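(* Let $R$ be a standard graded ring over an infinite field $k$ and let $I\subset R$ be a $d$-equigenerated homogeneous ideal of height $g$ and analytic deviation one (so its analytic spread is $\ell(I)=g+1$). Let $f_1,\ldots,f_g,f_{g+1}$ be forms in $[I]_d$ such that (a) the images of $f_1,\ldots,f_g$ in $I/I^2\subset \mathrm{gr}_I(R)$ form a regular sequence in $\mathrm{gr}_I(R)$; (b) $J=(f_1,\ldots,f_{g+1})$ is a reduction of $I$. Then the following are equivalent: (i) the sequence $f_1,\ldots,f_g,f_{g+1}$ is analytically tight; (ii) the special fiber $\mathcal{F}(I)$ is Cohen--Macaulay.
   Context: A standard graded ring over a field $k$ is a commutative graded $k$-algebra $R=\bigoplus_{i\ge 0}[R]_i$ with $[R]_0=k$, generated by finitely many elements of degree $1$; $\mathfrak{m}=([R]_1)$. A homogeneous ideal $I\subset\mathfrak m$ is $d$-equigenerated if it is minimally generated by forms all of the same degree $d$, i.e. $I=([I]_d)$, where $[\,\cdot\,]_j$ denotes the degree $j$ graded piece. $\mathcal{R}_R(I)=\bigoplus_{i\ge 0}I^it^i\subset R[t]$ is the Rees algebra, $\mathrm{gr}_I(R)=\mathcal{R}_R(I)/I\mathcal{R}_R(I)$ the associated graded ring, and $\mathcal{F}(I)=\mathcal{R}_R(I)/\mathfrak{m}\mathcal{R}_R(I)$ the special fiber; for $d$-equigenerated $I$ one has $\mathcal{F}(I)\simeq k[[I]_d]=\bigoplus_{n\ge 0}[I^n]_{nd}\subset R$. The analytic spread is $\ell(I)=\dim\mathcal{F}(I)$ and the analytic deviation is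 $\ell(I)-\mathrm{ht}\, I$. Definition. With $\ell=\ell(I)$, a sequence of forms $f_1,\ldots,f_\ell\in[I]_d$ is analytically tight in power $n$ if $$[((f_1,\ldots,f_{\ell-1}):f_\ell)\cap I^n]_{nd}=[(f_1,\ldots,f_{\ell-1})\cap I^n]_{nd}.$$ It is analytically tight if it is analytically tight in power $n$ for every $n\ge 1$. *)

theory Defs
  imports "HOL-Algebra.Algebra" "HOL-Library.Extended_Nat"
begin

subsection \<open>Standard graded rings\<close>

text \<open>
  A grading is a family \<open>G :: nat \<Rightarrow> 'a set\<close> of additive subgroups, and the coefficient field
  is literally the degree zero piece.
\<close>

locale standard_graded_ring = cring R
  for R :: "('a, 'b) ring_scheme" (structure) and k :: "'a set" and G :: "nat \<Rightarrow> 'a set" +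
  assumes subfield_k: "subfield k R"
    and degree_zero: "G 0 = k"
    and piece_subgroup: "additive_subgroup (G i) R"
    and piece_mult: "x \<in> G i \<Longrightarrow> y \<in> G j \<Longrightarrow> x \<otimes> y \<in> G (i + j)"
    and direct_sum: "x \<in> carrier R \<Longrightarrow>
      \<exists>!c. (\<forall>i. c i \<in> G i) \<and> finite {i. c i \<noteq> \<zero>} \<and> x = (\<Oplus>i\<in>{i. c i \<noteq> \<zero>}. c i)"
    and generated: "\<exists>S. finite S \<and> S \<subseteq> G 1 \<and> generate_ring R (k \<union> S) = carrier R"

definition irrelevant_ideal :: "('a, 'b) ring_scheme \<Rightarrow> (nat \<Rightarrow> 'a set) \<Rightarrow> 'a set"
  where "irrelevant_ideal R G = genideal R (G 1)"

definition homogeneous_ideal :: "('a, 'b) ring_scheme \<Rightarrow> (nat \<Rightarrow> 'a set) \<Rightarrow> 'a set \<Rightarrow> bool"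
  where "homogeneous_ideal R G I \<longleftrightarrow> ideal I R \<and> I = genideal R (I \<inter> (\<Union>i. G i))"

text \<open>For a homogeneous ideal \<open>L\<close>, the degree \<open>j\<close> piece of \<open>L\<close> is \<open>L \<inter> G j\<close>.\<close>

definition equigenerated_ideal ::
  "('a, 'b) ring_scheme \<Rightarrow> (nat \<Rightarrow> 'a set) \<Rightarrow> nat \<Rightarrow> 'a set \<Rightarrow> bool"
  where "equigenerated_ideal R G d I \<longleftrightarrow>
    homogeneous_ideal R G I \<and> I \<subseteq> irrelevant_ideal R G \<and> I = genideal R (I \<inter> G d)"


subsection \<open>Powers, colons and reductions of ideals\<close>

abbreviation ideal_power :: "('a, 'b) ring_scheme \<Rightarrow> 'a set \<Rightarrow> nat \<Rightarrow> 'a set"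
  where "ideal_power R I n \<equiv> I [^]\<^bsub>ideals_set R\<^esub> n"

definition colon :: "('a, 'b) ring_scheme \<Rightarrow> 'a set \<Rightarrow> 'a \<Rightarrow> 'a set"
  where "colon R L f = {x \<in> carrier R. x \<otimes>\<^bsub>R\<^esub> f \<in> L}"

definition reduction :: "('a, 'b) ring_scheme \<Rightarrow> 'a set \<Rightarrow> 'a set \<Rightarrow> bool"
  where "reduction R J I \<longleftrightarrow> ideal J R \<and> J \<subseteq> I \<and>
    (\<exists>n. ideal_power R I (Suc n) = ideal_prod R J (ideal_power R I n))"


subsection \<open>Dimension, height, depth and Cohen--Macaulay rings\<close>

definition prime_chain :: "('a, 'b) ring_scheme \<Rightarrow> nat \<Rightarrow> (nat \<Rightarrow> 'a set) \<Rightarrow> bool"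
  where "prime_chain A n P \<longleftrightarrow> (\<forall>i\<le>n. primeideal (P i) A) \<and> (\<forall>i<n. P i \<subset> P (Suc i))"

definition krull_dim :: "('a, 'b) ring_scheme \<Rightarrow> enat"
  where "krull_dim A = Sup {enat n |n. \<exists>P. prime_chain A n P}"

definition prime_height :: "('a, 'b) ring_scheme \<Rightarrow> 'a set \<Rightarrow> enat"
  where "prime_height A Q = Sup {enat n |n. \<exists>P. prime_chain A n P \<and> P n = Q}"

definition ideal_height :: "('a, 'b) ring_scheme \<Rightarrow> 'a set \<Rightarrow> enat"
  where "ideal_height A I = Inf {prime_height A Q |Q. primeideal Q A \<and> I \<subseteq> Q}"

definition regular_sequence :: "('a, 'b) ring_scheme \<Rightarrow> 'a list \<Rightarrow> bool"
  where "regular_sequence A xs \<longleftrightarrow> set xs \<subseteq> carrier A \<and>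
    (\<forall>i<length xs. \<forall>a\<in>carrier A.
       xs ! i \<otimes>\<^bsub>A\<^esub> a \<in> genideal A (set (take i xs)) \<longrightarrow> a \<in> genideal A (set (take i xs))) \<and>
    genideal A (set xs) \<noteq> carrier A"

definition depth :: "('a, 'b) ring_scheme \<Rightarrow> 'a set \<Rightarrow> enat"
  where "depth A Q = Sup {enat (length xs) |xs. set xs \<subseteq> Q \<and> regular_sequence A xs}"

text \<open>
  Eisenbud, \<^emph>\<open>Commutative Algebra with a View Toward Algebraic Geometry\<close>, Section 18.2:
  a Noetherian ring in which \<open>depth M = codim M\<close> for every maximal ideal \<open>M\<close>.
\<close>

definition cohen_macaulay :: "('a, 'b) ring_scheme \<Rightarrow> bool"
  where "cohen_macaulay A \<longleftrightarrow> cring A \<and> noetherian_ring A \<and>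
    (\<forall>M. maximalideal M A \<longrightarrow> depth A M = ideal_height A M)"


subsection \<open>Blowup algebras\<close>

text \<open>The Rees algebra is the subring of \<open>R[t]\<close> of polynomials whose \<open>i\<close>-th coefficient is in \<open>I^i\<close>.\<close>

definition rees_algebra :: "('a, 'b) ring_scheme \<Rightarrow> 'a set \<Rightarrow> ('a, nat \<Rightarrow> 'a) up_ring"
  where "rees_algebra R I = (UP R)\<lparr>carrier :=
    {p \<in> carrier (UP R). \<forall>i. coeff (UP R) p i \<in> ideal_power R I i}\<rparr>"

definition rees_extension :: "('a, 'b) ring_scheme \<Rightarrow> 'a set \<Rightarrow> 'a set \<Rightarrow> (nat \<Rightarrow> 'a) set"
  where "rees_extension R I L = genideal (rees_algebra R I) ((\<lambda>x. monom (UP R) x 0) ` L)"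

definition associated_graded_ring :: "('a, 'b) ring_scheme \<Rightarrow> 'a set \<Rightarrow> (nat \<Rightarrow> 'a) set ring"
  where "associated_graded_ring R I = rees_algebra R I Quot rees_extension R I I"

text \<open>
  For \<open>f \<in> I\<close>, the class of \<open>f\<close> in the degree one piece \<open>I/I\<^sup>2\<close> of the associated graded ring is
  the residue class of \<open>f t\<close>.
\<close>

definition degree_one_class :: "('a, 'b) ring_scheme \<Rightarrow> 'a set \<Rightarrow> 'a \<Rightarrow> (nat \<Rightarrow> 'a) set"
  where "degree_one_class R I f =
    rees_extension R I I +>\<^bsub>rees_algebra R I\<^esub> monom (UP R) f 1"

definition special_fiber ::
  "('a, 'b) ring_scheme \<Rightarrow> (nat \<Rightarrow> 'a set) \<Rightarrow> 'a set \<Rightarrow> (nat \<Rightarrow> 'a) set ring"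
  where "special_fiber R G I =
    rees_algebra R I Quot rees_extension R I (irrelevant_ideal R G)"

definition analytic_spread :: "('a, 'b) ring_scheme \<Rightarrow> (nat \<Rightarrow> 'a set) \<Rightarrow> 'a set \<Rightarrow> enat"
  where "analytic_spread R G I = krull_dim (special_fiber R G I)"

text \<open>
  Subtraction on \<^typ>\<open>enat\<close> truncates at zero; for a proper ideal of a Noetherian ring the height
  never exceeds the analytic spread, and in any case the value \<open>1\<close> is not affected by truncation.
\<close>

definition analytic_deviation :: "('a, 'b) ring_scheme \<Rightarrow> (nat \<Rightarrow> 'a set) \<Rightarrow> 'a set \<Rightarrow> enat"
  where "analytic_deviation R G I = analytic_spread R G I - ideal_height R I"


subsection \<open>Analytically tight sequences\<close>

definition analytically_tight_in_power ::
  "('a, 'b) ring_scheme \<Rightarrow> (nat \<Rightarrow> 'a set) \<Rightarrow> nat \<Rightarrow> 'a set \<Rightarrow> 'a list \<Rightarrow> nat \<Rightarrow> bool"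
  where "analytically_tight_in_power R G d I fs n \<longleftrightarrow>
    set fs \<subseteq> I \<inter> G d \<and> enat (length fs) = analytic_spread R G I \<and>
    colon R (genideal R (set (butlast fs))) (last fs) \<inter> ideal_power R I n \<inter> G (n * d) =
      genideal R (set (butlast fs)) \<inter> ideal_power R I n \<inter> G (n * d)"

definition analytically_tight ::
  "('a, 'b) ring_scheme \<Rightarrow> (nat \<Rightarrow> 'a set) \<Rightarrow> nat \<Rightarrow> 'a set \<Rightarrow> 'a list \<Rightarrow> bool"
  where "analytically_tight R G d I fs \<longleftrightarrow>
    (\<forall>n\<ge>1. analytically_tight_in_power R G d I fs n)"

end

theory Submission
  imports Defs
begin

text \<open>
  Write \<open>F = \<F>(I)\<close> for the special fiber and \<open>x\<^sub>i\<close> for the class of \<open>f\<^sub>i t\<close> in \<open>F\<close>. The class of an element of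
  \<open>I\<^sup>n t\<^sup>n\<close> in \<open>F\<close> is determined by its component of degree \<open>n d\<close>, because everything of larger degree in
  \<open>I\<^sup>n\<close> lies in \<open>R\<^sub>+ I\<^sup>n\<close>. Hence \<open>F\<close> is a standard graded ring over \<open>k\<close> with graded pieces
  \<open>[I\<^sup>n]\<^bsub>nd\<^esub>\<close> (lemma \<open>F_standard_graded\<close>), of dimension \<open>g + 1\<close> by the assumption on the analytic deviation.

  Both sides of the equivalence say that \<open>x\<^bsub>g+1\<^esub>\<close> is a nonzerodivisor modulo \<open>(x\<^sub>1, \<dots>, x\<^sub>g)\<close>.

  For tightness: hypothesis (a) gives the Valabrega--Valla equalities
  \<open>(f\<^sub>1, \<dots>, f\<^sub>g) \<inter> I\<^bsup>n+1\<^esup> = (f\<^sub>1, \<dots>, f\<^sub>g) I\<^sup>n\<close> (lemma \<open>genideal_inter_Ipow\<close>). In degree \<open>(n + 1) d\<close> they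
  say that a form of \<open>I\<^bsup>n+1\<^esup>\<close> lies in \<open>(f\<^sub>1, \<dots>, f\<^sub>g)\<close> exactly if its class lies in
  \<open>(x\<^sub>1, \<dots>, x\<^sub>g)\<close>. So tightness in all powers \<open>n \<ge> 1\<close> is injectivity of multiplication by \<open>x\<^bsub>g+1\<^esub>\<close> on
  \<open>F/(x\<^sub>1, \<dots>, x\<^sub>g)\<close> in positive degrees, and in degree zero it is injective because
  \<open>x\<^bsub>g+1\<^esub>\<close> is not in \<open>(x\<^sub>1, \<dots>, x\<^sub>g)\<close>, by dimension. The same lowest-degree argument turns (a) into regularity
  of \<open>x\<^sub>1, \<dots>, x\<^sub>g\<close> in \<open>F\<close> (lemma \<open>regular_mod_cls\<close>), and (b) says that
  \<open>(x\<^sub>1, \<dots>, x\<^bsub>g+1\<^esub>)\<close> contains all forms of \<open>F\<close> of large degree.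

  For the Cohen--Macaulay property this is a statement about any standard graded ring \<open>A\<close> of dimension
  \<open>g + 1\<close> over an infinite field with such elements (theorem \<open>cohen_macaulay_iff_nonzerodivisor\<close>).

  If \<open>x\<^sub>1, \<dots>, x\<^bsub>g+1\<^esub>\<close> is regular, then every maximal ideal \<open>M\<close> has depth at least \<open>g + 1\<close>, also if it is
  not homogeneous: by the Nullstellensatz \<open>M\<close> contains a monic polynomial in each \<open>x\<^sub>i\<close>, the
  top-degree forms of these are powers of the \<open>x\<^sub>i\<close>, which are again a regular sequence, and regularity lifts from
  top-degree forms to the elements themselves (lemma \<open>length_le_depth_maximalideal\<close>). Since depth is at most
  height and height is at most \<open>dim A = g + 1\<close>, equality holds throughout.

  If \<open>x\<^bsub>g+1\<^esub>\<close> is a zerodivisor modulo the regular sequence \<open>x\<^sub>1, \<dots>, x\<^sub>g\<close>, then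
  \<open>A/(x\<^sub>1, \<dots>, x\<^sub>g)\<close> has a nonzero element killed by \<open>A\<^sub>+\<close>, because \<open>x\<^bsub>g+1\<^esub>\<close> generates an ideal of this
  ring that contains all forms of large degree. An exchange argument then bounds every regular sequence in \<open>A\<^sub>+\<close> by
  \<open>g\<close> (theorem \<open>regular_mod_length_le_of_socle\<close>). On the other hand \<open>A\<^sub>+\<close> has height at least \<open>g + 1\<close>:
  counting dimensions shows that \<open>g\<close> linear forms whose ideal contains all forms of large degree force
  \<open>dim A \<le> g\<close> (theorem \<open>krull_dim_le_parameters\<close>), so \<open>x\<^bsub>g+1\<^esub>\<close> is not nilpotent modulo
  \<open>(x\<^sub>1, \<dots>, x\<^sub>g)\<close>, and there is a prime strictly below \<open>A\<^sub>+\<close> that contains this regular sequence.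
\<close>

section \<open>Regular sequences modulo an ideal\<close>

lemma (in ring) ideal_ops:
  assumes "ideal Q R"
  shows "Q \<subseteq> carrier R" "\<zero> \<in> Q" "\<And>a b. a \<in> Q \<Longrightarrow> b \<in> Q \<Longrightarrow> a \<oplus> b \<in> Q"
    "\<And>a b. a \<in> Q \<Longrightarrow> b \<in> Q \<Longrightarrow> a \<ominus> b \<in> Q" "\<And>a. a \<in> Q \<Longrightarrow> \<ominus> a \<in> Q"
    "\<And>a r. a \<in> Q \<Longrightarrow> r \<in> carrier R \<Longrightarrow> r \<otimes> a \<in> Q"
    "\<And>a r. a \<in> Q \<Longrightarrow> r \<in> carrier R \<Longrightarrow> a \<otimes> r \<in> Q"
    "\<And>a. a \<in> Q \<Longrightarrow> a \<in> carrier R"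
proof -
  interpret ideal Q R by fact
  show "Q \<subseteq> carrier R" "\<zero> \<in> Q" by (auto simp: a_subset)
  show "\<And>a b. a \<in> Q \<Longrightarrow> b \<in> Q \<Longrightarrow> a \<oplus> b \<in> Q" by simp
  show "\<And>a b. a \<in> Q \<Longrightarrow> b \<in> Q \<Longrightarrow> a \<ominus> b \<in> Q" by (simp add: a_minus_def)
  show "\<And>a. a \<in> Q \<Longrightarrow> \<ominus> a \<in> Q" by simp
  show "\<And>a r. a \<in> Q \<Longrightarrow> r \<in> carrier R \<Longrightarrow> r \<otimes> a \<in> Q" by (simp add: I_l_closed)
  show "\<And>a r. a \<in> Q \<Longrightarrow> r \<in> carrier R \<Longrightarrow> a \<otimes> r \<in> Q" by (simp add: I_r_closed)
  show "\<And>a. a \<in> Q \<Longrightarrow> a \<in> carrier R" by (simp add: Icarr)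
qed

lemma (in cring) idealI_simple:
  assumes "Q \<subseteq> carrier R" "\<zero> \<in> Q" "\<And>a b. a \<in> Q \<Longrightarrow> b \<in> Q \<Longrightarrow> a \<oplus> b \<in> Q"
    "\<And>a r. a \<in> Q \<Longrightarrow> r \<in> carrier R \<Longrightarrow> r \<otimes> a \<in> Q"
  shows "ideal Q R"
proof (rule idealI)
  show "ring R" by (rule ring_axioms)
  show "subgroup Q (add_monoid R)"
  proof (rule add.subgroupI)
    fix a assume a: "a \<in> Q"
    hence "\<ominus> a = (\<ominus> \<one>) \<otimes> a" using assms(1) by (simp add: l_minus subsetD)
    thus "\<ominus> a \<in> Q" using assms(4)[OF a, of "\<ominus> \<one>"] by simp
  qed (use assms in auto)
  fix a x assume "a \<in> Q" "x \<in> carrier R"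
  thus "x \<otimes> a \<in> Q" "a \<otimes> x \<in> Q" using assms(1,4) m_comm by (auto simp: subset_iff)
qed

definition (in ring) adjoin :: "'a set \<Rightarrow> 'a \<Rightarrow> 'a set"
  where "adjoin Q x = {q \<oplus> x \<otimes> r | q r. q \<in> Q \<and> r \<in> carrier R}"

definition (in ring) nonzerodivisor_mod :: "'a set \<Rightarrow> 'a \<Rightarrow> bool"
  where "nonzerodivisor_mod Q x \<longleftrightarrow> (\<forall>a\<in>carrier R. x \<otimes> a \<in> Q \<longrightarrow> a \<in> Q)"

text \<open>
  In contrast to a regular sequence, the ideal generated is allowed to be the whole ring. This makes the notion a plain
  recursion over the list, which moves the ideal \<open>Q\<close> along; properness enters only in \<open>regular_sequence_iff\<close>.
\<close>

fun (in ring) regular_mod :: "'a set \<Rightarrow> 'a list \<Rightarrow> bool" where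
  "regular_mod Q [] = True"
| "regular_mod Q (x # xs) = (nonzerodivisor_mod Q x \<and> regular_mod (adjoin Q x) xs)"

abbreviation (in ring) adjoin_list :: "'a set \<Rightarrow> 'a list \<Rightarrow> 'a set"
  where "adjoin_list Q xs \<equiv> foldl adjoin Q xs"

context cring
begin

lemma adjoinI: "q \<in> Q \<Longrightarrow> r \<in> carrier R \<Longrightarrow> q \<oplus> x \<otimes> r \<in> adjoin Q x"
  unfolding adjoin_def by blast

lemma adjoinE:
  assumes "a \<in> adjoin Q x" obtains q r where "q \<in> Q" "r \<in> carrier R" "a = q \<oplus> x \<otimes> r"
  using assms unfolding adjoin_def by blast

lemma adjoin_ideal:
  assumes Q: "ideal Q R" and x: "x \<in> carrier R" shows "ideal (adjoin Q x) R"
proof (rule idealI_simple)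
  note [simp] = ideal_ops[OF Q]
  show "adjoin Q x \<subseteq> carrier R" using x by (auto simp: adjoin_def)
  show "\<zero> \<in> adjoin Q x" using adjoinI[of \<zero> Q \<zero> x] x by simp
  fix a assume "a \<in> adjoin Q x"
  then obtain q r where a: "q \<in> Q" "r \<in> carrier R" "a = q \<oplus> x \<otimes> r" by (rule adjoinE)
  have qc: "q \<in> carrier R" using a by simp
  { fix b assume "b \<in> adjoin Q x"
    then obtain q' r' where b: "q' \<in> Q" "r' \<in> carrier R" "b = q' \<oplus> x \<otimes> r'" by (rule adjoinE)
    have qc': "q' \<in> carrier R" using b by simp
    have "a \<oplus> b = (q \<oplus> q') \<oplus> x \<otimes> (r \<oplus> r')" using a(2,3) b(2,3) qc qc' x by algebra
    thus "a \<oplus> b \<in> adjoin Q x" using a b adjoinI[of "q \<oplus> q'" Q "r \<oplus> r'" x] by simp }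
  { fix s assume s: "s \<in> carrier R"
    have "s \<otimes> a = s \<otimes> q \<oplus> x \<otimes> (s \<otimes> r)" using a(2,3) qc x s by algebra
    thus "s \<otimes> a \<in> adjoin Q x" using a s adjoinI[of "s \<otimes> q" Q "s \<otimes> r" x] by simp }
qed

lemma adjoin_superset:
  assumes Q: "ideal Q R" and x: "x \<in> carrier R" shows "Q \<subseteq> adjoin Q x" "x \<in> adjoin Q x"
proof -
  note [simp] = ideal_ops[OF Q]
  show "Q \<subseteq> adjoin Q x" using adjoinI[of _ Q \<zero> x] x by fastforce
  show "x \<in> adjoin Q x" using adjoinI[of \<zero> Q \<one> x] x by simp
qed

lemma adjoin_least:
  assumes "ideal P R" "Q \<subseteq> P" "x \<in> P" shows "adjoin Q x \<subseteq> P"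
  using ideal_ops[OF assms(1)] assms by (auto elim!: adjoinE)

lemma adjoin_list_ideal:
  assumes "ideal Q R" and "set xs \<subseteq> carrier R" shows "ideal (adjoin_list Q xs) R"
  using assms by (induction xs arbitrary: Q) (auto simp: adjoin_ideal)

lemma adjoin_list_superset:
  assumes "ideal Q R" and "set xs \<subseteq> carrier R" shows "Q \<union> set xs \<subseteq> adjoin_list Q xs"
  using assms
proof (induction xs arbitrary: Q)
  case (Cons x xs)
  from Cons.IH[OF adjoin_ideal[OF Cons.prems(1), of x]] Cons.prems
    adjoin_superset[OF Cons.prems(1), of x]
  show ?case by auto
qed simp

lemma adjoin_list_least:
  assumes "ideal P R" "Q \<subseteq> P" "set xs \<subseteq> P" shows "adjoin_list Q xs \<subseteq> P"
  using assms by (induction xs arbitrary: Q) (auto simp: adjoin_least)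

lemma adjoin_list_eq_genideal:
  assumes Q: "ideal Q R" and xs: "set xs \<subseteq> carrier R"
  shows "adjoin_list Q xs = Idl (Q \<union> set xs)"
proof
  have c: "Q \<union> set xs \<subseteq> carrier R" using ideal_ops[OF Q] xs by auto
  show "adjoin_list Q xs \<subseteq> Idl (Q \<union> set xs)"
    using genideal_self[OF c] by (intro adjoin_list_least genideal_ideal[OF c]) auto
  show "Idl (Q \<union> set xs) \<subseteq> adjoin_list Q xs"
    using adjoin_list_superset[OF Q xs] by (intro genideal_minimal adjoin_list_ideal Q xs) auto
qed

lemma adjoin_list_zero:
  assumes "set xs \<subseteq> carrier R" shows "adjoin_list {\<zero>} xs = Idl (set xs)"
proof -
  have i: "ideal (Idl (set xs)) R" using assms by (rule genideal_ideal)
  have "Idl ({\<zero>} \<union> set xs) = Idl (set xs)"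
  proof
    show "Idl ({\<zero>} \<union> set xs) \<subseteq> Idl (set xs)"
      using ideal_ops[OF i] genideal_self[OF assms] by (intro genideal_minimal i) auto
    show "Idl (set xs) \<subseteq> Idl ({\<zero>} \<union> set xs)" using assms by (intro subset_Idl_subset) auto
  qed
  thus ?thesis using adjoin_list_eq_genideal[OF zeroideal assms] by simp
qed

lemma adjoin_commute:
  assumes "ideal Q R" "x \<in> carrier R" "y \<in> carrier R"
  shows "adjoin (adjoin Q x) y = adjoin (adjoin Q y) x"
  using adjoin_list_eq_genideal[OF assms(1), of "[x,y]"]
    adjoin_list_eq_genideal[OF assms(1), of "[y,x]"] assms by (simp add: insert_commute)

lemma regular_mod_append:
  "regular_mod Q (xs @ ys) \<longleftrightarrow> regular_mod Q xs \<and> regular_mod (adjoin_list Q xs) ys"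
  by (induction xs arbitrary: Q) auto

lemma regular_mod_iff_nth:
  "regular_mod Q xs \<longleftrightarrow>
    (\<forall>i<length xs. nonzerodivisor_mod (adjoin_list Q (take i xs)) (xs ! i))"
proof (induction xs arbitrary: Q)
  case (Cons x xs)
  show ?case unfolding regular_mod.simps Cons.IH by (simp add: All_less_Suc2)
qed simp

lemma regular_sequence_iff:
  "regular_sequence R xs \<longleftrightarrow>
    set xs \<subseteq> carrier R \<and> regular_mod {\<zero>} xs \<and> adjoin_list {\<zero>} xs \<noteq> carrier R"
proof (cases "set xs \<subseteq> carrier R")
  case True
  have t: "adjoin_list {\<zero>} (take i xs) = Idl (set (take i xs))" for i
    using True set_take_subset[of i xs] by (intro adjoin_list_zero) auto
  show ?thesis
    unfolding regular_sequence_def regular_mod_iff_nth t adjoin_list_zero[OF True]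
      nonzerodivisor_mod_def by blast
qed (simp add: regular_sequence_def)

end

section \<open>Prime chains below regular sequences\<close>

text \<open>
  Krull: take \<open>P\<close> maximal among the ideals containing \<open>Q\<close> and disjoint from \<open>W\<close>. If neither \<open>a\<close> nor \<open>b\<close> is in
  \<open>P\<close>, then \<open>P + (a)\<close> and \<open>P + (b)\<close> both meet \<open>W\<close>, and so does \<open>P + (a b)\<close>.
\<close>

lemma (in cring) primeideal_avoiding:
  assumes Q: "ideal Q R" and one: "\<one> \<in> W" and W: "W \<subseteq> carrier R"
    and mult: "\<And>a b. a \<in> W \<Longrightarrow> b \<in> W \<Longrightarrow> a \<otimes> b \<in> W" and disj: "Q \<inter> W = {}"
  shows "\<exists>P. primeideal P R \<and> Q \<subseteq> P \<and> P \<inter> W = {}"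
proof -
  define A where "A = {I. ideal I R \<and> Q \<subseteq> I \<and> I \<inter> W = {}}"
  have "\<exists>M\<in>A. \<forall>Z\<in>A. M \<subseteq> Z \<longrightarrow> Z = M"
  proof (rule subset_Zorn_nonempty)
    show "A \<noteq> {}" using Q disj by (auto simp: A_def)
    fix C assume C: "C \<noteq> {}" "subset.chain A C"
    hence CA: "C \<subseteq> A" by (simp add: pred_on.chain_def)
    have "subset.chain {I. ideal I R} C"
      using C(2) unfolding pred_on.chain_def A_def by blast
    from chain_Union_is_ideal[OF this] have "ideal (\<Union>C) R" using C(1) by simp
    moreover have "Q \<subseteq> \<Union>C" using C(1) CA unfolding A_def by blast
    moreover have "\<Union>C \<inter> W = {}" using CA unfolding A_def by blast
    ultimately show "\<Union>C \<in> A" by (simp add: A_def)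
  qed
  then obtain P where P: "P \<in> A" and max: "\<And>Z. Z \<in> A \<Longrightarrow> P \<subseteq> Z \<Longrightarrow> Z = P" by blast
  have iP: "ideal P R" and QP: "Q \<subseteq> P" and PW: "P \<inter> W = {}" using P by (auto simp: A_def)
  note [simp] = ideal_ops[OF iP]
  have ext: "\<exists>p r. p \<in> P \<and> r \<in> carrier R \<and> p \<oplus> a \<otimes> r \<in> W" if a: "a \<in> carrier R" "a \<notin> P" for a
  proof (rule ccontr)
    assume "\<not> ?thesis"
    hence "adjoin P a \<inter> W = {}" unfolding adjoin_def by blast
    hence "adjoin P a \<in> A"
      using adjoin_ideal[OF iP a(1)] adjoin_superset[OF iP a(1)] QP by (auto simp: A_def)
    thus False using max adjoin_superset[OF iP a(1)] a(2) by blast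
  qed
  have "primeideal P R"
  proof (rule primeidealI)
    show "carrier R \<noteq> P" using PW one by auto
    fix a b assume ab: "a \<in> carrier R" "b \<in> carrier R" "a \<otimes> b \<in> P"
    show "a \<in> P \<or> b \<in> P"
    proof (rule ccontr)
      assume n: "\<not> ?thesis"
      obtain p r where 1: "p \<in> P" "r \<in> carrier R" "p \<oplus> a \<otimes> r \<in> W" using ext ab n by blast
      obtain q s where 2: "q \<in> P" "s \<in> carrier R" "q \<oplus> b \<otimes> s \<in> W" using ext ab n by blast
      have c: "p \<in> carrier R" "q \<in> carrier R" using 1 2 by auto
      have "(p \<oplus> a \<otimes> r) \<otimes> (q \<oplus> b \<otimes> s) =
        p \<otimes> (q \<oplus> b \<otimes> s) \<oplus> (q \<otimes> (a \<otimes> r) \<oplus> (a \<otimes> b) \<otimes> (r \<otimes> s))"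
        using c 1(2) 2(2) ab(1,2) by algebra
      also have "\<dots> \<in> P" using 1(1,2) 2(1,2) ab c by simp
      finally show False using mult[OF 1(3) 2(3)] PW by blast
    qed
  qed (use iP is_cring in auto)
  thus ?thesis using QP PW by blast
qed

text \<open>
  The prime is found by avoiding the multiplicative set of all \<open>y\<^sup>i b\<close> with \<open>b \<notin> P\<close>: its elements \<open>b\<close> keep the
  prime inside \<open>P\<close>, and its element \<open>y\<close> keeps \<open>y\<close> out.
\<close>

lemma (in cring) primeideal_omitting:
  assumes Q: "ideal Q R" and P: "primeideal P R" and y: "y \<in> carrier R"
    and notin: "\<And>i b. b \<in> carrier R - P \<Longrightarrow> y [^] (i::nat) \<otimes> b \<notin> Q"
  shows "\<exists>P'. primeideal P' R \<and> Q \<subseteq> P' \<and> P' \<subseteq> P \<and> y \<notin> P'"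
proof -
  interpret P: primeideal P R by fact
  define W where "W = {y [^] i \<otimes> b | i b. (i::nat) \<in> UNIV \<and> b \<in> carrier R - P}"
  have o: "\<one> \<notin> P" using P.I_notcarr P.one_imp_carrier by blast
  have WI: "y [^] (i::nat) \<otimes> b \<in> W" if "b \<in> carrier R" "b \<notin> P" for i b
    using that unfolding W_def by blast
  have "\<exists>P'. primeideal P' R \<and> Q \<subseteq> P' \<and> P' \<inter> W = {}"
  proof (rule primeideal_avoiding[OF Q])
    show "\<one> \<in> W" using WI[OF _ o, of 0] by simp
    show "W \<subseteq> carrier R" using y by (auto simp: W_def)
    fix a b assume "a \<in> W" "b \<in> W"
    then obtain i c j e where a: "a = y [^] (i::nat) \<otimes> c" "c \<in> carrier R" "c \<notin> P"
      and b: "b = y [^] (j::nat) \<otimes> e" "e \<in> carrier R" "e \<notin> P" unfolding W_def by blast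
    have "a \<otimes> b = y [^] (i + j) \<otimes> (c \<otimes> e)"
      using a b y by (simp add: nat_pow_mult[symmetric] m_ac)
    moreover have "c \<otimes> e \<notin> P" using P.I_prime a b by blast
    ultimately show "a \<otimes> b \<in> W" using WI a b by simp
  next
    show "Q \<inter> W = {}" unfolding W_def using notin by blast
  qed
  then obtain P' where P': "primeideal P' R" "Q \<subseteq> P'" "P' \<inter> W = {}" by blast
  have "P' \<subseteq> carrier R" using P'(1) by (intro ideal_ops(1) primeideal.axioms(1))
  moreover have "b \<in> W" if "b \<in> carrier R" "b \<notin> P" for b using WI[OF that, of 0] that by simp
  ultimately have "P' \<subseteq> P" using P'(3) by blast
  note sub = this
  have "y [^] (1::nat) \<otimes> \<one> \<in> W" by (rule WI[OF one_closed o])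
  hence "y \<in> W" using y by simp
  hence "y \<notin> P'" using P'(3) by blast
  have "primeideal P' R \<and> Q \<subseteq> P' \<and> P' \<subseteq> P \<and> y \<notin> P'" using P'(1) P'(2) sub \<open>y \<notin> P'\<close> by (intro conjI)
  thus ?thesis by (rule exI[of _ P'])
qed

lemma (in cring) primeideal_omitting_nonzerodivisor:
  assumes Q: "ideal Q R" and P: "primeideal P R" and QP: "Q \<subseteq> P"
    and y: "y \<in> carrier R" and nzd: "nonzerodivisor_mod Q y"
  shows "\<exists>P'. primeideal P' R \<and> Q \<subseteq> P' \<and> P' \<subseteq> P \<and> y \<notin> P'"
proof (rule primeideal_omitting[OF Q P y])
  have cancel: "b \<in> Q" if "b \<in> carrier R" "y [^] (i::nat) \<otimes> b \<in> Q" for i b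
    using that
  proof (induction i arbitrary: b)
    case (Suc i)
    have "y [^] i \<otimes> (y \<otimes> b) \<in> Q" using Suc.prems y by (simp add: m_assoc)
    hence "y \<otimes> b \<in> Q" using Suc.IH Suc.prems y by simp
    thus ?case using nzd Suc.prems by (auto simp: nonzerodivisor_mod_def)
  qed simp
  fix i :: nat and b assume "b \<in> carrier R - P"
  thus "y [^] i \<otimes> b \<notin> Q" using cancel QP by blast
qed

text \<open>
  The chain is built downwards from \<open>P\<close>: the last member \<open>y\<close> of the sequence is a nonzerodivisor modulo the ideal of the
  others, so these lie in a prime inside \<open>P\<close> that omits \<open>y\<close>.
\<close>

lemma (in cring) regular_mod_imp_prime_chain:
  assumes "ideal Q R" "set ys \<subseteq> P" "Q \<subseteq> P" "primeideal P R" "regular_mod Q ys"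
  shows "\<exists>C. prime_chain R (length ys) C \<and> C (length ys) = P"
  using assms
proof (induction ys arbitrary: P rule: rev_induct)
  case Nil
  hence "prime_chain R 0 (\<lambda>_. P)" by (simp add: prime_chain_def)
  thus ?case by auto
next
  case (snoc y ys)
  have Pi: "ideal P R" using snoc.prems by (simp add: primeideal.axioms(1))
  have Pc: "P \<subseteq> carrier R" using ideal_ops[OF Pi] by simp
  define Q' where "Q' = adjoin_list Q ys"
  have yc: "set ys \<subseteq> carrier R" "y \<in> carrier R" using snoc.prems Pc by auto
  have Q'i: "ideal Q' R" unfolding Q'_def by (rule adjoin_list_ideal[OF snoc.prems(1) yc(1)])
  have Q'sup: "Q \<union> set ys \<subseteq> Q'" unfolding Q'_def by (rule adjoin_list_superset[OF snoc.prems(1) yc(1)])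
  have Q'P: "Q' \<subseteq> P" unfolding Q'_def using snoc.prems by (intro adjoin_list_least[OF Pi]) auto
  note Q' = Q'i Q'sup Q'P
  have reg: "regular_mod Q ys" "nonzerodivisor_mod Q' y"
    using snoc.prems by (auto simp: regular_mod_append Q'_def)
  obtain P' where P': "primeideal P' R" "Q' \<subseteq> P'" "P' \<subseteq> P" "y \<notin> P'"
    using primeideal_omitting_nonzerodivisor[OF Q'(1) snoc.prems(4) Q'(3) yc(2) reg(2)] by blast
  have "set ys \<subseteq> P'" "Q \<subseteq> P'" using Q'sup P'(2) by auto
  from snoc.IH[OF snoc.prems(1) this P'(1) reg(1)]
  obtain C where C: "prime_chain R (length ys) C" "C (length ys) = P'" by (elim exE conjE)
  define C' where "C' = (\<lambda>i. if i \<le> length ys then C i else P)"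
  have lt: "P' \<subset> P" using P'(3,4) snoc.prems(2) by auto
  have "prime_chain R (Suc (length ys)) C'"
    unfolding prime_chain_def
  proof (intro conjI allI impI)
    fix i assume "i \<le> Suc (length ys)"
    thus "primeideal (C' i) R" using C(1) snoc.prems(4) by (simp add: prime_chain_def C'_def)
  next
    fix i assume "i < Suc (length ys)"
    thus "C' i \<subset> C' (Suc i)" using C lt by (cases "i = length ys") (simp_all add: prime_chain_def C'_def)
  qed
  hence "prime_chain R (length (ys @ [y])) C' \<and> C' (length (ys @ [y])) = P" by (simp add: C'_def)
  thus ?case by (rule exI[of _ C'])
qed

lemma (in cring) depth_le_ideal_height: "depth R M \<le> ideal_height R M"
  unfolding depth_def ideal_height_def
proof (rule Sup_least, rule Inf_greatest, clarify)
  fix xs Q assume xs: "set xs \<subseteq> M" "regular_sequence R xs" and Q: "primeideal Q R" "M \<subseteq> Q"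
  have iQ: "ideal Q R" using Q by (simp add: primeideal.axioms(1))
  have "\<exists>C. prime_chain R (length xs) C \<and> C (length xs) = Q"
    using xs Q ideal_ops(2)[OF iQ] zeroideal
    by (intro regular_mod_imp_prime_chain[of "{\<zero>}"]) (auto simp: regular_sequence_iff)
  thus "enat (length xs) \<le> prime_height R Q"
    unfolding prime_height_def by (intro Sup_upper) blast
qed

lemma ideal_height_le_krull_dim:
  assumes "primeideal Q A" shows "ideal_height A Q \<le> krull_dim A"
proof -
  have "ideal_height A Q \<le> prime_height A Q"
    unfolding ideal_height_def using assms by (intro Inf_lower) auto
  also have "\<dots> \<le> krull_dim A" unfolding prime_height_def krull_dim_def
    by (intro Sup_subset_mono) auto
  finally show ?thesis .
qed

section \<open>The Hilbert basis theorem\<close>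

text \<open>
  The polynomial expressions in \<open>x\<close> of degree less than \<open>n\<close> with coefficients in \<open>S\<close>. They are elements of the ring, and
  \<open>x\<close> may satisfy relations over \<open>S\<close>, so degree and leading coefficient belong to an expression and not to its value.
\<close>

primrec poly_below :: "('a, 'b) ring_scheme \<Rightarrow> 'a set \<Rightarrow> 'a \<Rightarrow> nat \<Rightarrow> 'a set" where
  "poly_below R S x 0 = {\<zero>\<^bsub>R\<^esub>}"
| "poly_below R S x (Suc n) =
    {v \<oplus>\<^bsub>R\<^esub> s \<otimes>\<^bsub>R\<^esub> x [^]\<^bsub>R\<^esub> n | v s. v \<in> poly_below R S x n \<and> s \<in> S}"

context cring
begin

lemma poly_belowI: "v \<in> poly_below R S x n \<Longrightarrow> s \<in> S \<Longrightarrow> v \<oplus> s \<otimes> x [^] n \<in> poly_below R S x (Suc n)"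
  by auto

context
  fixes S x assumes S: "subring S R" and x: "x \<in> carrier R"
begin

lemma poly_below_carrier: "poly_below R S x n \<subseteq> carrier R"
  using subringE(1)[OF S] x by (induction n) auto

lemma poly_below_zero: "\<zero> \<in> poly_below R S x n"
proof (induction n)
  case (Suc n)
  from poly_belowI[OF Suc subringE(2)[OF S]] show ?case using x by simp
qed simp

lemma poly_below_mono: "m \<le> n \<Longrightarrow> poly_below R S x m \<subseteq> poly_below R S x n"
proof (induction n)
  case (Suc n)
  have "poly_below R S x n \<subseteq> poly_below R S x (Suc n)"
  proof
    fix v assume v: "v \<in> poly_below R S x n"
    hence "v \<oplus> \<zero> \<otimes> x [^] n = v" using poly_below_carrier[of n] x by (simp add: subset_iff)
    thus "v \<in> poly_below R S x (Suc n)" using poly_belowI[OF v subringE(2)[OF S]] by simp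
  qed
  thus ?case using Suc by (cases "m = Suc n") auto
qed simp

lemma poly_below_add:
  "u \<in> poly_below R S x n \<Longrightarrow> v \<in> poly_below R S x n \<Longrightarrow> u \<oplus> v \<in> poly_below R S x n"
proof (induction n arbitrary: u v)
  case (Suc n)
  from Suc.prems(1) obtain u' s where u: "u' \<in> poly_below R S x n" "s \<in> S" "u = u' \<oplus> s \<otimes> x [^] n"
    by auto
  from Suc.prems(2) obtain v' t where v: "v' \<in> poly_below R S x n" "t \<in> S" "v = v' \<oplus> t \<otimes> x [^] n"
    by auto
  have c: "u' \<in> carrier R" "v' \<in> carrier R" "s \<in> carrier R" "t \<in> carrier R" "x [^] n \<in> carrier R"
    using u v poly_below_carrier[of n] subringE(1)[OF S] x by (auto simp: subset_iff)
  have "u \<oplus> v = (u' \<oplus> v') \<oplus> (s \<oplus> t) \<otimes> x [^] n" unfolding u(3) v(3) using c by algebra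
  thus ?case using poly_belowI[OF Suc.IH[OF u(1) v(1)] subringE(7)[OF S u(2) v(2)]] by simp
qed simp

lemma poly_below_smult: "v \<in> poly_below R S x n \<Longrightarrow> t \<in> S \<Longrightarrow> t \<otimes> v \<in> poly_below R S x n"
proof (induction n arbitrary: v)
  case 0 thus ?case using subringE(1)[OF S] by auto
next
  case (Suc n)
  from Suc.prems(1) obtain v' s where v: "v' \<in> poly_below R S x n" "s \<in> S" "v = v' \<oplus> s \<otimes> x [^] n"
    by auto
  have c: "v' \<in> carrier R" "s \<in> carrier R" "t \<in> carrier R" "x [^] n \<in> carrier R"
    using v poly_below_carrier[of n] subringE(1)[OF S] x Suc.prems by (auto simp: subset_iff)
  have "t \<otimes> v = t \<otimes> v' \<oplus> (t \<otimes> s) \<otimes> x [^] n" unfolding v(3) using c by algebra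
  thus ?case using poly_belowI[OF Suc.IH[OF v(1) Suc.prems(2)] subringE(6)[OF S Suc.prems(2) v(2)]] by simp
qed

lemma poly_below_uminus: 
  assumes "v \<in> poly_below R S x n" shows "\<ominus> v \<in> poly_below R S x n"
proof -
  have "\<ominus> \<one> \<otimes> v = \<ominus> v" using assms poly_below_carrier[of n] by (simp add: l_minus subset_iff)
  thus ?thesis using poly_below_smult[OF assms subringE(5)[OF S subringE(3)[OF S]]] by simp
qed

lemma poly_below_pow: "v \<in> poly_below R S x n \<Longrightarrow> x [^] (i::nat) \<otimes> v \<in> poly_below R S x (i + n)"
proof (induction n arbitrary: v)
  case 0 thus ?case using x poly_below_zero by simp
next
  case (Suc n)
  from Suc.prems obtain v' s where v: "v' \<in> poly_below R S x n" "s \<in> S" "v = v' \<oplus> s \<otimes> x [^] n"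
    by auto
  have c: "v' \<in> carrier R" "s \<in> carrier R" "x [^] i \<in> carrier R" "x [^] n \<in> carrier R"
    using v poly_below_carrier[of n] subringE(1)[OF S] x by (auto simp: subset_iff)
  have "x [^] i \<otimes> v = x [^] i \<otimes> v' \<oplus> s \<otimes> (x [^] i \<otimes> x [^] n)" unfolding v(3) using c by algebra
  also have "x [^] i \<otimes> x [^] n = x [^] (i + n)" using x by (simp add: nat_pow_mult)
  finally show ?case using poly_belowI[OF Suc.IH[OF v(1)] v(2)] by simp
qed

lemma poly_below_mult:
  "u \<in> poly_below R S x m \<Longrightarrow> v \<in> poly_below R S x n \<Longrightarrow> u \<otimes> v \<in> poly_below R S x (m + n)"
proof (induction m arbitrary: u)
  case 0 thus ?case using poly_below_carrier[of n] poly_below_zero by (auto simp: subset_iff)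
next
  case (Suc m)
  from Suc.prems obtain u' s where u: "u' \<in> poly_below R S x m" "s \<in> S" "u = u' \<oplus> s \<otimes> x [^] m"
    by auto
  have c: "u' \<in> carrier R" "s \<in> carrier R" "x [^] m \<in> carrier R" "v \<in> carrier R"
    using u poly_below_carrier[of n] poly_below_carrier[of m] subringE(1)[OF S] x Suc.prems(2)
    by (auto simp: subset_iff)
  have "u \<otimes> v = u' \<otimes> v \<oplus> s \<otimes> (x [^] m \<otimes> v)" unfolding u(3) using c by algebra
  also have "\<dots> \<in> poly_below R S x (m + n)"
    by (intro poly_below_add poly_below_smult poly_below_pow Suc.IH u Suc.prems(2))
  finally show ?case using poly_below_mono[of "m + n" "Suc m + n"] by auto
qed

lemma generate_ring_insert_poly_below:
  "generate_ring R (insert x S) \<subseteq> (\<Union>n. poly_below R S x n)" (is "_ \<subseteq> ?U")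
proof (rule generate_ring_min_subring1)
  show "insert x S \<subseteq> carrier R" using x subringE(1)[OF S] by auto
  have S1: "S \<subseteq> poly_below R S x 1"
  proof
    fix s assume s: "s \<in> S"
    hence "\<zero> \<oplus> s \<otimes> x [^] (0::nat) \<in> poly_below R S x (Suc 0)" by (intro poly_belowI) auto
    thus "s \<in> poly_below R S x 1" using subringE(1)[OF S] s by (auto simp: subset_iff)
  qed
  have "\<zero> \<oplus> \<one> \<otimes> x [^] (1::nat) \<in> poly_below R S x (Suc 1)"
    by (intro poly_belowI poly_below_zero subringE(3)[OF S])
  hence "x \<in> poly_below R S x (Suc 1)" using x by simp
  thus "insert x S \<subseteq> ?U" using S1 by blast
  show "subring ?U R"
  proof (rule subringI)
    show "?U \<subseteq> carrier R" using poly_below_carrier by blast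
    show "\<one> \<in> ?U" using S1 subringE(3)[OF S] by blast
    fix u assume "u \<in> ?U"
    then obtain m where u: "u \<in> poly_below R S x m" by blast
    thus "\<ominus> u \<in> ?U" using poly_below_uminus by blast
    fix v assume "v \<in> ?U"
    then obtain n where v: "v \<in> poly_below R S x n" by blast
    show "u \<otimes> v \<in> ?U" using poly_below_mult[OF u v] by blast
    have "u \<in> poly_below R S x (max m n)" "v \<in> poly_below R S x (max m n)"
      using u v poly_below_mono[of m "max m n"] poly_below_mono[of n "max m n"] by auto
    from poly_below_add[OF this] show "u \<oplus> v \<in> ?U" by blast
  qed
qed

end

lemma Idl_image_mono:
  fixes f :: "nat \<Rightarrow> 'a"
  assumes "\<And>i. f i \<in> carrier R" "m \<le> n"
  shows "Idl (f ` {..<m}) \<subseteq> Idl (f ` {..<n})"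
  using assms by (intro subset_Idl_subset) (auto intro!: image_mono)

lemma noetherian_Idl_sequence_stabilizes:
  fixes f :: "nat \<Rightarrow> 'a"
  assumes noeth: "noetherian_ring R" and B: "B \<subseteq> carrier R" and f: "\<And>i. f i \<in> carrier R"
  shows "\<exists>m. f m \<in> Idl (B \<union> f ` {..<m})"
proof -
  define L where "L m = Idl (B \<union> f ` {..<m})" for m
  have c: "B \<union> f ` {..<m} \<subseteq> carrier R" for m using B f by auto
  have mono: "L m \<subseteq> L n" if "m \<le> n" for m n
    unfolding L_def using that c by (intro subset_Idl_subset) (auto intro!: image_mono)
  have ideal: "ideal (L m) R" for m unfolding L_def using c by (rule genideal_ideal)
  have lin: "L m \<subseteq> L n \<or> L n \<subseteq> L m" for m n using mono[of m n] mono[of n m] by linarith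
  have "subset.chain {I. ideal I R} (range L)"
    unfolding pred_on.chain_def using ideal lin by blast
  hence "\<Union>(range L) \<in> range L" using noetherian_ring.ideal_chain_is_trivial[OF noeth, of "range L"] by auto
  then obtain m where m: "\<Union>(range L) = L m" by blast
  have "f m \<in> L (Suc m)" unfolding L_def using genideal_self[OF c[of "Suc m"]] by auto
  hence "f m \<in> L m" using m by blast
  thus ?thesis unfolding L_def by blast
qed

text \<open>
  If \<open>Q\<close> is not finitely generated, choose \<open>q\<^sub>0, q\<^sub>1, \<dots>\<close> in \<open>Q\<close>, each of minimal degree \<open>d\<^sub>i\<close> outside the ideal
  of its predecessors, with leading coefficient \<open>s\<^sub>i\<close>. As \<open>S\<close> is Noetherian, some \<open>s\<^sub>m\<close> is a combination of
  \<open>s\<^sub>0, \<dots>, s\<^bsub>m-1\<^esub>\<close>. The same combination of the \<open>x\<^bsup>d\<^sub>m-d\<^sub>j\<^esup> q\<^sub>j\<close> cancels the leading term of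
  \<open>q\<^sub>m\<close>, against the choice of \<open>q\<^sub>m\<close>.
\<close>

theorem hilbert_basis:
  assumes S: "subring S R" and x: "x \<in> carrier R"
    and noeth: "noetherian_ring (R\<lparr>carrier := S\<rparr>)"
    and gen: "carrier R = (\<Union>n. poly_below R S x n)"
  shows "noetherian_ring R"
proof (rule noetherian_ringI)
  fix Q assume Q: "ideal Q R"
  note Qo = ideal_ops[OF Q]
  let ?V = "poly_below R S x"
  note Vc = poly_below_carrier[OF S x]
  show "\<exists>A\<subseteq>carrier R. finite A \<and> Q = Idl A"
  proof (rule ccontr)
    assume nfg: "\<not> ?thesis"
    have out: "\<exists>q\<in>Q. q \<notin> Idl A" if "finite A" "A \<subseteq> Q" for A
    proof (rule ccontr)
      assume "\<not> ?thesis"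
      hence "Q \<subseteq> Idl A" by blast
      moreover have "Idl A \<subseteq> Q" using that(2) by (rule genideal_minimal[OF Q])
      ultimately have "Q = Idl A" by blast
      thus False using nfg that(1) subset_trans[OF that(2) Qo(1)] by blast
    qed
    define good where "good = (\<lambda>A d s q. q \<in> Q \<and> q \<notin> Idl A \<and> s \<in> S \<and>
      q \<ominus> s \<otimes> x [^] (d::nat) \<in> ?V d \<and> (\<forall>q'\<in>Q. q' \<notin> Idl A \<longrightarrow> q' \<notin> ?V d))"
    have ex_good: "\<exists>d s q. good A d s q" if A: "finite A" "A \<subseteq> Q" for A
    proof -
      obtain q0 where q0: "q0 \<in> Q" "q0 \<notin> Idl A" using out[OF A] by blast
      define N where "N = (LEAST n. \<exists>q\<in>Q. q \<notin> Idl A \<and> q \<in> ?V n)"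
      have ex: "\<exists>n. \<exists>q\<in>Q. q \<notin> Idl A \<and> q \<in> ?V n" using q0 gen Qo(1) by blast
      obtain q where q: "q \<in> Q" "q \<notin> Idl A" "q \<in> ?V N" using LeastI_ex[OF ex] unfolding N_def by blast
      have min: "q' \<notin> ?V n" if "n < N" "q' \<in> Q" "q' \<notin> Idl A" for n q'
        using not_less_Least[OF that(1)[unfolded N_def]] that by blast
      have "ideal (Idl A) R" using A Qo(1) by (intro genideal_ideal) auto
      hence "\<zero> \<in> Idl A" by (rule ideal_ops(2))
      hence "N \<noteq> 0" using q by (cases N) auto
      then obtain d where d: "N = Suc d" by (cases N) auto
      then obtain v s where vs: "v \<in> ?V d" "s \<in> S" "q = v \<oplus> s \<otimes> x [^] d" using q(3) by auto
      have c: "v \<in> carrier R" "s \<otimes> x [^] d \<in> carrier R"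
        using vs(1,2) Vc[of d] subringE(1)[OF S] x by (auto simp: subset_iff)
      have "q \<ominus> s \<otimes> x [^] d = v" unfolding vs(3) using c by algebra
      hence "good A d s q" unfolding good_def using q(1,2) vs(1,2) min[of d] d by simp
      thus ?thesis by blast
    qed
    have "\<exists>f. \<forall>i::nat. (case f i of (d, s, q) \<Rightarrow> good ((\<lambda>j. snd (snd (f j))) ` {..<i}) d s q)"
    proof (rule dependent_wellorder_choice)
      fix r :: "nat \<times> 'a \<times> 'a" and f g :: "nat \<Rightarrow> nat \<times> 'a \<times> 'a" and i :: nat
      assume "\<And>j. j < i \<Longrightarrow> f j = g j"
      hence "(\<lambda>j. snd (snd (f j))) ` {..<i} = (\<lambda>j. snd (snd (g j))) ` {..<i}" by auto
      thus "(case r of (d, s, q) \<Rightarrow> good ((\<lambda>j. snd (snd (f j))) ` {..<i}) d s q) =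
        (case r of (d, s, q) \<Rightarrow> good ((\<lambda>j. snd (snd (g j))) ` {..<i}) d s q)" by simp
    next
      fix i :: nat and f :: "nat \<Rightarrow> nat \<times> 'a \<times> 'a"
      assume *: "\<And>j. j < i \<Longrightarrow> (case f j of (d, s, q) \<Rightarrow> good ((\<lambda>j. snd (snd (f j))) ` {..<j}) d s q)"
      have "snd (snd (f j)) \<in> Q" if "j < i" for j
        using *[OF that] by (cases "f j") (simp add: good_def)
      hence "(\<lambda>j. snd (snd (f j))) ` {..<i} \<subseteq> Q" by blast
      from ex_good[OF _ this] show "\<exists>r. case r of (d, s, q) \<Rightarrow> good ((\<lambda>j. snd (snd (f j))) ` {..<i}) d s q"
        by auto
    qed
    then obtain f where f: "\<And>i::nat. (case f i of (d, s, q) \<Rightarrow> good ((\<lambda>j. snd (snd (f j))) ` {..<i}) d s q)"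
      by blast
    define d where "d i = fst (f i)" for i
    define s where "s i = fst (snd (f i))" for i
    define q where "q i = snd (snd (f i))" for i
    have good: "good (q ` {..<i}) (d i) (s i) (q i)" for i
      using f[of i] unfolding d_def s_def q_def by (cases "f i") simp
    have qQ: "q i \<in> Q" and qI: "q i \<notin> Idl (q ` {..<i})" and sS: "s i \<in> S"
      and qV: "q i \<ominus> s i \<otimes> x [^] d i \<in> ?V (d i)"
      and min: "\<And>q'. q' \<in> Q \<Longrightarrow> q' \<notin> Idl (q ` {..<i}) \<Longrightarrow> q' \<notin> ?V (d i)" for i
      using good[of i] by (auto simp: good_def)
    have qc: "q i \<in> carrier R" for i using qQ Qo(1) by blast
    have sc: "s i \<in> carrier R" for i using sS subringE(1)[OF S] by blast
    have xc: "x [^] (n::nat) \<in> carrier R" for n using x by simp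
    have qV1: "q i \<in> ?V (Suc (d i))" for i
    proof -
      have "(q i \<ominus> s i \<otimes> x [^] d i) \<oplus> s i \<otimes> x [^] d i = q i"
        using qc[of i] sc[of i] xc[of "d i"] by algebra
      thus ?thesis using poly_belowI[OF qV[of i] sS[of i]] by simp
    qed
    have dmono: "d i \<le> d j" if "i \<le> j" for i j
    proof (rule ccontr)
      assume "\<not> ?thesis"
      hence "?V (Suc (d j)) \<subseteq> ?V (d i)" by (intro poly_below_mono[OF S x]) auto
      moreover have "q j \<notin> Idl (q ` {..<i})" using qI Idl_image_mono[of q, OF qc that] by blast
      ultimately show False using min[OF qQ, of j i] qV1 by blast
    qed
    let ?S = "R\<lparr>carrier := S\<rparr>"
    have crS: "cring ?S"
      using subcringI'[OF S] subcring_iff[OF subringE(1)[OF S]] by blast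
    interpret S: cring ?S by (rule crS)
    obtain m where m: "s m \<in> genideal ?S (s ` {..<m})"
      using S.noetherian_Idl_sequence_stabilizes[OF noeth, of "{}" s] sS by auto
    \<comment> \<open>Leading coefficients available in degree \<open>d m\<close>. They form an ideal of \<open>S\<close>, which saves writing out the combination
      of the \<open>x\<^bsup>d\<^sub>m-d\<^sub>j\<^esup> q\<^sub>j\<close>.\<close>
    define L where "L = {t \<in> S. \<exists>b\<in>Idl (q ` {..<m}). b \<ominus> t \<otimes> x [^] d m \<in> ?V (d m)}"
    have Ii: "ideal (Idl (q ` {..<m})) R" using qc by (intro genideal_ideal) auto
    note Io = ideal_ops[OF Ii]
    have LI: "t \<in> L" if "t \<in> S" "b \<in> Idl (q ` {..<m})" "b \<ominus> t \<otimes> x [^] d m \<in> ?V (d m)" for t b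
      using that unfolding L_def by blast
    have "ideal L ?S"
    proof (rule S.idealI_simple)
      show "L \<subseteq> carrier ?S" by (auto simp: L_def)
      have "\<zero> \<ominus> \<zero> \<otimes> x [^] d m = \<zero>" using xc[of "d m"] by algebra
      hence "\<zero> \<in> L" using LI[OF subringE(2)[OF S] Io(2)] poly_below_zero[OF S x] by simp
      thus "\<zero>\<^bsub>?S\<^esub> \<in> L" by simp
      fix t assume "t \<in> L"
      then obtain b where t: "t \<in> S" "b \<in> Idl (q ` {..<m})" "b \<ominus> t \<otimes> x [^] d m \<in> ?V (d m)"
        unfolding L_def by blast
      have tc: "t \<in> carrier R" "b \<in> carrier R" using t(1,2) subringE(1)[OF S] Io(1) by auto
      { fix t' assume "t' \<in> L"
        then obtain b' where t': "t' \<in> S" "b' \<in> Idl (q ` {..<m})" "b' \<ominus> t' \<otimes> x [^] d m \<in> ?V (d m)"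
          unfolding L_def by blast
        have tc': "t' \<in> carrier R" "b' \<in> carrier R" using t'(1,2) subringE(1)[OF S] Io(1) by auto
        have "(b \<oplus> b') \<ominus> (t \<oplus> t') \<otimes> x [^] d m = (b \<ominus> t \<otimes> x [^] d m) \<oplus> (b' \<ominus> t' \<otimes> x [^] d m)"
          using tc tc' xc[of "d m"] by algebra
        also have "\<dots> \<in> ?V (d m)" by (rule poly_below_add[OF S x t(3) t'(3)])
        finally have "t \<oplus> t' \<in> L"
          by (rule LI[OF subringE(7)[OF S t(1) t'(1)] Io(3)[OF t(2) t'(2)]])
        thus "t \<oplus>\<^bsub>?S\<^esub> t' \<in> L" by simp }
      { fix r assume "r \<in> carrier ?S"
        hence r: "r \<in> S" "r \<in> carrier R" using subringE(1)[OF S] by auto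
        have "(r \<otimes> b) \<ominus> (r \<otimes> t) \<otimes> x [^] d m = r \<otimes> (b \<ominus> t \<otimes> x [^] d m)"
          using tc r(2) xc[of "d m"] by algebra
        also have "\<dots> \<in> ?V (d m)" by (rule poly_below_smult[OF S x t(3) r(1)])
        finally have "r \<otimes> t \<in> L"
          by (rule LI[OF subringE(6)[OF S r(1) t(1)] Io(6)[OF t(2) r(2)]])
        thus "r \<otimes>\<^bsub>?S\<^esub> t \<in> L" by simp }
    qed
    moreover have "s ` {..<m} \<subseteq> L"
    proof clarify
      fix j assume j: "j < m"
      have dj: "d j \<le> d m" using dmono j by simp
      let ?b = "x [^] (d m - d j) \<otimes> q j"
      have "q j \<in> Idl (q ` {..<m})" using genideal_self[of "q ` {..<m}"] qc j by auto
      hence b: "?b \<in> Idl (q ` {..<m})" using Io(6) xc by simp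
      have "x [^] (d m - d j) \<otimes> (q j \<ominus> s j \<otimes> x [^] d j) = ?b \<ominus> s j \<otimes> (x [^] (d m - d j) \<otimes> x [^] d j)"
        using qc[of j] sc[of j] xc[of "d m - d j"] xc[of "d j"] by algebra
      also have "x [^] (d m - d j) \<otimes> x [^] d j = x [^] d m" using dj x by (simp add: nat_pow_mult)
      finally have "?b \<ominus> s j \<otimes> x [^] d m \<in> ?V (d m)"
        using poly_below_pow[OF S x qV[of j], of "d m - d j"] dj by simp
      thus "s j \<in> L" by (rule LI[OF sS b])
    qed
    ultimately have "s m \<in> L" using m S.genideal_minimal[of L "s ` {..<m}"] by blast
    then obtain b where b: "b \<in> Idl (q ` {..<m})" "b \<ominus> s m \<otimes> x [^] d m \<in> ?V (d m)"
      unfolding L_def by blast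
    have bc: "b \<in> carrier R" using b Io(1) by blast
    have bQ: "b \<in> Q" using b(1) genideal_minimal[OF Q, of "q ` {..<m}"] qQ by blast
    have "q m \<ominus> b = (q m \<ominus> s m \<otimes> x [^] d m) \<oplus> \<ominus> (b \<ominus> s m \<otimes> x [^] d m)"
      using qc[of m] sc[of m] xc[of "d m"] bc by algebra
    also have "\<dots> \<in> ?V (d m)"
      by (intro poly_below_add[OF S x] qV poly_below_uminus[OF S x] b)
    finally have "q m \<ominus> b \<in> ?V (d m)" .
    moreover have "q m \<ominus> b \<in> Q" using qQ bQ Qo(4) by blast
    moreover have "q m \<ominus> b \<notin> Idl (q ` {..<m})"
    proof
      assume a: "q m \<ominus> b \<in> Idl (q ` {..<m})"
      have "(q m \<ominus> b) \<oplus> b = q m" using qc[of m] bc by algebra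
      thus False using Io(3)[OF a b(1)] qI by simp
    qed
    ultimately show False using min by blast
  qed
qed

lemma noetherian_subfield:
  assumes K: "subfield K R" shows "noetherian_ring (R\<lparr>carrier := K\<rparr>)"
proof -
  interpret F: field "R\<lparr>carrier := K\<rparr>" by (rule subfield_iff(2)[OF K])
  show ?thesis
  proof (rule F.noetherian_ringI)
    fix I assume "ideal I (R\<lparr>carrier := K\<rparr>)"
    hence "I \<in> {I. ideal I (R\<lparr>carrier := K\<rparr>)}" by simp
    hence "I = Idl\<^bsub>R\<lparr>carrier := K\<rparr>\<^esub> {\<zero>\<^bsub>R\<lparr>carrier := K\<rparr>\<^esub>} \<or> I = Idl\<^bsub>R\<lparr>carrier := K\<rparr>\<^esub> {\<one>\<^bsub>R\<lparr>carrier := K\<rparr>\<^esub>}"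
      unfolding F.all_ideals F.genideal_zero F.genideal_one by blast
    thus "\<exists>A\<subseteq>carrier (R\<lparr>carrier := K\<rparr>). finite A \<and> I = Idl\<^bsub>R\<lparr>carrier := K\<rparr>\<^esub> A"
    proof
      assume "I = Idl\<^bsub>R\<lparr>carrier := K\<rparr>\<^esub> {\<zero>\<^bsub>R\<lparr>carrier := K\<rparr>\<^esub>}"
      thus ?thesis using F.zero_closed by (intro exI[of _ "{\<zero>\<^bsub>R\<lparr>carrier := K\<rparr>\<^esub>}"] conjI) auto
    next
      assume "I = Idl\<^bsub>R\<lparr>carrier := K\<rparr>\<^esub> {\<one>\<^bsub>R\<lparr>carrier := K\<rparr>\<^esub>}"
      thus ?thesis using F.one_closed by (intro exI[of _ "{\<one>\<^bsub>R\<lparr>carrier := K\<rparr>\<^esub>}"] conjI) auto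
    qed
  qed
qed

lemma noetherian_generate_ring:
  assumes K: "subfield K R" and T: "finite T" "T \<subseteq> carrier R"
  shows "noetherian_ring (R\<lparr>carrier := generate_ring R (K \<union> T)\<rparr>)"
  using T
proof (induction T rule: finite_induct)
  case empty
  have sub: "subring K R" using K by (rule subfieldE(1))
  have "generate_ring R K = K"
    using generate_ring_min_subring1[OF subringE(1)[OF sub] sub] generate_ring.incl[of _ K R] by blast
  thus ?case using noetherian_subfield[OF K] by simp
next
  case (insert x T)
  have Kc: "K \<subseteq> carrier R" using subringE(1)[OF subfieldE(1)[OF K]] .
  have xc: "x \<in> carrier R" and Tc: "T \<subseteq> carrier R" using insert.prems by auto
  define S where "S = generate_ring R (K \<union> T)"
  define S' where "S' = generate_ring R (K \<union> insert x T)"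
  have S: "subring S R" unfolding S_def using Kc Tc by (intro generate_ring_is_subring) auto
  have S': "subring S' R" unfolding S'_def using Kc Tc xc by (intro generate_ring_is_subring) auto
  have sub: "S \<subseteq> S'"
    unfolding S_def using Tc Kc
    by (intro generate_ring_min_subring1[OF _ S']) (auto simp: S'_def generate_ring.incl)
  have xS': "x \<in> S'" by (simp add: S'_def generate_ring.incl)
  let ?R = "R\<lparr>carrier := S'\<rparr>"
  have cr: "cring ?R" using subcringI'[OF S'] subcring_iff[OF subringE(1)[OF S']] by blast
  have subR: "subring S ?R"
    using subring_is_ring[OF S] ring.subring_iff[OF cring.axioms(1)[OF cr], of S] sub by simp
  have eq: "poly_below ?R S x n = poly_below R S x n" for n
    by (induction n) (simp_all add: nat_pow_consistent[symmetric])
  have "S' \<subseteq> generate_ring R (insert x S)"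
  proof -
    have c: "insert x S \<subseteq> carrier R" using xc subringE(1)[OF S] by simp
    have "K \<union> T \<subseteq> S" unfolding S_def by (auto simp: generate_ring.incl)
    hence "K \<union> insert x T \<subseteq> generate_ring R (insert x S)" by (auto intro: generate_ring.incl)
    thus ?thesis unfolding S'_def
      using Kc Tc xc by (intro generate_ring_min_subring1 generate_ring_is_subring[OF c]) auto
  qed
  hence "S' \<subseteq> (\<Union>n. poly_below R S x n)" using generate_ring_insert_poly_below[OF S xc] by blast
  moreover have "poly_below ?R S x n \<subseteq> S'" for n
    using cring.poly_below_carrier[OF cr subR, of x n] xS' by simp
  ultimately have gen: "carrier ?R = (\<Union>n. poly_below ?R S x n)" unfolding eq by auto
  have "noetherian_ring (?R\<lparr>carrier := S\<rparr>)" using insert.IH Tc by (simp add: S_def)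
  hence "noetherian_ring ?R"
    using cring.hilbert_basis[OF cr subR _ _ gen] xS' by simp
  thus ?case by (simp add: S'_def)
qed

end

section \<open>The Nullstellensatz over an infinite field\<close>

abbreviation up_monom :: "('a, 'b) ring_scheme \<Rightarrow> 'a \<Rightarrow> nat \<Rightarrow> nat \<Rightarrow> 'a"
  where "up_monom R \<equiv> up_ring.monom (UP R)"

abbreviation up_coeff :: "('a, 'b) ring_scheme \<Rightarrow> (nat \<Rightarrow> 'a) \<Rightarrow> nat \<Rightarrow> 'a"
  where "up_coeff R \<equiv> up_ring.coeff (UP R)"

lemma (in abelian_monoid) finsum_in_subset:
  assumes "finite I" "\<zero> \<in> B" "\<And>a b. a \<in> B \<Longrightarrow> b \<in> B \<Longrightarrow> a \<oplus> b \<in> B" "B \<subseteq> carrier G"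
    and "\<And>i. i \<in> I \<Longrightarrow> f i \<in> B"
  shows "finsum G f I \<in> B"
  using assms(1,5)
proof (induction I rule: finite_induct)
  case (insert i I)
  hence "f \<in> I \<rightarrow> carrier G" "f i \<in> carrier G" using assms(4) by auto
  thus ?case using insert assms(3) by (simp add: finsum_insert)
qed (simp add: assms(2))

context cring
begin

lemma subring_poly_below: 
  assumes S: "subring S R" and x: "x \<in> carrier R" and H: "S \<subseteq> H" "x \<in> H" "subring H R"
  shows "poly_below R S x n \<subseteq> H"
proof (induction n)
  case 0 show ?case using subringE(2)[OF H(3)] by simp
next
  case (Suc n)
  have "x [^] n \<in> H" using H(2) subringE(3,6)[OF H(3)] by (induction n) auto
  moreover note Suc
  ultimately show ?case using H(1) by (auto intro!: subringE(6,7)[OF H(3)])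
qed

lemma poly_below_subset:
  assumes S: "subring S R" and x: "x \<in> carrier R"
  shows "S \<subseteq> (\<Union>n. poly_below R S x n)" "x \<in> (\<Union>n. poly_below R S x n)"
    "subring (\<Union>n. poly_below R S x n) R"
proof -
  have "insert x S \<subseteq> carrier R" using x subringE(1)[OF S] by simp
  have "(\<Union>n. poly_below R S x n) = generate_ring R (insert x S)"
  proof
    show "(\<Union>n. poly_below R S x n) \<subseteq> generate_ring R (insert x S)"
      using subring_poly_below[OF S x, of "generate_ring R (insert x S)"]
        generate_ring_is_subring[of "insert x S"] x subringE(1)[OF S]
      by (auto simp: generate_ring.incl subset_iff)
  qed (rule generate_ring_insert_poly_below[OF S x])
  thus "S \<subseteq> (\<Union>n. poly_below R S x n)" "x \<in> (\<Union>n. poly_below R S x n)"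
    "subring (\<Union>n. poly_below R S x n) R"
    using generate_ring_is_subring[of "insert x S"] x subringE(1)[OF S]
    by (auto simp: generate_ring.incl)
qed

lemma poly_below_divide_linear:
  assumes S: "subring S R" and x: "x \<in> carrier R" and c: "c \<in> S"
  shows "p \<in> poly_below R S x n \<Longrightarrow> \<exists>q\<in>poly_below R S x (n - 1). \<exists>e\<in>S. p = (x \<ominus> c) \<otimes> q \<oplus> e"
proof (induction n arbitrary: p)
  case 0
  have "\<zero> = (x \<ominus> c) \<otimes> \<zero> \<oplus> \<zero>" using x c subringE(1)[OF S] by (simp add: subset_iff)
  thus ?case using 0 subringE(2)[OF S] by auto
next
  case (Suc n)
  then obtain v s where v: "v \<in> poly_below R S x n" "s \<in> S" "p = v \<oplus> s \<otimes> x [^] n" by auto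
  have cc: "c \<in> carrier R" "s \<in> carrier R" "v \<in> carrier R" 
    using c v subringE(1)[OF S] poly_below_carrier[OF S x, of n] by auto
  show ?case
  proof (cases n)
    case 0
    hence "p = (x \<ominus> c) \<otimes> \<zero> \<oplus> s" using v cc x by simp
    thus ?thesis using poly_below_zero[OF S x] v(2) by blast
  next
    case (Suc m)
    \<comment> \<open>\<open>s x\<^sup>n = (x - c) s x\<^sup>m + c s x\<^sup>m\<close>, and the last term has smaller degree.\<close>
    define v' where "v' = v \<oplus> (c \<otimes> s) \<otimes> x [^] m"
    have "\<zero> \<oplus> (c \<otimes> s) \<otimes> x [^] m \<in> poly_below R S x n"
      unfolding Suc by (intro poly_belowI poly_below_zero[OF S x] subringE(6)[OF S] c v)
    hence "(c \<otimes> s) \<otimes> x [^] m \<in> poly_below R S x n" using cc x by simp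
    hence "v' \<in> poly_below R S x n" unfolding v'_def by (rule poly_below_add[OF S x v(1)])
    from Suc.IH[OF this] obtain q e where q: "q \<in> poly_below R S x (n - 1)" "e \<in> S"
      "v' = (x \<ominus> c) \<otimes> q \<oplus> e" by blast
    have "q \<oplus> s \<otimes> x [^] m \<in> poly_below R S x (Suc m)"
      using q v Suc by (intro poly_belowI) auto
    moreover have "p = (x \<ominus> c) \<otimes> (q \<oplus> s \<otimes> x [^] m) \<oplus> e"
    proof -
      have qc: "q \<in> carrier R" "e \<in> carrier R" "x [^] m \<in> carrier R"
        using q subringE(1)[OF S] poly_below_carrier[OF S x, of "n - 1"] x by auto
      have "p = v \<oplus> s \<otimes> (x [^] m \<otimes> x)" using v(3) Suc by simp
      also have "\<dots> = v' \<oplus> (x \<ominus> c) \<otimes> (s \<otimes> x [^] m)"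
        unfolding v'_def using cc qc x by algebra
      also have "\<dots> = (x \<ominus> c) \<otimes> (q \<oplus> s \<otimes> x [^] m) \<oplus> e"
        unfolding q(3) using cc qc x by algebra
      finally show ?thesis .
    qed
    ultimately show ?thesis using q(2) Suc by auto
  qed
qed

end

text \<open>
  An indirect proof of the Nullstellensatz: suppose that the residue class of \<open>x\<close> modulo \<open>M\<close> is transcendental over
  \<open>K\<close>. Filter \<open>R\<close> by degree in the generators \<open>S\<close>, with coefficients in \<open>K[x]\<close>, and let \<open>V\<^sub>m\<close> be the \<open>m\<close>-th
  step. The Rees ring of this filtration is a finitely generated algebra, hence Noetherian, so a single polynomial
  \<open>q \<notin> M\<close> kills all \<open>K[x]\<close>-torsion in the quotients of \<open>V\<^sub>m\<close> by \<open>V\<^bsub>m-1\<^esub> + M\<close>. Since \<open>K\<close> is infinite, some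
  \<open>c \<in> K\<close> is not a root of \<open>q\<close>. Modulo \<open>M\<close> the element \<open>x - c\<close> has an inverse \<open>y\<close>, taken in \<open>V\<^sub>m\<close> with \<open>m\<close> least. If
  \<open>m > 0\<close>, then \<open>(x - c) y \<equiv> 1\<close> shows that \<open>y\<close> is torsion, so \<open>q y\<close> lies in \<open>V\<^bsub>m-1\<^esub> + M\<close>; but
  \<open>q y \<equiv> q(c) y\<close> modulo \<open>K[x] + M\<close>, so \<open>y\<close> itself can be taken in \<open>V\<^bsub>m-1\<^esub>\<close>. Hence \<open>m = 0\<close> and \<open>y\<close> is
  a polynomial in \<open>x\<close>, contrary to transcendence.
\<close>

locale transcendental_residue = cring R for R :: "('a, 'b) ring_scheme" (structure) +
  fixes K S M x
  assumes K: "subfield K R" and infK: "infinite K" and S: "finite S" "S \<subseteq> carrier R"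
    and gen: "generate_ring R (K \<union> S) = carrier R" and M: "maximalideal M R" and x: "x \<in> carrier R"
    and no_monic: "\<And>N v. v \<in> poly_below R K x N \<Longrightarrow> x [^] N \<oplus> v \<notin> M"
begin

abbreviation (input) "Kx \<equiv> (\<Union>n. poly_below R K x n)"

lemma Kring: "subring K R" using K by (rule subfieldE(1))
lemma Kc: "K \<subseteq> carrier R" by (rule subringE(1)[OF Kring])
lemmas Kx = poly_below_subset[OF Kring x]
lemma Kxc: "Kx \<subseteq> carrier R" by (rule subringE(1)[OF Kx(3)])
lemma Mi: "ideal M R" using M by (rule maximalideal.axioms(1))
lemmas Mo = ideal_ops[OF Mi]
lemma Mp: "primeideal M R" by (rule maximalideal_prime[OF M])
lemma M1: "\<one> \<notin> M" using M ideal.one_imp_carrier[OF Mi] maximalideal.I_notcarr by blast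

lemma leading_term:
  assumes "p \<in> poly_below R K x n" "p \<noteq> \<zero>"
  shows "\<exists>j v s. v \<in> poly_below R K x j \<and> s \<in> K \<and> s \<noteq> \<zero> \<and> p = v \<oplus> s \<otimes> x [^] j"
  using assms
proof (induction n)
  case (Suc n)
  then obtain v s where v: "v \<in> poly_below R K x n" "s \<in> K" "p = v \<oplus> s \<otimes> x [^] n" by auto
  show ?case
  proof (cases "s = \<zero>")
    case True
    hence "p = v" using v x poly_below_carrier[OF Kring x, of n] by (auto simp: subset_iff)
    thus ?thesis using Suc v by blast
  qed (use v in blast)
qed simp

lemma lead_notin_M:
  assumes "v \<in> poly_below R K x j" "s \<in> K" "s \<noteq> \<zero>"
  shows "v \<oplus> s \<otimes> x [^] j \<notin> M"
proof
  assume a: "v \<oplus> s \<otimes> x [^] j \<in> M"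
  have inv: "inv s \<in> K" "inv s \<otimes> s = \<one>" using subfield_m_inv[OF K, of s] assms by auto
  have c: "inv s \<in> carrier R" "s \<in> carrier R" "v \<in> carrier R" "x [^] j \<in> carrier R"
    using inv(1) assms(1,2) Kc x poly_below_carrier[OF Kring x, of j] by auto
  have "inv s \<otimes> (v \<oplus> s \<otimes> x [^] j) = inv s \<otimes> v \<oplus> (inv s \<otimes> s) \<otimes> x [^] j" using c by algebra
  also have "\<dots> = x [^] j \<oplus> inv s \<otimes> v" using c inv(2) by (simp add: a_comm)
  finally have "x [^] j \<oplus> inv s \<otimes> v \<in> M" using Mo(6)[OF a c(1)] by simp
  thus False using no_monic[OF poly_below_smult[OF Kring x assms(1) inv(1)]] by simp
qed

lemma linear_notin_M: assumes "c \<in> K" shows "x \<ominus> c \<notin> M"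
proof -
  have "\<zero> \<oplus> \<ominus> c \<otimes> x [^] (0::nat) \<in> poly_below R K x (Suc 0)"
    using assms subringE(5)[OF Kring] by (intro poly_belowI) auto
  from no_monic[OF this] show ?thesis using x assms Kc by (auto simp: a_minus_def subset_iff)
qed

text \<open>
  The leading coefficient of \<open>(x - c) w - 1\<close> is that of \<open>w\<close>, and no polynomial in \<open>x\<close> with nonzero leading coefficient is
  in \<open>M\<close>.
\<close>

lemma linear_not_unit:
  assumes c: "c \<in> K" and w: "w \<in> Kx" shows "(x \<ominus> c) \<otimes> w \<ominus> \<one> \<notin> M"
proof (cases "w = \<zero>")
  case True
  hence "(x \<ominus> c) \<otimes> w \<ominus> \<one> = \<ominus> \<one>" using x c Kc by (auto simp: subset_iff a_minus_def)
  thus ?thesis using M1 Mo(5)[of "\<ominus> \<one>"] by auto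
next
  case False
  then obtain j v s where v: "v \<in> poly_below R K x j" "s \<in> K" "s \<noteq> \<zero>" "w = v \<oplus> s \<otimes> x [^] j"
    using leading_term w by blast
  have cc: "c \<in> carrier R" "s \<in> carrier R" "v \<in> carrier R" "x [^] j \<in> carrier R" "w \<in> carrier R"
    using c v Kc w Kxc x poly_below_carrier[OF Kring x, of j] by auto
  have wj: "w \<in> poly_below R K x (Suc j)" unfolding v(4) by (intro poly_belowI v)
  have K1: "\<one> \<in> poly_below R K x (Suc j)"
  proof -
    have "\<zero> \<oplus> \<one> \<otimes> x [^] (0::nat) \<in> poly_below R K x (Suc 0)" using subringE(3)[OF Kring] by (intro poly_belowI) auto
    thus ?thesis using poly_below_mono[OF Kring x, of "Suc 0" "Suc j"] by auto
  qed
  define u where "u = x \<otimes> v \<oplus> (\<ominus> c \<otimes> w \<oplus> \<ominus> \<one>)"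
  have "x [^] (1::nat) \<otimes> v \<in> poly_below R K x (1 + j)" by (rule poly_below_pow[OF Kring x v(1)])
  hence xv: "x \<otimes> v \<in> poly_below R K x (Suc j)" using x by simp
  have "u \<in> poly_below R K x (Suc j)" unfolding u_def
    by (intro poly_below_add[OF Kring x] xv poly_below_smult[OF Kring x] wj subringE(5)[OF Kring]
        poly_below_uminus[OF Kring x] K1 c)
  from lead_notin_M[OF this v(2,3)] have "u \<oplus> s \<otimes> x [^] Suc j \<notin> M" .
  moreover have "u \<oplus> s \<otimes> x [^] Suc j = (x \<ominus> c) \<otimes> w \<ominus> \<one>"
  proof -
    have "u \<oplus> s \<otimes> (x [^] j \<otimes> x) = x \<otimes> (v \<oplus> s \<otimes> x [^] j) \<oplus> (\<ominus> c \<otimes> w \<oplus> \<ominus> \<one>)"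
      unfolding u_def using cc x by algebra
    also have "\<dots> = (x \<ominus> c) \<otimes> w \<ominus> \<one>" unfolding v(4)[symmetric] using cc x by algebra
    finally show ?thesis by simp
  qed
  ultimately show ?thesis by simp
qed

text \<open>
  A nonzero polynomial has finitely many roots, where \<open>c\<close> counts as a root of \<open>q\<close> if \<open>x - c\<close> divides \<open>q\<close> in \<open>K[x]\<close>
  modulo \<open>M\<close>. One root \<open>c\<^sub>0\<close> is split off at a time; the remaining ones are roots of the quotient because \<open>x - c\<^sub>0\<close> is
  congruent to the nonzero scalar \<open>c - c\<^sub>0\<close> modulo \<open>x - c\<close>.
\<close>

lemma mem_M_of_infinitely_many_roots:
  assumes "q \<in> poly_below R K x n" "infinite C" "C \<subseteq> K"
    "\<And>c. c \<in> C \<Longrightarrow> \<exists>w\<in>Kx. q \<ominus> (x \<ominus> c) \<otimes> w \<in> M"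
  shows "q \<in> M"
  using assms
proof (induction n arbitrary: q C)
  case 0 thus ?case using Mo(2) by simp
next
  case (Suc n)
  obtain c0 where c0: "c0 \<in> C" using Suc.prems(2) by fastforce
  have c0K: "c0 \<in> K" using c0 Suc.prems by auto
  obtain q' e where q': "q' \<in> poly_below R K x n" "e \<in> K" "q = (x \<ominus> c0) \<otimes> q' \<oplus> e"
    using poly_below_divide_linear[OF Kring x c0K Suc.prems(1)] by auto
  have cc: "q \<in> carrier R" "q' \<in> carrier R" "e \<in> carrier R" "c0 \<in> carrier R"
    using q'(1,2) c0K Kc subsetD[OF poly_below_carrier[OF Kring x]] Suc.prems(1)
    by (blast, blast, blast, blast)
  have "e = \<zero>"
  proof (rule ccontr)
    assume ne: "e \<noteq> \<zero>"
    have inv: "inv e \<in> K" "inv e \<otimes> e = \<one>" using subfield_m_inv[OF K, of e] q' ne by auto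
    obtain w where w: "w \<in> Kx" "q \<ominus> (x \<ominus> c0) \<otimes> w \<in> M" using Suc.prems(4)[OF c0] by blast
    have ic: "inv e \<in> carrier R" "w \<in> carrier R" using inv w Kc Kxc by auto
    have "\<ominus> (inv e \<otimes> (q \<ominus> (x \<ominus> c0) \<otimes> w)) = (x \<ominus> c0) \<otimes> (inv e \<otimes> (w \<ominus> q')) \<ominus> inv e \<otimes> e"
      unfolding q'(3) using cc ic x by algebra
    also have "\<dots> = (x \<ominus> c0) \<otimes> (inv e \<otimes> (w \<ominus> q')) \<ominus> \<one>" using inv by simp
    finally have "(x \<ominus> c0) \<otimes> (inv e \<otimes> (w \<ominus> q')) \<ominus> \<one> \<in> M" using Mo(5)[OF Mo(6)[OF w(2) ic(1)]] by simp
    moreover have "inv e \<otimes> (w \<ominus> q') \<in> Kx"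
      unfolding a_minus_def using inv(1) w(1) q'(1) Kx(1)
      by (intro subringE(5-7)[OF Kx(3)]) blast+
    ultimately show False using linear_not_unit[OF c0K] by blast
  qed
  hence q: "q = (x \<ominus> c0) \<otimes> q'" using q' cc x by simp
  have "q' \<in> M"
  proof (rule Suc.IH[OF q'(1), of "C - {c0}"])
    show "infinite (C - {c0})" "C - {c0} \<subseteq> K" using Suc.prems by auto
    fix c assume c: "c \<in> C - {c0}"
    have cK: "c \<in> K" using c Suc.prems by auto
    obtain w where w: "w \<in> Kx" "q \<ominus> (x \<ominus> c) \<otimes> w \<in> M" using Suc.prems(4) c by blast
    define f where "f = c \<ominus> c0"
    have "f \<noteq> \<zero>"
    proof
      assume "f = \<zero>"
      moreover have "f \<oplus> c0 = c" unfolding f_def using subsetD[OF Kc cK] subsetD[OF Kc c0K] by algebra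
      ultimately show False using c subsetD[OF Kc c0K] by simp
    qed
    moreover have "f \<in> K" using cK c0K subringE(5,7)[OF Kring] by (auto simp: f_def a_minus_def)
    ultimately have inv: "inv f \<in> K" "inv f \<otimes> f = \<one>" using subfield_m_inv[OF K, of f] by auto
    have ic: "inv f \<in> carrier R" "w \<in> carrier R" "c \<in> carrier R" using inv w Kc Kxc cK by auto
    have "inv f \<otimes> (q \<ominus> (x \<ominus> c) \<otimes> w) = (inv f \<otimes> f) \<otimes> q' \<ominus> (x \<ominus> c) \<otimes> (inv f \<otimes> (w \<ominus> q'))"
    proof -
      have "i \<otimes> ((x \<ominus> c0) \<otimes> q' \<ominus> (x \<ominus> c) \<otimes> w) =
          (i \<otimes> (c \<ominus> c0)) \<otimes> q' \<ominus> (x \<ominus> c) \<otimes> (i \<otimes> (w \<ominus> q'))" if "i \<in> carrier R" for i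
        using cc ic(2,3) x that by algebra
      from this[OF ic(1)] show ?thesis unfolding q f_def .
    qed
    also have "\<dots> = q' \<ominus> (x \<ominus> c) \<otimes> (inv f \<otimes> (w \<ominus> q'))" using inv cc by simp
    finally have "q' \<ominus> (x \<ominus> c) \<otimes> (inv f \<otimes> (w \<ominus> q')) \<in> M" using Mo(6)[OF w(2) ic(1)] by simp
    moreover have "inv f \<otimes> (w \<ominus> q') \<in> Kx"
      unfolding a_minus_def using inv(1) w(1) q'(1) Kx(1)
      by (intro subringE(5-7)[OF Kx(3)]) blast+
    ultimately show "\<exists>w\<in>Kx. q' \<ominus> (x \<ominus> c) \<otimes> w \<in> M" by blast
  qed
  thus ?case unfolding q using Mo(6) cc x by simp
qed

interpretation U: UP_cring R "UP R" by unfold_locales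

definition fil_rees_gens where "fil_rees_gens = {up_monom R x 0, up_monom R \<one> 1} \<union> (\<lambda>s. up_monom R s 1) ` S"

text \<open>
  The Rees ring of the degree filtration \<open>fil\<close>. The generator \<open>\<one> t\<close> makes the filtration increasing; the generator \<open>x\<close> sits
  in degree zero because the filtration is over \<open>K[x]\<close>.
\<close>

definition fil_rees where "fil_rees = generate_ring (UP R) ((\<lambda>a. up_monom R a 0) ` K \<union> fil_rees_gens)"

definition fil where "fil m = {v \<in> carrier R. up_monom R v m \<in> fil_rees}"

lemma fil_rees_gens_carrier: "(\<lambda>a. up_monom R a 0) ` K \<union> fil_rees_gens \<subseteq> carrier (UP R)"
  unfolding fil_rees_gens_def using Kc S(2) x by (auto simp: subset_iff)

lemma fil_rees_subring: "subring fil_rees (UP R)"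
  unfolding fil_rees_def by (rule U.generate_ring_is_subring[OF fil_rees_gens_carrier])

lemma fil_rees_noetherian: "noetherian_ring ((UP R)\<lparr>carrier := fil_rees\<rparr>)"
proof -
  have "ring_hom_ring R (UP R) (\<lambda>a. up_monom R a 0)"
    by (intro ring_hom_ringI2 ring_axioms U.P.ring_axioms U.const_ring_hom)
  moreover have "\<one>\<^bsub>UP R\<^esub> \<noteq> \<zero>\<^bsub>UP R\<^esub>"
  proof
    assume "\<one>\<^bsub>UP R\<^esub> = \<zero>\<^bsub>UP R\<^esub>"
    hence "up_coeff R \<one>\<^bsub>UP R\<^esub> 0 = up_coeff R \<zero>\<^bsub>UP R\<^esub> 0" by simp
    hence "\<one> = \<zero>" by simp
    thus False using M1 Mo(2) by simp
  qed
  ultimately have "subfield ((\<lambda>a. up_monom R a 0) ` K) (UP R)"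
    by (rule ring_hom_ring.img_is_subfield(2)[OF _ K])
  thus ?thesis unfolding fil_rees_def using S(1) fil_rees_gens_carrier
    by (intro U.P.noetherian_generate_ring) (auto simp: fil_rees_gens_def)
qed

lemma fil_rees_incl: "h \<in> (\<lambda>a. up_monom R a 0) ` K \<union> fil_rees_gens \<Longrightarrow> h \<in> fil_rees"
  unfolding fil_rees_def by (rule generate_ring.incl)

lemma fil_carrier: "fil m \<subseteq> carrier R" by (auto simp: fil_def)
lemma fil_zero: "\<zero> \<in> fil m" using subringE(2)[OF fil_rees_subring] by (simp add: fil_def)
lemma fil_add: "a \<in> fil m \<Longrightarrow> b \<in> fil m \<Longrightarrow> a \<oplus> b \<in> fil m"
  using subringE(7)[OF fil_rees_subring] by (simp add: fil_def)
lemma fil_uminus: "a \<in> fil m \<Longrightarrow> \<ominus> a \<in> fil m"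
  using subringE(5)[OF fil_rees_subring] by (simp add: fil_def)
lemma fil_mult: "a \<in> fil m \<Longrightarrow> b \<in> fil n \<Longrightarrow> a \<otimes> b \<in> fil (m + n)"
  using subringE(6)[OF fil_rees_subring] by (simp add: fil_def)
lemma fil_K: "K \<subseteq> fil 0" using fil_rees_incl Kc by (auto simp: fil_def)
lemma fil_x: "x \<in> fil 0" using fil_rees_incl x by (auto simp: fil_def fil_rees_gens_def)
lemma fil_one: "\<one> \<in> fil 1" using fil_rees_incl by (auto simp: fil_def fil_rees_gens_def)
lemma fil_S: "S \<subseteq> fil 1" using fil_rees_incl S(2) by (auto simp: fil_def fil_rees_gens_def)

lemma fil_Suc: "fil m \<subseteq> fil (Suc m)"
proof
  fix a assume "a \<in> fil m" thus "a \<in> fil (Suc m)" using fil_mult[of a m \<one> 1] fil_one fil_carrier[of m] by (auto simp: subset_iff)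
qed

lemma fil_mono: "m \<le> n \<Longrightarrow> fil m \<subseteq> fil n"
  using lift_Suc_mono_le[of fil m n] fil_Suc by blast

lemma fil_0_subring: "subring (fil 0) R"
  using fil_carrier fil_K subringE(3)[OF Kring] fil_uminus fil_add fil_mult[of _ 0 _ 0]
  by (intro subringI) auto

lemma Kx_fil_0: "Kx \<subseteq> fil 0"
  using subring_poly_below[OF Kring x fil_K fil_x fil_0_subring] by blast

lemma fil_exhausts: "carrier R = (\<Union>m. fil m)"
proof
  have "subring (\<Union>m. fil m) R"
  proof (rule subringI)
    show "(\<Union>m. fil m) \<subseteq> carrier R" using fil_carrier by blast
    show "\<one> \<in> (\<Union>m. fil m)" using fil_one by blast
    fix a assume "a \<in> (\<Union>m. fil m)"
    then obtain m where a: "a \<in> fil m" by blast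
    thus "\<ominus> a \<in> (\<Union>m. fil m)" using fil_uminus by blast
    fix b assume "b \<in> (\<Union>m. fil m)"
    then obtain n where b: "b \<in> fil n" by blast
    show "a \<otimes> b \<in> (\<Union>m. fil m)" using fil_mult[OF a b] by blast
    have "a \<in> fil (max m n)" "b \<in> fil (max m n)"
      using a b fil_mono[of m "max m n"] fil_mono[of n "max m n"] by auto
    from fil_add[OF this] show "a \<oplus> b \<in> (\<Union>m. fil m)" by blast
  qed
  moreover have "K \<union> S \<subseteq> (\<Union>m. fil m)" using fil_K fil_S by blast
  ultimately show "carrier R \<subseteq> (\<Union>m. fil m)"
    unfolding gen[symmetric] using Kc S(2) by (intro generate_ring_min_subring1) auto
qed (use fil_carrier in blast)

text \<open>
  The filtration is the least one with the prescribed generators: any multiplicative family of subgroups that contains them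
  bounds the coefficients of the Rees ring.
\<close>

lemma fil_rees_coeff_subring:
  assumes B: "\<And>m. B m \<subseteq> carrier R" "\<And>m. \<zero> \<in> B m" "\<And>m a b. a \<in> B m \<Longrightarrow> b \<in> B m \<Longrightarrow> a \<oplus> b \<in> B m"
    "\<And>m a. a \<in> B m \<Longrightarrow> \<ominus> a \<in> B m" "\<And>m n a b. a \<in> B m \<Longrightarrow> b \<in> B n \<Longrightarrow> a \<otimes> b \<in> B (m + n)"
    and gens: "K \<subseteq> B 0" "x \<in> B 0" "\<one> \<in> B 1" "S \<subseteq> B 1" and h: "h \<in> fil_rees"
  shows "up_coeff R h m \<in> B m"
proof -
  define E where "E = {h \<in> carrier (UP R). \<forall>m. up_coeff R h m \<in> B m}"
  have "subring E (UP R)"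
  proof (rule U.P.subringI)
    show "E \<subseteq> carrier (UP R)" by (auto simp: E_def)
    show "\<one>\<^bsub>UP R\<^esub> \<in> E" using gens(1) subringE(3)[OF Kring] B(2) by (auto simp: E_def)
    fix h assume h: "h \<in> E"
    thus "\<ominus>\<^bsub>UP R\<^esub> h \<in> E" using B(4) by (auto simp: E_def)
    fix h' assume h': "h' \<in> E"
    show "h \<oplus>\<^bsub>UP R\<^esub> h' \<in> E" using h h' B(3) by (auto simp: E_def)
    have "(\<Oplus>i\<in>{..m}. up_coeff R h i \<otimes> up_coeff R h' (m - i)) \<in> B m" for m
    proof (rule finsum_in_subset)
      fix i assume "i \<in> {..m}"
      thus "up_coeff R h i \<otimes> up_coeff R h' (m - i) \<in> B m"
        using B(5)[of "up_coeff R h i" i "up_coeff R h' (m - i)" "m - i"] h h' by (auto simp: E_def)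
    qed (use B in auto)
    thus "h \<otimes>\<^bsub>UP R\<^esub> h' \<in> E" using h h' by (auto simp: E_def)
  qed
  moreover have "up_monom R a j \<in> E" if "a \<in> B j" for a j
    using that B(1)[of j] B(2) by (auto simp: E_def)
  hence "(\<lambda>a. up_monom R a 0) ` K \<union> fil_rees_gens \<subseteq> E" using gens by (auto simp: fil_rees_gens_def)
  ultimately have "fil_rees \<subseteq> E" unfolding fil_rees_def by (intro U.P.generate_ring_min_subring1 fil_rees_gens_carrier)
  thus ?thesis using h by (auto simp: E_def)
qed

lemma fil_rees_coeff: "h \<in> fil_rees \<Longrightarrow> up_coeff R h m \<in> fil m"
  by (rule fil_rees_coeff_subring) (use fil_carrier fil_zero fil_add fil_uminus fil_mult fil_K fil_x fil_one fil_S in auto)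

lemma fil_0: "fil 0 \<subseteq> Kx"
proof
  fix v assume v: "v \<in> fil 0"
  define B where "B m = (if m = 0 then Kx else carrier R)" for m :: nat
  have "up_coeff R (up_monom R v 0) 0 \<in> B 0"
  proof (rule fil_rees_coeff_subring)
    show "up_monom R v 0 \<in> fil_rees" using v by (simp add: fil_def)
    show "K \<subseteq> B 0" "x \<in> B 0" using Kx by (simp_all add: B_def)
    show "S \<subseteq> B 1" "\<one> \<in> B 1" using S(2) by (auto simp: B_def)
    show "B m \<subseteq> carrier R" for m using Kxc by (simp add: B_def)
    show "\<zero> \<in> B m" for m using subringE(2)[OF Kx(3)] by (simp add: B_def)
    show "a \<oplus> b \<in> B m" if "a \<in> B m" "b \<in> B m" for m a b
      using that subringE(7)[OF Kx(3), of a b] by (cases "m = 0") (simp_all add: B_def)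
    show "\<ominus> a \<in> B m" if "a \<in> B m" for m a
      using that subringE(5)[OF Kx(3), of a] by (cases "m = 0") (simp_all add: B_def)
    show "a \<otimes> b \<in> B (m + n)" if "a \<in> B m" "b \<in> B n" for m n a b
    proof (cases "m + n = 0")
      case True thus ?thesis using that subringE(6)[OF Kx(3), of a b] by (simp add: B_def)
    next
      case False
      have "a \<in> carrier R" "b \<in> carrier R" using that Kxc by (auto simp: B_def split: if_splits)
      hence "a \<otimes> b \<in> carrier R" by simp
      thus ?thesis unfolding B_def using False by (simp only: if_False)
    qed
  qed
  thus "v \<in> Kx" using v by (simp add: B_def fil_def)
qed

text \<open>
  The set \<open>V\<^bsub>m-1\<^esub> + M\<close> for the filtration \<open>V = fil\<close>, with \<open>V\<^bsub>-1\<^esub> = 0\<close>.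
\<close>

definition prev_fil where "prev_fil m = {a \<in> carrier R. \<exists>v\<in>(case m of 0 \<Rightarrow> {\<zero>} | Suc j \<Rightarrow> fil j). a \<ominus> v \<in> M}"

lemma prev_fil_carrier: "prev_fil m \<subseteq> carrier R" by (auto simp: prev_fil_def)

lemma prev_fil_zero: "\<zero> \<in> prev_fil m"
proof -
  have "\<zero> \<ominus> \<zero> \<in> M" using Mo(2) by (simp add: a_minus_def)
  thus ?thesis using fil_zero by (cases m) (auto simp: prev_fil_def)
qed

lemma prev_fil_add: assumes "a \<in> prev_fil m" "b \<in> prev_fil m" shows "a \<oplus> b \<in> prev_fil m"
proof -
  let ?B = "case m of 0 \<Rightarrow> {\<zero>} | Suc j \<Rightarrow> fil j"
  obtain v w where v: "v \<in> ?B" "a \<ominus> v \<in> M" and w: "w \<in> ?B" "b \<ominus> w \<in> M"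
    using assms by (auto simp: prev_fil_def)
  have c: "a \<in> carrier R" "b \<in> carrier R" "v \<in> carrier R" "w \<in> carrier R"
    using assms v(1) w(1) fil_carrier by (auto simp: prev_fil_def split: nat.splits)
  have "v \<oplus> w \<in> ?B" using v(1) w(1) fil_add by (cases m) auto
  moreover have "(a \<oplus> b) \<ominus> (v \<oplus> w) = (a \<ominus> v) \<oplus> (b \<ominus> w)" using c by algebra
  hence "(a \<oplus> b) \<ominus> (v \<oplus> w) \<in> M" using Mo(3)[OF v(2) w(2)] by simp
  ultimately show ?thesis using c unfolding prev_fil_def by blast
qed

lemma prev_fil_mult: assumes "r \<in> fil j" "a \<in> prev_fil m" shows "r \<otimes> a \<in> prev_fil (j + m)"
proof -
  obtain v where v: "v \<in> (case m of 0 \<Rightarrow> {\<zero>} | Suc j \<Rightarrow> fil j)" "a \<ominus> v \<in> M"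
    using assms by (auto simp: prev_fil_def)
  have c: "a \<in> carrier R" "r \<in> carrier R" "v \<in> carrier R"
    using assms v(1) fil_carrier by (auto simp: prev_fil_def split: nat.splits)
  have "r \<otimes> v \<in> (case j + m of 0 \<Rightarrow> {\<zero>} | Suc j \<Rightarrow> fil j)"
  proof (cases m)
    case 0 thus ?thesis using v(1) c fil_zero by (cases j) auto
  next
    case (Suc n) thus ?thesis using v(1) fil_mult[OF assms(1), of v n] by simp
  qed
  moreover have "(r \<otimes> a) \<ominus> (r \<otimes> v) = r \<otimes> (a \<ominus> v)" using c by algebra
  hence "(r \<otimes> a) \<ominus> (r \<otimes> v) \<in> M" using Mo(6)[OF v(2) c(2)] by simp
  ultimately show ?thesis using c unfolding prev_fil_def by blast
qed

text \<open>
  The Rees elements whose coefficients \<open>p\<close> annihilates in the quotients of \<open>V\<^sub>m\<close> by \<open>V\<^bsub>m-1\<^esub> + M\<close>.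
\<close>

definition torsion where "torsion p = {h \<in> fil_rees. \<forall>m. p \<otimes> up_coeff R h m \<in> prev_fil m}"

abbreviation (input) "fil_rees_ring \<equiv> (UP R)\<lparr>carrier := fil_rees\<rparr>"

lemma fil_rees_ring_cring: "cring fil_rees_ring"
  using U.P.subcringI'[OF fil_rees_subring] U.P.subcring_iff[OF subringE(1)[OF fil_rees_subring]] by blast

lemma fil_rees_closed: "h \<in> fil_rees \<Longrightarrow> h \<in> carrier (UP R)" using subringE(1)[OF fil_rees_subring] by blast

lemma torsion_ideal: assumes p: "p \<in> Kx" shows "ideal (torsion p) fil_rees_ring"
proof (rule cring.idealI_simple[OF fil_rees_ring_cring])
  have pc: "p \<in> carrier R" using p Kxc by blast
  show "torsion p \<subseteq> carrier fil_rees_ring" by (auto simp: torsion_def)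
  show "\<zero>\<^bsub>fil_rees_ring\<^esub> \<in> torsion p" using subringE(2)[OF fil_rees_subring] prev_fil_zero pc by (simp add: torsion_def)
  fix h assume h: "h \<in> torsion p"
  hence hH: "h \<in> fil_rees" and hW: "p \<otimes> up_coeff R h m \<in> prev_fil m" for m by (auto simp: torsion_def)
  note hc = fil_rees_closed[OF hH]
  { fix h' assume h': "h' \<in> torsion p"
    hence hH': "h' \<in> fil_rees" and hW': "p \<otimes> up_coeff R h' m \<in> prev_fil m" for m by (auto simp: torsion_def)
    have "p \<otimes> up_coeff R (h \<oplus>\<^bsub>UP R\<^esub> h') m = p \<otimes> up_coeff R h m \<oplus> p \<otimes> up_coeff R h' m" for m
      using pc hc fil_rees_closed[OF hH'] by (simp add: r_distr)
    hence "h \<oplus>\<^bsub>UP R\<^esub> h' \<in> torsion p"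
      using prev_fil_add[OF hW hW'] subringE(7)[OF fil_rees_subring hH hH'] by (simp add: torsion_def)
    thus "h \<oplus>\<^bsub>fil_rees_ring\<^esub> h' \<in> torsion p" by simp }
  { fix r assume "r \<in> carrier fil_rees_ring"
    hence r: "r \<in> fil_rees" by simp
    note rc = fil_rees_closed[OF r]
    have "p \<otimes> up_coeff R (r \<otimes>\<^bsub>UP R\<^esub> h) m \<in> prev_fil m" for m
    proof -
      have "p \<otimes> up_coeff R (r \<otimes>\<^bsub>UP R\<^esub> h) m = (\<Oplus>i\<in>{..m}. p \<otimes> (up_coeff R r i \<otimes> up_coeff R h (m - i)))"
        using pc rc hc by (simp add: finsum_rdistr Pi_def)
      also have "\<dots> \<in> prev_fil m"
      proof (rule finsum_in_subset)
        fix i assume i: "i \<in> {..m}"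
        have "p \<otimes> (up_coeff R r i \<otimes> up_coeff R h (m - i)) = up_coeff R r i \<otimes> (p \<otimes> up_coeff R h (m - i))"
          using pc rc hc by (simp add: m_lcomm)
        also have "\<dots> \<in> prev_fil (i + (m - i))" by (rule prev_fil_mult[OF fil_rees_coeff[OF r] hW])
        finally show "p \<otimes> (up_coeff R r i \<otimes> up_coeff R h (m - i)) \<in> prev_fil m" using i by simp
      qed (use prev_fil_zero prev_fil_add prev_fil_carrier in auto)
      finally show ?thesis .
    qed
    thus "r \<otimes>\<^bsub>fil_rees_ring\<^esub> h \<in> torsion p" using subringE(6)[OF fil_rees_subring r hH] by (simp add: torsion_def) }
qed

lemma torsion_mono: assumes "p \<in> Kx" "p' \<in> Kx" shows "torsion p \<subseteq> torsion (p' \<otimes> p)"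
proof
  fix h assume h: "h \<in> torsion p"
  have "p' \<otimes> p \<otimes> up_coeff R h m \<in> prev_fil m" for m
    using prev_fil_mult[of p' 0 "p \<otimes> up_coeff R h m" m] h assms Kx_fil_0 Kxc fil_rees_closed[of h]
    by (auto simp: torsion_def m_assoc subset_iff)
  thus "h \<in> torsion (p' \<otimes> p)" using h by (simp add: torsion_def)
qed

text \<open>
  All torsion elements together form an ideal of the Noetherian Rees ring; the product of annihilators of finitely many generators
  annihilates it.
\<close>

lemma torsion_bounded: "\<exists>q\<in>Kx. q \<notin> M \<and> (\<forall>p\<in>Kx. p \<notin> M \<longrightarrow> torsion p \<subseteq> torsion q)"
proof -
  interpret fil_rees_ring: cring fil_rees_ring by (rule fil_rees_ring_cring)
  define all_torsion where "all_torsion = \<Union>(torsion ` (Kx - M))"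
  have K1: "\<one> \<in> Kx - M" using M1 subringE(3)[OF Kx(3)] by simp
  have dir: "p' \<otimes> p \<in> Kx - M" "torsion p \<subseteq> torsion (p' \<otimes> p)" "torsion p' \<subseteq> torsion (p' \<otimes> p)"
    if "p \<in> Kx - M" "p' \<in> Kx - M" for p p'
  proof -
    have "p' \<otimes> p \<notin> M" using that Kxc primeideal.I_prime[OF Mp] by blast
    thus "p' \<otimes> p \<in> Kx - M" using that subringE(6)[OF Kx(3), of p' p] by blast
    show "torsion p \<subseteq> torsion (p' \<otimes> p)" using torsion_mono that by blast
    have "torsion p' \<subseteq> torsion (p \<otimes> p')" using torsion_mono that by blast
    moreover have "p \<otimes> p' = p' \<otimes> p" using that Kxc by (intro m_comm) blast+
    ultimately show "torsion p' \<subseteq> torsion (p' \<otimes> p)" by simp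
  qed
  have "ideal all_torsion fil_rees_ring"
  proof (rule fil_rees_ring.idealI_simple)
    show "all_torsion \<subseteq> carrier fil_rees_ring" by (auto simp: all_torsion_def torsion_def)
    show "\<zero>\<^bsub>fil_rees_ring\<^esub> \<in> all_torsion" using K1 fil_rees_ring.ideal_ops(2)[OF torsion_ideal] unfolding all_torsion_def by blast
    fix h assume "h \<in> all_torsion"
    then obtain p where p: "p \<in> Kx - M" "h \<in> torsion p" unfolding all_torsion_def by blast
    { fix h' assume "h' \<in> all_torsion"
      then obtain p' where p': "p' \<in> Kx - M" "h' \<in> torsion p'" unfolding all_torsion_def by blast
      note d = dir[OF p(1) p'(1)]
      have "h \<oplus>\<^bsub>fil_rees_ring\<^esub> h' \<in> torsion (p' \<otimes> p)"
        using fil_rees_ring.ideal_ops(3)[OF torsion_ideal] d p p' by blast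
      thus "h \<oplus>\<^bsub>fil_rees_ring\<^esub> h' \<in> all_torsion" using d(1) unfolding all_torsion_def by blast }
    { fix r assume "r \<in> carrier fil_rees_ring"
      hence "r \<otimes>\<^bsub>fil_rees_ring\<^esub> h \<in> torsion p" using fil_rees_ring.ideal_ops(6)[OF torsion_ideal, of p h r] p by blast
      thus "r \<otimes>\<^bsub>fil_rees_ring\<^esub> h \<in> all_torsion" using p(1) unfolding all_torsion_def by blast }
  qed
  then obtain A where A: "A \<subseteq> carrier fil_rees_ring" "finite A" "all_torsion = genideal fil_rees_ring A"
    using noetherian_ring.finetely_gen[OF fil_rees_noetherian] by blast
  have "A \<subseteq> all_torsion" using fil_rees_ring.genideal_self[OF A(1)] A(3) by simp
  with A(2) have "\<exists>q\<in>Kx - M. A \<subseteq> torsion q"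
  proof (induction A rule: finite_induct)
    case empty thus ?case using K1 by blast
  next
    case (insert a A)
    then obtain q where q: "q \<in> Kx - M" "A \<subseteq> torsion q" by auto
    obtain p where p: "p \<in> Kx - M" "a \<in> torsion p" using insert unfolding all_torsion_def by blast
    note d = dir[OF p(1) q(1)]
    have "insert a A \<subseteq> torsion (q \<otimes> p)" using d q p by blast
    thus ?case using d(1) by blast
  qed
  then obtain q where q: "q \<in> Kx - M" "A \<subseteq> torsion q" by blast
  have "all_torsion \<subseteq> torsion q" unfolding A(3) using q by (intro fil_rees_ring.genideal_minimal torsion_ideal) auto
  thus ?thesis using q(1) unfolding all_torsion_def by blast
qed

lemma no_transcendental_residue: False
proof -
  obtain q where q: "q \<in> Kx" "q \<notin> M" and qT: "\<And>p. p \<in> Kx \<Longrightarrow> p \<notin> M \<Longrightarrow> torsion p \<subseteq> torsion q"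
    using torsion_bounded by blast
  obtain n where n: "q \<in> poly_below R K x n" using q(1) by blast
  have "\<exists>c\<in>K. \<forall>w\<in>Kx. q \<ominus> (x \<ominus> c) \<otimes> w \<notin> M"
    using mem_M_of_infinitely_many_roots[OF n infK subset_refl] q(2) by blast
  then obtain c where c: "c \<in> K" "\<And>w. w \<in> Kx \<Longrightarrow> q \<ominus> (x \<ominus> c) \<otimes> w \<notin> M" by blast
  obtain q' e where q': "q' \<in> poly_below R K x (n - 1)" "e \<in> K" "q = (x \<ominus> c) \<otimes> q' \<oplus> e"
    using poly_below_divide_linear[OF Kring x c(1) n] by blast
  have q'K: "q' \<in> Kx" using q'(1) by blast
  have cc: "q \<in> carrier R" "q' \<in> carrier R" "e \<in> carrier R" "c \<in> carrier R"
    using q'(2) c(1) Kc q'K q(1) Kxc by (blast, blast, blast, blast)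
  have "q \<ominus> (x \<ominus> c) \<otimes> q' = e" unfolding q'(3) using cc x by algebra
  hence "e \<noteq> \<zero>" using c(2)[OF q'K] Mo(2) by auto
  hence inv: "inv e \<in> K" "inv e \<otimes> e = \<one>" using subfield_m_inv[OF K, of e] q' by auto
  have ic: "inv e \<in> carrier R" using inv Kc by auto
  have xcK: "x \<ominus> c \<in> Kx" unfolding a_minus_def
    using Kx(1,2) c(1) by (intro subringE(5,7)[OF Kx(3)]) auto
  have xcM: "x \<ominus> c \<notin> M" by (rule linear_notin_M[OF c(1)])
  have xc: "x \<ominus> c \<in> carrier R" using x cc by simp
  define good where "good m y \<longleftrightarrow> y \<in> fil m \<and> (x \<ominus> c) \<otimes> y \<ominus> \<one> \<in> M" for m y
  have "\<exists>m y. good m y"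
  proof -
    have "adjoin M (x \<ominus> c) = carrier R"
      using maximalideal.I_maximal[OF M adjoin_ideal[OF Mi xc]] adjoin_superset[OF Mi xc] xcM
        ideal_ops(1)[OF adjoin_ideal[OF Mi xc]] by blast
    hence "\<one> \<in> adjoin M (x \<ominus> c)" by simp
    then obtain u y where u: "u \<in> M" "y \<in> carrier R" "\<one> = u \<oplus> (x \<ominus> c) \<otimes> y" by (rule adjoinE)
    have uc: "u \<in> carrier R" using u Mo(1) by blast
    have "(x \<ominus> c) \<otimes> y \<ominus> \<one> = \<ominus> u" unfolding u(3) using uc u(2) x cc by algebra
    hence "(x \<ominus> c) \<otimes> y \<ominus> \<one> \<in> M" using Mo(5)[OF u(1)] by simp
    thus ?thesis using fil_exhausts u(2) unfolding good_def by blast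
  qed
  define m where "m = (LEAST m. \<exists>y. good m y)"
  obtain y where y: "good m y" using LeastI_ex[OF \<open>\<exists>m y. good m y\<close>] unfolding m_def by blast
  have min: "\<not> good j y" if "j < m" for j y using not_less_Least[OF that[unfolded m_def]] by blast
  have yV: "y \<in> fil m" and yM: "(x \<ominus> c) \<otimes> y \<ominus> \<one> \<in> M" using y by (auto simp: good_def)
  have yc: "y \<in> carrier R" using yV fil_carrier by blast
  show False
  proof (cases m)
    case 0
    thus False using yV fil_0 linear_not_unit[OF c(1)] yM by blast
  next
    case (Suc j)
    have Vj: "Kx \<subseteq> fil j" using Kx_fil_0 fil_mono[of 0 j] by auto
    have "(x \<ominus> c) \<otimes> y \<in> prev_fil m"
      unfolding prev_fil_def using Suc yM xc yc Vj subringE(3)[OF Kx(3)] by auto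
    hence "up_monom R y m \<in> torsion (x \<ominus> c)"
      unfolding torsion_def using yV yc prev_fil_zero xc by (auto simp: fil_def)
    hence "up_monom R y m \<in> torsion q" using qT[OF xcK xcM] by blast
    hence "q \<otimes> up_coeff R (up_monom R y m) m \<in> prev_fil m" unfolding torsion_def by blast
    hence "q \<otimes> y \<in> prev_fil m" using yc by simp
    then obtain v where v: "v \<in> fil j" "q \<otimes> y \<ominus> v \<in> M" using Suc by (auto simp: prev_fil_def)
    have vc: "v \<in> carrier R" using v fil_carrier by blast
    define y' where "y' = inv e \<otimes> (v \<ominus> q')"
    have y'c: "y' \<in> carrier R" unfolding y'_def using ic vc cc by simp
    have "y' \<in> fil j"
    proof -
      have "v \<ominus> q' \<in> fil j" unfolding a_minus_def using v(1) q'K Vj by (intro fil_add fil_uminus) auto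
      moreover have "inv e \<in> fil 0" using inv fil_K by blast
      ultimately show ?thesis unfolding y'_def using fil_mult[of "inv e" 0 "v \<ominus> q'" j] by simp
    qed
    moreover have "(x \<ominus> c) \<otimes> y' \<ominus> \<one> \<in> M"
    proof -
      \<comment> \<open>\<open>e y \<equiv> q y - q' (x - c) y \<equiv> v - q'\<close>, so \<open>y' \<equiv> y\<close> modulo \<open>M\<close>.\<close>
      have "e \<otimes> y = (q \<otimes> y) \<ominus> q' \<otimes> ((x \<ominus> c) \<otimes> y)" unfolding q'(3) using cc yc x by algebra
      hence "inv e \<otimes> ((q \<otimes> y \<ominus> v) \<ominus> q' \<otimes> ((x \<ominus> c) \<otimes> y \<ominus> \<one>)) = inv e \<otimes> (e \<otimes> y \<ominus> (v \<ominus> q'))"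
        using cc yc vc ic xc by algebra
      also have "\<dots> = (inv e \<otimes> e) \<otimes> y \<ominus> y'" unfolding y'_def using cc yc vc ic by algebra
      finally have e: "inv e \<otimes> ((q \<otimes> y \<ominus> v) \<ominus> q' \<otimes> ((x \<ominus> c) \<otimes> y \<ominus> \<one>)) = y \<ominus> y'" using inv yc by simp
      have "y \<ominus> y' \<in> M"
        unfolding e[symmetric] by (rule Mo(6)[OF Mo(4)[OF v(2) Mo(6)[OF yM cc(2)]] ic])
      hence "((x \<ominus> c) \<otimes> y \<ominus> \<one>) \<ominus> (x \<ominus> c) \<otimes> (y \<ominus> y') \<in> M" by (rule Mo(4)[OF yM Mo(6)[OF _ xc]])
      moreover have "((x \<ominus> c) \<otimes> y \<ominus> \<one>) \<ominus> (x \<ominus> c) \<otimes> (y \<ominus> y') = (x \<ominus> c) \<otimes> y' \<ominus> \<one>"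
        using xc yc y'c by algebra
      ultimately show ?thesis by simp
    qed
    ultimately have "good j y'" unfolding good_def by blast
    thus False using min[of j] Suc by simp
  qed
qed

end

theorem (in cring) nullstellensatz:
  assumes "subfield K R" "infinite K" "finite S" "S \<subseteq> carrier R"
    and "generate_ring R (K \<union> S) = carrier R" and "maximalideal M R" and "x \<in> carrier R"
  shows "\<exists>N. \<exists>v\<in>poly_below R K x N. x [^] N \<oplus> v \<in> M"
  using transcendental_residue.no_transcendental_residue[OF transcendental_residue.intro, OF is_cring
      transcendental_residue_axioms.intro, OF assms] by blast

section \<open>Powers of the members of a regular sequence\<close>

context cring
begin

text \<open>
  From \<open>x a \<equiv> z b\<close> modulo \<open>Q\<close>, regularity of \<open>z\<close> modulo \<open>Q + (x)\<close> gives \<open>b \<equiv> x c\<close>, and cancelling \<open>x\<close> gives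
  \<open>a \<equiv> z c\<close>.
\<close>

lemma nonzerodivisor_mod_swap:
  assumes Q: "ideal Q R" and x: "x \<in> carrier R" and z: "z \<in> carrier R"
    and nx: "nonzerodivisor_mod Q x" and nz: "nonzerodivisor_mod (adjoin Q x) z"
  shows "nonzerodivisor_mod (adjoin Q z) x"
  unfolding nonzerodivisor_mod_def
proof (intro ballI impI)
  note Qo = ideal_ops[OF Q]
  fix a assume a: "a \<in> carrier R" "x \<otimes> a \<in> adjoin Q z"
  from a(2) obtain q b where q: "q \<in> Q" "b \<in> carrier R" "x \<otimes> a = q \<oplus> z \<otimes> b" by (rule adjoinE)
  have qc: "q \<in> carrier R" using q Qo(8) by blast
  have "z \<otimes> b = x \<otimes> a \<ominus> q" unfolding q(3) using qc z q(2) by algebra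
  also have "\<dots> = \<ominus> q \<oplus> x \<otimes> a" using qc x a by algebra
  finally have "z \<otimes> b \<in> adjoin Q x" using adjoinI[OF Qo(5)[OF q(1)] a(1)] by simp
  hence "b \<in> adjoin Q x" using nz q(2) unfolding nonzerodivisor_mod_def by blast
  then obtain q' c where q': "q' \<in> Q" "c \<in> carrier R" "b = q' \<oplus> x \<otimes> c" by (rule adjoinE)
  have qc': "q' \<in> carrier R" using q' Qo(8) by blast
  have "x \<otimes> (a \<ominus> z \<otimes> c) = x \<otimes> a \<ominus> z \<otimes> (x \<otimes> c)" using x a z q'(2) by algebra
  also have "\<dots> = q \<oplus> z \<otimes> q'" unfolding q(3) q'(3) using qc qc' z x q'(2) by algebra
  also have "\<dots> \<in> Q" by (intro Qo(3) Qo(6) q q' z)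
  finally have "a \<ominus> z \<otimes> c \<in> Q" using nx a z q'(2) unfolding nonzerodivisor_mod_def by simp
  hence "(a \<ominus> z \<otimes> c) \<oplus> z \<otimes> c \<in> adjoin Q z" using q'(2) by (intro adjoinI)
  moreover have "(a \<ominus> z \<otimes> c) \<oplus> z \<otimes> c = a" using a z q'(2) by algebra
  ultimately show "a \<in> adjoin Q z" by simp
qed

text \<open>
  If \<open>y a \<equiv> u v c\<close> modulo \<open>Q\<close>, then regularity of \<open>y\<close> modulo \<open>Q + (u)\<close> gives \<open>a \<equiv> u b\<close>; cancelling \<open>u\<close> leaves
  \<open>y b \<equiv> v c\<close>, to which regularity modulo \<open>Q + (v)\<close> applies.
\<close>

lemma regular_mod_mult_step:
  assumes "ideal Q R" "u \<in> carrier R" "v \<in> carrier R" "set ys \<subseteq> carrier R"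
    and "nonzerodivisor_mod Q u" "regular_mod (adjoin Q u) ys" "regular_mod (adjoin Q v) ys"
  shows "regular_mod (adjoin Q (u \<otimes> v)) ys"
  using assms
proof (induction ys arbitrary: Q)
  case (Cons y ys)
  note Qo = ideal_ops[OF Cons.prems(1)]
  note u = Cons.prems(2) and v = Cons.prems(3)
  have y: "y \<in> carrier R" using Cons.prems by simp
  have uv: "u \<otimes> v \<in> carrier R" using u v by simp
  have nu: "\<And>a. a \<in> carrier R \<Longrightarrow> u \<otimes> a \<in> Q \<Longrightarrow> a \<in> Q"
    using Cons.prems(5) by (simp add: nonzerodivisor_mod_def)
  have nyu: "\<And>a. a \<in> carrier R \<Longrightarrow> y \<otimes> a \<in> adjoin Q u \<Longrightarrow> a \<in> adjoin Q u"
    and nyv: "\<And>a. a \<in> carrier R \<Longrightarrow> y \<otimes> a \<in> adjoin Q v \<Longrightarrow> a \<in> adjoin Q v"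
    using Cons.prems(6,7) by (simp_all add: nonzerodivisor_mod_def)
  have "nonzerodivisor_mod (adjoin Q (u \<otimes> v)) y"
    unfolding nonzerodivisor_mod_def
  proof (intro ballI impI)
    fix a assume a: "a \<in> carrier R" "y \<otimes> a \<in> adjoin Q (u \<otimes> v)"
    from a(2) obtain q c where q: "q \<in> Q" "c \<in> carrier R" "y \<otimes> a = q \<oplus> (u \<otimes> v) \<otimes> c" by (rule adjoinE)
    have qc: "q \<in> carrier R" using q Qo(1) by blast
    have "y \<otimes> a = q \<oplus> u \<otimes> (v \<otimes> c)" using q u v by (simp add: m_assoc)
    hence "y \<otimes> a \<in> adjoin Q u" using adjoinI[OF q(1), of "v \<otimes> c" u] q v by simp
    from nyu[OF a(1) this]
    obtain q' b where q': "q' \<in> Q" "b \<in> carrier R" "a = q' \<oplus> u \<otimes> b" by (rule adjoinE)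
    have qc': "q' \<in> carrier R" using q' Qo(1) by blast
    have "u \<otimes> (y \<otimes> b \<ominus> v \<otimes> c) = (y \<otimes> a \<ominus> y \<otimes> q') \<ominus> (u \<otimes> v) \<otimes> c"
      unfolding q'(3) using y q'(2) qc' u v q(2) by algebra
    also have "\<dots> = q \<ominus> y \<otimes> q'" unfolding q(3) using qc qc' y u v q(2) by algebra
    also have "\<dots> \<in> Q" by (intro Qo(4) Qo(6) q q' y)
    finally have "y \<otimes> b \<ominus> v \<otimes> c \<in> Q" using nu y q'(2) v q(2) by simp
    hence "(y \<otimes> b \<ominus> v \<otimes> c) \<oplus> v \<otimes> c \<in> adjoin Q v" using q(2) by (intro adjoinI)
    moreover have "(y \<otimes> b \<ominus> v \<otimes> c) \<oplus> v \<otimes> c = y \<otimes> b" using y q'(2) v q(2) by algebra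
    ultimately have "b \<in> adjoin Q v" using nyv q'(2) by simp
    then obtain q'' e where b: "q'' \<in> Q" "e \<in> carrier R" "b = q'' \<oplus> v \<otimes> e" by (rule adjoinE)
    have qc'': "q'' \<in> carrier R" using b Qo(1) by blast
    have "a = (q' \<oplus> u \<otimes> q'') \<oplus> (u \<otimes> v) \<otimes> e"
      unfolding q'(3) b(3) using qc' qc'' u v b(2) by algebra
    moreover have "q' \<oplus> u \<otimes> q'' \<in> Q" by (intro Qo(3) Qo(6) q' b u)
    ultimately show "a \<in> adjoin Q (u \<otimes> v)" using adjoinI b(2) by metis
  qed
  moreover have "regular_mod (adjoin (adjoin Q y) (u \<otimes> v)) ys"
  proof (rule Cons.IH[OF adjoin_ideal[OF Cons.prems(1) y] u v])
    show "set ys \<subseteq> carrier R" using Cons.prems by simp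
    show "regular_mod (adjoin (adjoin Q y) u) ys" "regular_mod (adjoin (adjoin Q y) v) ys"
      using Cons.prems(6,7) adjoin_commute[OF Cons.prems(1) y] u v by simp_all
    show "nonzerodivisor_mod (adjoin Q y) u"
      using Cons.prems(6) by (intro nonzerodivisor_mod_swap[OF Cons.prems(1) u y Cons.prems(5)]) simp
  qed
  ultimately show ?case
    using adjoin_commute[OF Cons.prems(1) uv y] by simp
qed simp

lemma nonzerodivisor_mod_mult:
  assumes "nonzerodivisor_mod Q u" "nonzerodivisor_mod Q v" "u \<in> carrier R" "v \<in> carrier R"
  shows "nonzerodivisor_mod Q (u \<otimes> v)"
  unfolding nonzerodivisor_mod_def
proof (intro ballI impI)
  fix a assume a: "a \<in> carrier R" "u \<otimes> v \<otimes> a \<in> Q"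
  have "u \<otimes> (v \<otimes> a) \<in> Q" using a assms(3,4) by (simp only: m_assoc)
  hence "v \<otimes> a \<in> Q" using assms(1,4) a(1) unfolding nonzerodivisor_mod_def by blast
  thus "a \<in> Q" using assms(2) a(1) unfolding nonzerodivisor_mod_def by blast
qed

lemma regular_mod_pow_head:
  assumes Q: "ideal Q R" and x: "x \<in> carrier R" and ys: "set ys \<subseteq> carrier R"
    and reg: "regular_mod Q (x # ys)"
  shows "regular_mod Q (x [^] Suc n # ys)"
proof (induction n)
  case 0 show ?case using reg x by simp
next
  case (Suc n)
  let ?p = "x [^] Suc n"
  have p: "?p \<in> carrier R" using x by simp
  have "regular_mod (adjoin Q (?p \<otimes> x)) ys"
    using Suc reg by (intro regular_mod_mult_step[OF Q p x ys]) auto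
  moreover have "nonzerodivisor_mod Q (?p \<otimes> x)"
    using Suc reg by (intro nonzerodivisor_mod_mult p x) auto
  ultimately show ?case by simp
qed

lemma regular_mod_pow:
  assumes "ideal Q R" "set xs \<subseteq> carrier R" "regular_mod Q xs" "length ns = length xs"
    "\<And>n. n \<in> set ns \<Longrightarrow> n \<noteq> (0::nat)"
  shows "regular_mod Q (map2 (\<lambda>x n. x [^] n) xs ns)"
  using assms
proof (induction xs arbitrary: Q ns)
  case (Cons x xs)
  then obtain n ms where ns: "ns = n # ms" by (cases ns) auto
  obtain m where m: "n = Suc m" using Cons.prems(5)[of n] ns by (cases n) auto
  have x: "x \<in> carrier R" "x [^] n \<in> carrier R" using Cons.prems by auto
  have r: "regular_mod Q (x [^] n # xs)"
    unfolding m using Cons.prems by (intro regular_mod_pow_head) auto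
  have "regular_mod (adjoin Q (x [^] n)) (map2 (\<lambda>x n. x [^] n) xs ms)"
    using Cons.prems ns r x by (intro Cons.IH adjoin_ideal) auto
  thus ?case using r ns by simp
qed simp

end

section \<open>Components and homogeneous ideals\<close>

context standard_graded_ring
begin

lemma G_carrier: "G i \<subseteq> carrier R" using additive_subgroup.a_subset[OF piece_subgroup] .
lemma G_closed [intro, simp]: "a \<in> G i \<Longrightarrow> a \<in> carrier R" using G_carrier by blast
lemma G_zero [simp]: "\<zero> \<in> G i" using additive_subgroup.zero_closed[OF piece_subgroup] .
lemma G_add: "a \<in> G i \<Longrightarrow> b \<in> G i \<Longrightarrow> a \<oplus> b \<in> G i" using additive_subgroup.a_closed[OF piece_subgroup] .
lemma G_uminus: "a \<in> G i \<Longrightarrow> \<ominus> a \<in> G i" using additive_subgroup.a_inv_closed[OF piece_subgroup] .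
lemma one_G: "\<one> \<in> G 0" unfolding degree_zero using subringE(3)[OF subfieldE(1)[OF subfield_k]] .
lemma k_carrier: "k \<subseteq> carrier R" using G_carrier[of 0] degree_zero by simp
lemma one_not_zero: "\<one> \<noteq> \<zero>"
  using subfield_iff(2)[OF subfield_k, THEN field.axioms(1), THEN domain.one_not_zero] by simp

definition component :: "'a \<Rightarrow> nat \<Rightarrow> 'a" where
  "component a = (THE c. (\<forall>i. c i \<in> G i) \<and> finite {i. c i \<noteq> \<zero>} \<and> a = (\<Oplus>i\<in>{i. c i \<noteq> \<zero>}. c i))"

lemma component_spec:
  assumes "a \<in> carrier R"
  shows "component a i \<in> G i" "finite {i. component a i \<noteq> \<zero>}"
    "a = (\<Oplus>i\<in>{i. component a i \<noteq> \<zero>}. component a i)"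
  using theI'[OF direct_sum[OF assms]] unfolding component_def by blast+

lemma component_closed [simp]: "a \<in> carrier R \<Longrightarrow> component a i \<in> carrier R"
  using component_spec(1) by blast

lemma finsum_extend_support:
  assumes "finite I" "{i. c i \<noteq> \<zero>} \<subseteq> I" "\<And>i. c i \<in> carrier R"
  shows "(\<Oplus>i\<in>{i. c i \<noteq> \<zero>}. c i) = (\<Oplus>i\<in>I. c i)"
  using assms by (intro add.finprod_mono_neutral_cong_left) auto

lemma component_eqI:
  assumes "finite I" "{i. c i \<noteq> \<zero>} \<subseteq> I" "\<And>i. c i \<in> G i" "a = (\<Oplus>i\<in>I. c i)"
  shows "component a = c"
proof -
  have a: "a \<in> carrier R" unfolding assms(4) using assms(3) by (intro finsum_closed) auto
  have "(\<forall>i. c i \<in> G i) \<and> finite {i. c i \<noteq> \<zero>} \<and> a = (\<Oplus>i\<in>{i. c i \<noteq> \<zero>}. c i)"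
    using assms(3,4) finite_subset[OF assms(2,1)] finsum_extend_support[OF assms(1,2) G_closed[OF assms(3)]]
    by simp
  thus ?thesis unfolding component_def by (rule the1_equality[OF direct_sum[OF a]])
qed

lemma component_bound: assumes "a \<in> carrier R" obtains n where "\<And>i. i \<ge> n \<Longrightarrow> component a i = \<zero>"
proof -
  obtain n where "{i. component a i \<noteq> \<zero>} \<subseteq> {..<n}"
    using finite_nat_iff_bounded[of "{i. component a i \<noteq> \<zero>}"] component_spec(2)[OF assms] by blast
  hence "component a i = \<zero>" if "i \<ge> n" for i using that by force
  thus ?thesis by (rule that)
qed

lemma component_sum:
  assumes "a \<in> carrier R" "\<And>i. i \<ge> n \<Longrightarrow> component a i = \<zero>"
  shows "a = (\<Oplus>i\<in>{..<n}. component a i)"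
proof -
  have s: "{i. component a i \<noteq> \<zero>} \<subseteq> {..<n}" using assms(2) by (force simp: not_le[symmetric])
  show ?thesis using component_spec(3)[OF assms(1)] finsum_extend_support[OF _ s] assms(1) by simp
qed

lemma component_homogeneous: assumes "a \<in> G i" shows "component a j = (if j = i then a else \<zero>)"
proof -
  have "component a = (\<lambda>j. if j = i then a else \<zero>)"
    using assms by (intro component_eqI[of "{i}"]) auto
  thus ?thesis by simp
qed

lemma component_zero [simp]: "component \<zero> j = \<zero>"
  using component_homogeneous[of \<zero> 0 j] by simp

lemma component_add:
  assumes a: "a \<in> carrier R" and b: "b \<in> carrier R"
  shows "component (a \<oplus> b) j = component a j \<oplus> component b j"
proof -
  obtain m n where m: "\<And>i. i \<ge> m \<Longrightarrow> component a i = \<zero>" and n: "\<And>i. i \<ge> n \<Longrightarrow> component b i = \<zero>"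
    using component_bound a b by metis
  let ?N = "max m n"
  have A: "a = (\<Oplus>i\<in>{..<?N}. component a i)" and B: "b = (\<Oplus>i\<in>{..<?N}. component b i)"
    using m n a b by (auto intro!: component_sum)
  have "component (a \<oplus> b) = (\<lambda>i. component a i \<oplus> component b i)"
  proof (rule component_eqI[of "{..<?N}"])
    have "component a i \<oplus> component b i = \<zero>" if "i \<ge> ?N" for i using that m n by simp
    thus "{i. component a i \<oplus> component b i \<noteq> \<zero>} \<subseteq> {..<?N}" by (force simp: not_le[symmetric])
    show "component a i \<oplus> component b i \<in> G i" for i using component_spec(1) a b by (intro G_add)
    show "a \<oplus> b = (\<Oplus>i\<in>{..<?N}. component a i \<oplus> component b i)"
      using a b A B by (subst finsum_addf) auto
  qed simp
  thus ?thesis by simp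
qed

lemma component_uminus:
  assumes a: "a \<in> carrier R" shows "component (\<ominus> a) j = \<ominus> component a j"
proof -
  have "component (\<ominus> a) j \<oplus> component a j = component (\<ominus> a \<oplus> a) j"
    using a by (intro component_add[symmetric]) auto
  hence "component (\<ominus> a) j \<oplus> component a j = \<zero>" using a by (simp add: l_neg)
  thus ?thesis using a by (metis a_inv_closed component_closed minus_equality)
qed

lemma component_minus:
  "a \<in> carrier R \<Longrightarrow> b \<in> carrier R \<Longrightarrow> component (a \<ominus> b) j = component a j \<ominus> component b j"
  by (simp add: a_minus_def component_add component_uminus)

lemma component_finsum:
  assumes "finite I" "f \<in> I \<rightarrow> carrier R"
  shows "component (\<Oplus>i\<in>I. f i) j = (\<Oplus>i\<in>I. component (f i) j)"
  using assms by (induction I rule: finite_induct) (simp_all add: component_add Pi_def)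

lemma component_mult_homogeneous:
  assumes x: "x \<in> G e" and a: "a \<in> carrier R"
  shows "component (x \<otimes> a) j = (if e \<le> j then x \<otimes> component a (j - e) else \<zero>)"
proof -
  obtain n where n: "\<And>i. i \<ge> n \<Longrightarrow> component a i = \<zero>" using component_bound[OF a] by blast
  have A: "a = (\<Oplus>i\<in>{..<n}. component a i)" using component_sum[OF a n] .
  have xc: "x \<in> carrier R" using x by simp
  have hom: "x \<otimes> component a i \<in> G (e + i)" for i using piece_mult[OF x component_spec(1)[OF a]] .
  have "x \<otimes> a = (\<Oplus>i\<in>{..<n}. x \<otimes> component a i)"
    using A finsum_rdistr[of "{..<n}" x "component a"] xc a by auto
  hence "component (x \<otimes> a) j = (\<Oplus>i\<in>{..<n}. component (x \<otimes> component a i) j)"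
    using component_finsum[of "{..<n}" "\<lambda>i. x \<otimes> component a i" j] xc a by auto
  also have "\<dots> = (\<Oplus>i\<in>{..<n}. if e \<le> j \<and> j - e = i then x \<otimes> component a i else \<zero>)"
    using xc a by (intro finsum_cong') (auto simp: component_homogeneous[OF hom])
  also have "\<dots> = (if e \<le> j then x \<otimes> component a (j - e) else \<zero>)"
  proof (cases "e \<le> j \<and> j - e < n")
    case True
    hence "(\<Oplus>i\<in>{..<n}. if j - e = i then x \<otimes> component a i else \<zero>) = x \<otimes> component a (j - e)"
      using xc a by (intro finsum_singleton) auto
    thus ?thesis using True by simp
  next
    case False
    hence "(\<Oplus>i\<in>{..<n}. if e \<le> j \<and> j - e = i then x \<otimes> component a i else \<zero>) = (\<Oplus>i\<in>{..<n}. \<zero>)"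
      by (intro finsum_cong') auto
    also have "\<dots> = \<zero>" by simp
    finally show ?thesis using False n[of "j - e"] xc by auto
  qed
  finally show ?thesis .
qed

text \<open>
  For \<open>e = e' = 0\<close> this is multiplicativity of the constant term. Elements of \<open>I\<^sup>n\<close>, for \<open>I\<close> generated in degree \<open>d\<close>, satisfy
  the vanishing condition with \<open>n d\<close>.
\<close>

lemma component_mult_low:
  assumes a: "a \<in> carrier R" "\<And>i. i < e \<Longrightarrow> component a i = \<zero>"
    and b: "b \<in> carrier R" "\<And>i. i < e' \<Longrightarrow> component b i = \<zero>"
  shows "component (a \<otimes> b) (e + e') = component a e \<otimes> component b e'"
proof -
  obtain n where n: "\<And>i. i \<ge> n \<Longrightarrow> component a i = \<zero>" using component_bound[OF a(1)] by blast
  define N where "N = Suc (max n e)"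
  have A: "a = (\<Oplus>i\<in>{..<N}. component a i)" using component_sum[OF a(1), of N] n by (simp add: N_def)
  have "a \<otimes> b = (\<Oplus>i\<in>{..<N}. component a i \<otimes> b)"
    using A finsum_ldistr[of "{..<N}" b "component a"] a b by auto
  hence "component (a \<otimes> b) (e + e') = (\<Oplus>i\<in>{..<N}. component (component a i \<otimes> b) (e + e'))"
    using component_finsum[of "{..<N}" "\<lambda>i. component a i \<otimes> b"] a b by auto
  also have "\<dots> = (\<Oplus>i\<in>{..<N}. if e = i then component a i \<otimes> component b e' else \<zero>)"
  proof (rule finsum_cong')
    fix i assume "i \<in> {..<N}"
    have c: "component (component a i \<otimes> b) (e + e') = (if i \<le> e + e' then component a i \<otimes> component b (e + e' - i) else \<zero>)"
      by (rule component_mult_homogeneous[OF component_spec(1)[OF a(1)] b(1)])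
    show "component (component a i \<otimes> b) (e + e') = (if e = i then component a i \<otimes> component b e' else \<zero>)"
    proof (cases i e rule: linorder_cases)
      case less thus ?thesis unfolding c using a b by simp
    next
      case equal thus ?thesis unfolding c by simp
    next
      case greater thus ?thesis unfolding c using a b by simp
    qed
  qed (use a b in auto)
  also have "\<dots> = component a e \<otimes> component b e'"
    using a b by (intro finsum_singleton) (auto simp: N_def)
  finally show ?thesis .
qed

lemma component_mult_zero:
  "a \<in> carrier R \<Longrightarrow> b \<in> carrier R \<Longrightarrow> component (a \<otimes> b) 0 = component a 0 \<otimes> component b 0"
  using component_mult_low[of a 0 b 0] by simp

definition homogeneous :: "'a set \<Rightarrow> bool" where
  "homogeneous Q \<longleftrightarrow> ideal Q R \<and> (\<forall>a\<in>Q. \<forall>i. component a i \<in> Q)"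

lemma homogeneousD: "homogeneous Q \<Longrightarrow> a \<in> Q \<Longrightarrow> component a i \<in> Q"
  by (simp add: homogeneous_def)

lemma homogeneous_ideal_of: "homogeneous Q \<Longrightarrow> ideal Q R" by (simp add: homogeneous_def)

lemma components_in_ideal:
  assumes "ideal Q R" "a \<in> carrier R" "\<And>i. component a i \<in> Q" shows "a \<in> Q"
proof -
  obtain n where "\<And>i. i \<ge> n \<Longrightarrow> component a i = \<zero>" using component_bound[OF assms(2)] by blast
  hence "a = (\<Oplus>i\<in>{..<n}. component a i)" using assms(2) by (intro component_sum)
  also have "\<dots> \<in> Q" using ideal_ops[OF assms(1)] assms(3) by (intro finsum_in_subset) auto
  finally show ?thesis .
qed

lemma homogeneous_zero: "homogeneous {\<zero>}"
  by (simp add: homogeneous_def zeroideal)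

lemma homogeneous_adjoin:
  assumes Q: "homogeneous Q" and x: "x \<in> G e" shows "homogeneous (adjoin Q x)"
  unfolding homogeneous_def
proof (intro conjI ballI allI)
  have Qi: "ideal Q R" using Q by (rule homogeneous_ideal_of)
  note Qo = ideal_ops[OF Qi]
  have xc: "x \<in> carrier R" using x by simp
  show "ideal (adjoin Q x) R" by (rule adjoin_ideal[OF Qi xc])
  fix a i assume "a \<in> adjoin Q x"
  then obtain q r where a: "q \<in> Q" "r \<in> carrier R" "a = q \<oplus> x \<otimes> r" by (rule adjoinE)
  have qc: "q \<in> carrier R" using a Qo(1) by blast
  have "component a i = component q i \<oplus> x \<otimes> (if e \<le> i then component r (i - e) else \<zero>)"
    using a(2,3) qc xc by (simp add: component_add component_mult_homogeneous[OF x])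
  also have "\<dots> \<in> adjoin Q x"
    using a(2) by (intro adjoinI homogeneousD[OF Q a(1)]) auto
  finally show "component a i \<in> adjoin Q x" .
qed

lemma homogeneous_adjoin_list:
  assumes "homogeneous Q" "set xs \<subseteq> (\<Union>e. G e)" shows "homogeneous (adjoin_list Q xs)"
  using assms
proof (induction xs arbitrary: Q)
  case (Cons x xs)
  then obtain e where "x \<in> G e" by auto
  thus ?case using Cons homogeneous_adjoin by simp
qed simp

lemma genideal_of_forms:
  assumes B: "B \<subseteq> G e" and a: "a \<in> Idl B"
  shows "component a i \<in> Idl B" "i < e \<Longrightarrow> component a i = \<zero>"
proof -
  have Bc: "B \<subseteq> carrier R" using B G_carrier by blast
  have IB: "ideal (Idl B) R" by (rule genideal_ideal[OF Bc])
  note o = ideal_ops[OF IB]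
  define T where "T = {a \<in> carrier R. \<forall>i. component a i \<in> Idl B \<and> (i < e \<longrightarrow> component a i = \<zero>)}"
  have add: "u \<oplus> v \<in> T" if "u \<in> T" "v \<in> T" for u v
    using that o(3) by (auto simp: T_def component_add)
  have zero: "\<zero> \<in> T" using o(2) by (simp add: T_def)
  have hom: "r \<otimes> u \<in> T" if u: "u \<in> T" and r: "r \<in> G j" for u r j
  proof -
    have uc: "u \<in> carrier R" and ui: "\<And>i. component u i \<in> Idl B" "\<And>i. i < e \<Longrightarrow> component u i = \<zero>"
      using u by (auto simp: T_def)
    have "component (r \<otimes> u) i \<in> Idl B" for i
      using ui(1) o(2) o(6) r by (simp add: component_mult_homogeneous[OF r uc])
    moreover have "component (r \<otimes> u) i = \<zero>" if "i < e" for i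
      using ui(2)[of "i - j"] that r by (simp add: component_mult_homogeneous[OF r uc])
    ultimately show ?thesis using uc r by (simp add: T_def)
  qed
  have "ideal T R"
  proof (rule idealI_simple)
    show "T \<subseteq> carrier R" by (auto simp: T_def)
    fix u r assume u: "u \<in> T" and r: "r \<in> carrier R"
    have uc: "u \<in> carrier R" using u by (simp add: T_def)
    obtain n where n: "\<And>i. i \<ge> n \<Longrightarrow> component r i = \<zero>" using component_bound[OF r] by blast
    have rs: "r = (\<Oplus>i\<in>{..<n}. component r i)" using component_sum[OF r n] .
    have "r \<otimes> u = (\<Oplus>i\<in>{..<n}. component r i \<otimes> u)"
      using rs finsum_ldistr[of "{..<n}" u "component r"] r uc by auto
    also have "\<dots> \<in> T"
      by (rule finsum_in_subset) (use zero add hom[OF u component_spec(1)[OF r]] in \<open>auto simp: T_def\<close>)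
    finally show "r \<otimes> u \<in> T" .
  qed (rule zero, rule add)
  moreover have "B \<subseteq> T"
  proof
    fix b assume b: "b \<in> B"
    hence "b \<in> G e" "b \<in> Idl B" using B genideal_self[OF Bc] by auto
    thus "b \<in> T" using o(2) by (simp add: T_def component_homogeneous)
  qed
  ultimately have "Idl B \<subseteq> T" by (rule genideal_minimal)
  thus "component a i \<in> Idl B" "i < e \<Longrightarrow> component a i = \<zero>" using a by (auto simp: T_def)
qed

lemma homogeneous_nonzerodivisor_modI:
  assumes Q: "homogeneous Q" and x: "x \<in> G e" and h: "\<And>m a. a \<in> G m \<Longrightarrow> x \<otimes> a \<in> Q \<Longrightarrow> a \<in> Q"
  shows "nonzerodivisor_mod Q x"
  unfolding nonzerodivisor_mod_def
proof (intro ballI impI)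
  fix a assume a: "a \<in> carrier R" "x \<otimes> a \<in> Q"
  have "component a i \<in> Q" for i
  proof -
    have "component (x \<otimes> a) (e + i) \<in> Q" by (rule homogeneousD[OF Q a(2)])
    hence "x \<otimes> component a i \<in> Q" by (simp add: component_mult_homogeneous[OF x a(1)])
    thus ?thesis by (rule h[OF component_spec(1)[OF a(1)]])
  qed
  thus "a \<in> Q" by (rule components_in_ideal[OF homogeneous_ideal_of[OF Q] a(1)])
qed

text \<open>
  The elements that differ from their constant term by a member of \<open>(S)\<close> form a subring, which contains \<open>k\<close> and \<open>S\<close>.
\<close>

lemma positive_part_subset_genideal:
  assumes S: "S \<subseteq> G 1" and gen: "generate_ring R (k \<union> S) = carrier R"
  shows "{a \<in> carrier R. component a 0 = \<zero>} \<subseteq> Idl S" (is "_ \<subseteq> ?L")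
proof -
  have Sc: "S \<subseteq> carrier R" using S G_carrier by blast
  have Li: "ideal ?L R" by (rule genideal_ideal[OF Sc])
  note Lo = ideal_ops[OF Li]
  have GL: "S \<subseteq> ?L" by (rule genideal_self[OF Sc])
  define E where "E = {a \<in> carrier R. a \<ominus> component a 0 \<in> ?L}"
  have "subring E R"
  proof (rule subringI)
    show "E \<subseteq> carrier R" by (auto simp: E_def)
    show "\<one> \<in> E" using Lo(2) by (simp add: E_def component_homogeneous[OF one_G] a_minus_def r_neg)
    fix a assume a: "a \<in> E"
    hence ac: "a \<in> carrier R" "component a 0 \<in> carrier R" "a \<ominus> component a 0 \<in> ?L" by (auto simp: E_def)
    have "\<ominus> a \<ominus> component (\<ominus> a) 0 = \<ominus> (a \<ominus> component a 0)"
      unfolding component_uminus[OF ac(1)] using ac(1,2) by algebra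
    thus "\<ominus> a \<in> E" using Lo(5)[OF ac(3)] ac(1) by (simp add: E_def)
    fix b assume b: "b \<in> E"
    hence bc: "b \<in> carrier R" "component b 0 \<in> carrier R" "b \<ominus> component b 0 \<in> ?L" by (auto simp: E_def)
    have "(a \<oplus> b) \<ominus> component (a \<oplus> b) 0 = (a \<ominus> component a 0) \<oplus> (b \<ominus> component b 0)"
      unfolding component_add[OF ac(1) bc(1)] using ac(1,2) bc(1,2) by algebra
    thus "a \<oplus> b \<in> E" using Lo(3)[OF ac(3) bc(3)] ac(1) bc(1) by (simp add: E_def)
    have "(a \<otimes> b) \<ominus> component (a \<otimes> b) 0 = b \<otimes> (a \<ominus> component a 0) \<oplus> component a 0 \<otimes> (b \<ominus> component b 0)"
      unfolding component_mult_zero[OF ac(1) bc(1)] using ac(1,2) bc(1,2) by algebra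
    thus "a \<otimes> b \<in> E"
      using Lo(3)[OF Lo(6)[OF ac(3) bc(1)] Lo(6)[OF bc(3) ac(2)]] ac(1) bc(1) by (simp add: E_def)
  qed
  moreover have "k \<union> S \<subseteq> E"
  proof
    fix a assume "a \<in> k \<union> S"
    thus "a \<in> E"
    proof
      assume "a \<in> k"
      hence a: "a \<in> G 0" by (simp add: degree_zero)
      thus ?thesis using Lo(2) by (simp add: E_def component_homogeneous[OF a] a_minus_def r_neg)
    next
      assume "a \<in> S"
      hence a: "a \<in> G 1" "a \<in> ?L" using S GL by auto
      thus ?thesis by (simp add: E_def component_homogeneous[OF a(1)] a_minus_def)
    qed
  qed
  ultimately have "carrier R \<subseteq> E"
    unfolding gen[symmetric] using k_carrier Sc by (intro generate_ring_min_subring1) blast+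
  thus ?thesis by (auto simp: E_def a_minus_def)
qed

lemma irrelevant_ideal_eq: "irrelevant_ideal R G = {a \<in> carrier R. component a 0 = \<zero>}" (is "?L = ?P")
proof
  have Pi: "ideal ?P R"
    by (rule idealI_simple) (auto simp: component_add component_mult_zero)
  show "?L \<subseteq> ?P"
    unfolding irrelevant_ideal_def
    by (rule genideal_minimal[OF Pi]) (auto simp: component_homogeneous)
  obtain S where S: "finite S" "S \<subseteq> G 1" "generate_ring R (k \<union> S) = carrier R" using generated by blast
  have "?P \<subseteq> Idl S" by (rule positive_part_subset_genideal[OF S(2,3)])
  also have "Idl S \<subseteq> ?L" unfolding irrelevant_ideal_def by (rule subset_Idl_subset[OF G_carrier S(2)])
  finally show "?P \<subseteq> ?L" .
qed

lemma irrelevant_ideal_ideal: "ideal (irrelevant_ideal R G) R"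
  unfolding irrelevant_ideal_def by (rule genideal_ideal[OF G_carrier])

lemma irrelevant_ideal_maximal: "maximalideal (irrelevant_ideal R G) R"
proof (rule maximalidealI[OF irrelevant_ideal_ideal])
  let ?L = "irrelevant_ideal R G"
  have o: "\<one> \<notin> ?L" unfolding irrelevant_ideal_eq using one_not_zero by (simp add: component_homogeneous[OF one_G])
  thus "carrier R \<noteq> ?L" by auto
  fix J assume J: "ideal J R" "?L \<subseteq> J" "J \<subseteq> carrier R"
  note Jo = ideal_ops[OF J(1)]
  show "J = ?L \<or> J = carrier R"
  proof (rule disjCI)
    assume "J \<noteq> carrier R"
    hence J1: "\<one> \<notin> J" using ideal.one_imp_carrier[OF J(1)] by blast
    have "a \<in> ?L" if a: "a \<in> J" for a
    proof (rule ccontr)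
      assume n: "a \<notin> ?L"
      have ac: "a \<in> carrier R" using a J(3) by blast
      let ?c = "component a 0"
      have c: "?c \<in> k" "?c \<noteq> \<zero>"
        using n ac component_spec(1)[OF ac, of 0] degree_zero by (auto simp: irrelevant_ideal_eq)
      hence inv: "inv ?c \<in> k" "inv ?c \<otimes> ?c = \<one>" using subfield_m_inv[OF subfield_k, of ?c] by auto
      have "a \<ominus> ?c \<in> ?L" unfolding irrelevant_ideal_eq using ac component_spec(1)[OF ac, of 0]
        by (simp add: component_minus component_homogeneous r_neg a_minus_def component_add component_uminus)
      hence "a \<ominus> (a \<ominus> ?c) \<in> J" using J(2) a Jo(4) by blast
      moreover have "a \<ominus> (a \<ominus> ?c) = ?c" using ac component_closed[OF ac, of 0] by algebra
      ultimately have "inv ?c \<otimes> ?c \<in> J" using Jo(6) inv(1) k_carrier by auto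
      thus False using inv J1 by simp
    qed
    thus "J = ?L" using J(2) by blast
  qed
qed

section \<open>Top-degree forms\<close>

definition below :: "nat \<Rightarrow> 'a set" where
  "below n = {a \<in> carrier R. \<forall>i\<ge>n. component a i = \<zero>}"

lemma below_carrier: "a \<in> below n \<Longrightarrow> a \<in> carrier R" by (simp add: below_def)
lemma below_0: "below 0 = {\<zero>}"
proof -
  have "a = \<zero>" if "a \<in> carrier R" "\<And>i. component a i = \<zero>" for a
    using component_sum[OF that(1), of 0] that(2) by simp
  thus ?thesis by (auto simp: below_def)
qed
lemma below_mono: "m \<le> n \<Longrightarrow> below m \<subseteq> below n" by (auto simp: below_def)
lemma below_add: "a \<in> below n \<Longrightarrow> b \<in> below n \<Longrightarrow> a \<oplus> b \<in> below n"
  by (simp add: below_def component_add)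
lemma below_minus: "a \<in> below n \<Longrightarrow> b \<in> below n \<Longrightarrow> a \<ominus> b \<in> below n"
  by (simp add: below_def component_minus)
lemma below_homogeneous: "a \<in> G i \<Longrightarrow> i < n \<Longrightarrow> a \<in> below n"
  by (simp add: below_def component_homogeneous)
lemma below_exhausts: assumes "a \<in> carrier R" shows "\<exists>n. a \<in> below n"
proof -
  obtain n where "\<And>i. i \<ge> n \<Longrightarrow> component a i = \<zero>" using component_bound[OF assms] by blast
  hence "a \<in> below n" using assms by (simp add: below_def)
  thus ?thesis ..
qed
lemma below_split:
  assumes "a \<in> below (Suc n)" shows "a \<ominus> component a n \<in> below n"
proof -
  have a: "a \<in> carrier R" using assms by (simp add: below_def)
  have "component (a \<ominus> component a n) i = \<zero>" if i: "i \<ge> n" for i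
  proof (cases "i = n")
    case True
    thus ?thesis using a by (simp add: component_minus component_homogeneous[OF component_spec(1)[OF a]])
  next
    case False
    hence "component a i = \<zero>" using assms i by (simp add: below_def)
    thus ?thesis using a False
      by (simp add: component_minus component_homogeneous[OF component_spec(1)[OF a]])
  qed
  thus ?thesis using a by (simp add: below_def)
qed
lemma below_homogeneous_mult: "x \<in> G e \<Longrightarrow> a \<in> below n \<Longrightarrow> x \<otimes> a \<in> below (e + n)"
  by (auto simp: below_def component_mult_homogeneous)

lemma below_mult:
  assumes "a \<in> below m" "b \<in> below n" shows "a \<otimes> b \<in> below (m + n - 1)"
proof -
  have ac: "a \<in> carrier R" and bc: "b \<in> carrier R" using assms by (auto simp: below_carrier)
  have A: "a = (\<Oplus>i\<in>{..<m}. component a i)" using component_sum[OF ac] assms by (simp add: below_def)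
  have "a \<otimes> b = (\<Oplus>i\<in>{..<m}. component a i \<otimes> b)"
    using A finsum_ldistr[of "{..<m}" b "component a"] ac bc by auto
  also have "\<dots> \<in> below (m + n - 1)"
  proof (rule finsum_in_subset)
    fix i assume i: "i \<in> {..<m}"
    have "component a i \<otimes> b \<in> below (i + n)"
      by (rule below_homogeneous_mult[OF component_spec(1)[OF ac] assms(2)])
    moreover have "i + n \<le> m + n - 1" using i by auto
    ultimately show "component a i \<otimes> b \<in> below (m + n - 1)" using below_mono by blast
  next
    show "below (m + n - 1) \<subseteq> carrier R" by (auto simp: below_def)
    show "\<zero> \<in> below (m + n - 1)" by (simp add: below_def)
  qed (auto intro: below_add)
  finally show ?thesis .
qed

text \<open>
  \<open>Q'\<close> is the ideal of top-degree forms of \<open>Q\<close>: the top form of an element of \<open>Q\<close> is in \<open>Q'\<close>, and conversely every form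
  in \<open>Q'\<close> is a form of \<open>Q\<close> up to terms of smaller degree.
\<close>

definition initial_ideal :: "'a set \<Rightarrow> 'a set \<Rightarrow> bool" where
  "initial_ideal Q Q' \<longleftrightarrow> (\<forall>n. \<forall>q \<in> Q \<inter> below (Suc n). component q n \<in> Q') \<and>
     (\<forall>n. \<forall>h \<in> Q' \<inter> G n. \<exists>q\<in>Q. q \<ominus> h \<in> below n)"

text \<open>
  Let \<open>h\<close> be the top form of \<open>y\<close>. If the top terms of \<open>q\<close> and \<open>y r\<close> cancel, then \<open>h\<close> times the top form of \<open>r\<close> is in
  \<open>Q'\<close>, so the top form of \<open>r\<close> is in \<open>Q'\<close> and \<open>r\<close> can be replaced by some \<open>r - q\<^sub>0\<close> of smaller degree with \<open>q\<^sub>0 \<in> Q\<close>.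
  Repeating this, no cancellation remains, and the top form of \<open>q + y r\<close> is seen to be in \<open>Q' + (h)\<close>. The same descent on the
  degree of \<open>a\<close> shows that \<open>y a \<in> Q\<close> implies \<open>a \<in> Q\<close>.
\<close>

lemma initial_ideal_step:
  assumes Q: "ideal Q R" and Q': "homogeneous Q'" and ini: "initial_ideal Q Q'"
    and h: "h \<in> G N" and y: "y \<in> carrier R" "y \<ominus> h \<in> below N" and nzd: "nonzerodivisor_mod Q' h"
  shows "nonzerodivisor_mod Q y" "initial_ideal (adjoin Q y) (adjoin Q' h)"
proof -
  note Qo = ideal_ops[OF Q] and Qo' = ideal_ops[OF homogeneous_ideal_of[OF Q']]
  note Q'i = homogeneous_ideal_of[OF Q']
  have hc: "h \<in> carrier R" using h by simp
  have top: "\<And>q n. q \<in> Q \<Longrightarrow> q \<in> below (Suc n) \<Longrightarrow> component q n \<in> Q'"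
    and lift: "\<And>g n. g \<in> Q' \<Longrightarrow> g \<in> G n \<Longrightarrow> \<exists>q\<in>Q. q \<ominus> g \<in> below n"
    using ini by (auto simp: initial_ideal_def)
  have nz: "\<And>a. a \<in> carrier R \<Longrightarrow> h \<otimes> a \<in> Q' \<Longrightarrow> a \<in> Q'"
    using nzd by (simp add: nonzerodivisor_mod_def)
  have ydec: "y = h \<oplus> (y \<ominus> h)" using y(1) hc by algebra
  have ybelow: "y \<in> below (Suc N)"
    by (subst ydec) (intro below_add below_homogeneous[OF h] subsetD[OF below_mono y(2)], auto)
  have ytop: "component (y \<otimes> r) (N + n) = h \<otimes> component r n" "y \<otimes> r \<in> below (Suc (N + n))"
    if r: "r \<in> below (Suc n)" for r n
  proof -
    have rc: "r \<in> carrier R" using r by (rule below_carrier)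
    have "(y \<ominus> h) \<otimes> r \<in> below (N + Suc n - 1)" by (rule below_mult[OF y(2) r])
    hence b: "component ((y \<ominus> h) \<otimes> r) (N + n) = \<zero>" by (simp add: below_def)
    have "y \<otimes> r = h \<otimes> r \<oplus> (y \<ominus> h) \<otimes> r" using y(1) hc rc by algebra
    hence "component (y \<otimes> r) (N + n) = component (h \<otimes> r) (N + n) \<oplus> component ((y \<ominus> h) \<otimes> r) (N + n)"
      using hc rc y(1) by (simp add: component_add)
    thus "component (y \<otimes> r) (N + n) = h \<otimes> component r n"
      unfolding b using hc rc by (simp add: component_mult_homogeneous[OF h])
    show "y \<otimes> r \<in> below (Suc (N + n))" using below_mult[OF ybelow r] by simp
  qed
  have reduce: "\<exists>q\<in>Q. r \<ominus> q \<in> below n"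
    if r: "r \<in> below (Suc n)" and hr: "h \<otimes> component r n \<in> Q'" for r n
  proof -
    have rc: "r \<in> carrier R" using r by (rule below_carrier)
    let ?c = "component r n"
    have c: "?c \<in> G n" "?c \<in> carrier R" using component_spec(1)[OF rc] by auto
    obtain q where q: "q \<in> Q" "q \<ominus> ?c \<in> below n" using lift[OF nz[OF c(2) hr] c(1)] by blast
    have "r \<ominus> q = (r \<ominus> ?c) \<ominus> (q \<ominus> ?c)" using rc c(2) q(1) Qo(8) by algebra
    also have "\<dots> \<in> below n" by (rule below_minus[OF below_split[OF r] q(2)])
    finally show ?thesis using q(1) by blast
  qed
  show "nonzerodivisor_mod Q y"
    unfolding nonzerodivisor_mod_def
  proof (intro ballI impI)
    fix a assume a: "a \<in> carrier R" "y \<otimes> a \<in> Q"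
    obtain n where "a \<in> below n" using below_exhausts[OF a(1)] by blast
    thus "a \<in> Q" using a(2)
    proof (induction n arbitrary: a)
      case 0 thus ?case using Qo(2) by (simp add: below_0)
    next
      case (Suc n)
      have ac: "a \<in> carrier R" using Suc.prems(1) by (rule below_carrier)
      have "h \<otimes> component a n \<in> Q'"
        using top[OF Suc.prems(2) ytop(2)[OF Suc.prems(1)]] ytop(1)[OF Suc.prems(1)] by simp
      from reduce[OF Suc.prems(1) this] obtain q where q: "q \<in> Q" "a \<ominus> q \<in> below n" by blast
      have qc: "q \<in> carrier R" using q Qo(8) by simp
      have "y \<otimes> (a \<ominus> q) = y \<otimes> a \<ominus> y \<otimes> q" using y(1) ac qc by algebra
      also have "\<dots> \<in> Q" by (intro Qo(4) Suc.prems(2) Qo(6) q(1) y(1))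
      finally have "a \<ominus> q \<in> Q" by (rule Suc.IH[OF q(2)])
      hence "(a \<ominus> q) \<oplus> q \<in> Q" using q(1) by (rule Qo(3))
      moreover have "(a \<ominus> q) \<oplus> q = a" using ac qc by algebra
      ultimately show ?case by simp
    qed
  qed
  \<comment> \<open>Induction on the degree of \<open>r\<close>, comparing the degree \<open>N + n\<close> of the top term of \<open>y r\<close> with the degree \<open>m\<close> in
    which the sum is known to end.\<close>
  have topA: "component (q \<oplus> y \<otimes> r) m \<in> adjoin Q' h"
    if "q \<in> Q" "r \<in> below n" "q \<oplus> y \<otimes> r \<in> below (Suc m)" for q r n m
    using that
  proof (induction n arbitrary: q r)
    case 0
    hence "q \<oplus> y \<otimes> r = q" using y(1) Qo(8) by (simp add: below_0)
    thus ?case using top[OF 0(1)] 0(3) adjoin_superset(1)[OF Q'i hc] by auto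
  next
    case (Suc n)
    note r = Suc.prems(2)
    have rc: "r \<in> carrier R" using r by (rule below_carrier)
    have qc: "q \<in> carrier R" using Suc.prems Qo(8) by simp
    have qe: "q = (q \<oplus> y \<otimes> r) \<ominus> y \<otimes> r" using qc rc y(1) by algebra
    show ?case
    proof (cases "N + n \<le> m")
      case True
      have yr: "y \<otimes> r \<in> below (Suc m)"
        using ytop(2)[OF r] below_mono[of "Suc (N + n)" "Suc m"] True by auto
      have "q \<in> below (Suc m)" by (subst qe) (rule below_minus[OF Suc.prems(3) yr])
      hence qm: "component q m \<in> Q'" by (rule top[OF Suc.prems(1)])
      have "component (y \<otimes> r) m = h \<otimes> (if N + n = m then component r n else \<zero>)"
        using True ytop[OF r] hc by (auto simp: below_def)
      hence "component (q \<oplus> y \<otimes> r) m = component q m \<oplus> h \<otimes> (if N + n = m then component r n else \<zero>)"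
        using qc rc y(1) by (simp add: component_add)
      also have "\<dots> \<in> adjoin Q' h" using rc by (intro adjoinI qm) auto
      finally show ?thesis .
    next
      case False
      have p: "q \<oplus> y \<otimes> r \<in> below (N + n)" using Suc.prems(3) below_mono[of "Suc m" "N + n"] False by auto
      have p': "q \<oplus> y \<otimes> r \<in> below (Suc (N + n))" using p below_mono[of "N + n" "Suc (N + n)"] by auto
      have "q \<in> below (Suc (N + n))" by (subst qe) (rule below_minus[OF p' ytop(2)[OF r]])
      hence "component q (N + n) \<in> Q'" by (rule top[OF Suc.prems(1)])
      moreover have "component q (N + n) = \<ominus> (h \<otimes> component r n)"
      proof -
        have "component (q \<oplus> y \<otimes> r) (N + n) = \<zero>" using p by (simp add: below_def)
        hence "component q (N + n) \<oplus> h \<otimes> component r n = \<zero>"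
          using qc rc y(1) ytop(1)[OF r] by (simp add: component_add)
        thus ?thesis using qc rc hc by (intro minus_equality[symmetric]) auto
      qed
      ultimately have "\<ominus> (\<ominus> (h \<otimes> component r n)) \<in> Q'" using Qo'(5) by metis
      hence "h \<otimes> component r n \<in> Q'" using hc rc by simp
      from reduce[OF r this] obtain q0 where q0: "q0 \<in> Q" "r \<ominus> q0 \<in> below n" by blast
      have q0c: "q0 \<in> carrier R" using q0 Qo(8) by simp
      have e: "q \<oplus> y \<otimes> r = (q \<oplus> y \<otimes> q0) \<oplus> y \<otimes> (r \<ominus> q0)" using qc rc q0c y(1) by algebra
      show ?thesis unfolding e
        by (rule Suc.IH) (use Suc.prems(3) q0 in \<open>auto simp: e[symmetric] intro!: Qo(3,6) Suc.prems(1) y(1)\<close>)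
    qed
  qed
  show "initial_ideal (adjoin Q y) (adjoin Q' h)"
    unfolding initial_ideal_def
  proof (intro conjI allI ballI)
    fix n p assume p: "p \<in> adjoin Q y \<inter> below (Suc n)"
    then obtain q r where q: "q \<in> Q" "r \<in> carrier R" "p = q \<oplus> y \<otimes> r" by (blast elim: adjoinE)
    obtain j where "r \<in> below j" using below_exhausts[OF q(2)] by blast
    thus "component p n \<in> adjoin Q' h" using topA[OF q(1)] p q(3) by blast
  next
    fix m g assume g: "g \<in> adjoin Q' h \<inter> G m"
    then obtain q' r where q': "q' \<in> Q'" "r \<in> carrier R" "g = q' \<oplus> h \<otimes> r" by (blast elim: adjoinE)
    have q'c: "q' \<in> carrier R" using q' Qo'(8) by simp
    define s where "s = (if N \<le> m then component r (m - N) else \<zero>)"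
    have s: "s \<in> carrier R" using q'(2) by (simp add: s_def)
    have "g = component g m" using g component_homogeneous[of g m m] by simp
    also have "\<dots> = component q' m \<oplus> h \<otimes> s"
      unfolding q'(3) s_def using q'(2) q'c hc by (simp add: component_add component_mult_homogeneous[OF h])
    finally have ge: "g = component q' m \<oplus> h \<otimes> s" .
    obtain q where q: "q \<in> Q" "q \<ominus> component q' m \<in> below m"
      using lift[OF homogeneousD[OF Q' q'(1)] component_spec(1)[OF q'c]] by blast
    have qc: "q \<in> carrier R" using q Qo(8) by simp
    have "(y \<ominus> h) \<otimes> s \<in> below m"
    proof (cases "N \<le> m")
      case True
      hence "s \<in> G (m - N)" using component_spec(1)[OF q'(2)] by (simp add: s_def)
      from below_homogeneous_mult[OF this y(2)] show ?thesis using True s y(1) hc by (simp add: m_comm)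
    next
      case False
      thus ?thesis using y(1) hc by (simp add: s_def below_def)
    qed
    hence "(q \<ominus> component q' m) \<oplus> (y \<ominus> h) \<otimes> s \<in> below m" by (rule below_add[OF q(2)])
    moreover have "(q \<ominus> component q' m) \<oplus> (y \<ominus> h) \<otimes> s = (q \<oplus> y \<otimes> s) \<ominus> g"
      unfolding ge using qc component_closed[OF q'c, of m] y(1) hc s by algebra
    ultimately show "\<exists>p\<in>adjoin Q y. p \<ominus> g \<in> below m" using adjoinI[OF q(1) s, of y] by auto
  qed
qed

lemma regular_mod_of_top_forms:
  assumes "ideal Q R" "homogeneous Q'" "initial_ideal Q Q'" "regular_mod Q' hs"
    and "list_all2 (\<lambda>h y. y \<in> carrier R \<and> (\<exists>N. h \<in> G N \<and> y \<ominus> h \<in> below N)) hs ys"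
  shows "regular_mod Q ys"
  using assms(5,1-4)
proof (induction hs ys arbitrary: Q Q' rule: list_all2_induct)
  case (Cons h hs y ys)
  then obtain N where h: "h \<in> G N" "y \<ominus> h \<in> below N" and y: "y \<in> carrier R" by blast
  have nzd: "nonzerodivisor_mod Q' h" and reg: "regular_mod (adjoin Q' h) hs" using Cons.prems by auto
  note st = initial_ideal_step[OF Cons.prems(1-3) h(1) y h(2) nzd]
  show ?case using st(1) Cons.IH[OF adjoin_ideal[OF Cons.prems(1) y] homogeneous_adjoin[OF Cons.prems(2) h(1)] st(2) reg]
    by simp
qed simp

lemma initial_ideal_zero: "initial_ideal {\<zero>} {\<zero>}"
  by (auto simp: initial_ideal_def a_minus_def below_def)

lemma poly_below_below:
  assumes x: "x \<in> G 1" shows "poly_below R k x n \<subseteq> below n"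
proof (induction n)
  case 0 show ?case by (simp add: below_0)
next
  case (Suc n)
  have p: "x [^] m \<in> G m" for m
  proof (induction m)
    case (Suc m) thus ?case using piece_mult[OF Suc x] by simp
  qed (simp add: one_G)
  have "v \<oplus> s \<otimes> x [^] n \<in> below (Suc n)" if "v \<in> poly_below R k x n" "s \<in> k" for v s
  proof -
    have "s \<otimes> x [^] n \<in> G (0 + n)" using that(2) by (intro piece_mult p) (simp add: degree_zero)
    hence "s \<otimes> x [^] n \<in> below (Suc n)" by (intro below_homogeneous[of _ n]) auto
    moreover have "v \<in> below (Suc n)" using that(1) Suc below_mono[of n "Suc n"] by auto
    ultimately show ?thesis by (intro below_add)
  qed
  thus ?case by auto
qed

lemma pow_G: "x \<in> G 1 \<Longrightarrow> x [^] n \<in> G n"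
proof (induction n)
  case (Suc n) thus ?case using piece_mult[of "x [^] n" n x 1] by simp
qed (simp add: one_G)

text \<open>
  By the Nullstellensatz \<open>M\<close> contains a monic polynomial in each member \<open>x\<close> of \<open>xs\<close>. Its top form is a power of \<open>x\<close>,
  and powers of the members of a regular sequence are a regular sequence.
\<close>

lemma length_le_depth_maximalideal:
  assumes inf: "infinite k" and xs: "set xs \<subseteq> G 1" and reg: "regular_mod {\<zero>} xs"
    and M: "maximalideal M R"
  shows "enat (length xs) \<le> depth R M"
proof -
  have Mi: "ideal M R" using M by (rule maximalideal.axioms(1))
  note Mo = ideal_ops[OF Mi]
  have M1: "\<one> \<notin> M" using M ideal.one_imp_carrier[OF Mi] maximalideal.I_notcarr by blast
  obtain S where S: "finite S" "S \<subseteq> G 1" "generate_ring R (k \<union> S) = carrier R" using generated by blast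
  have "\<exists>N v. N \<noteq> 0 \<and> v \<in> below N \<and> x [^] (N::nat) \<oplus> v \<in> M" if x: "x \<in> G 1" for x
  proof -
    obtain N v where Nv: "v \<in> poly_below R k x N" "x [^] N \<oplus> v \<in> M"
      using nullstellensatz[OF subfield_k inf S(1) _ S(3) M, of x] S(2) G_carrier x by blast
    moreover have "N \<noteq> 0" using Nv M1 by (cases N) auto
    ultimately show ?thesis using poly_below_below[OF x] by blast
  qed
  then obtain N v where N: "\<And>x. x \<in> G 1 \<Longrightarrow> N x \<noteq> 0" and v: "\<And>x. x \<in> G 1 \<Longrightarrow> v x \<in> below (N x)"
    and vM: "\<And>x. x \<in> G 1 \<Longrightarrow> x [^] (N x :: nat) \<oplus> v x \<in> M" by metis
  define hs where "hs = map2 (\<lambda>x n. x [^] n) xs (map N xs)"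
  define ys where "ys = map (\<lambda>x. x [^] N x \<oplus> v x) xs"
  have hs: "hs = map (\<lambda>x. x [^] N x) xs" unfolding hs_def by (induction xs) auto
  have "regular_mod {\<zero>} hs"
    unfolding hs_def using xs G_carrier N reg by (intro regular_mod_pow zeroideal) auto
  moreover have "list_all2 (\<lambda>h y. y \<in> carrier R \<and> (\<exists>N. h \<in> G N \<and> y \<ominus> h \<in> below N)) hs ys"
    unfolding hs ys_def list_all2_map1 list_all2_map2
  proof (rule list_all2I)
    show "\<forall>z\<in>set (zip xs xs). case z of (x, x') \<Rightarrow> x' [^] N x' \<oplus> v x' \<in> carrier R \<and>
      (\<exists>m. x [^] N x \<in> G m \<and> x' [^] N x' \<oplus> v x' \<ominus> x [^] N x \<in> below m)"
    proof
      fix z assume "z \<in> set (zip xs xs)"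
      then obtain x where z: "z = (x, x)" "x \<in> set xs" unfolding zip_same_conv_map by auto
      have xG: "x \<in> G 1" using z(2) xs by blast
      have c: "x [^] N x \<in> carrier R" "v x \<in> carrier R" using xG v[OF xG] by (auto simp: below_carrier)
      have e: "x [^] N x \<oplus> v x \<ominus> x [^] N x = v x" using c by algebra
      have "x [^] N x \<oplus> v x \<in> carrier R \<and> (\<exists>m. x [^] N x \<in> G m \<and> x [^] N x \<oplus> v x \<ominus> x [^] N x \<in> below m)"
        unfolding e using pow_G[OF xG, of "N x"] v[OF xG] c by blast
      thus "case z of (x, x') \<Rightarrow> x' [^] N x' \<oplus> v x' \<in> carrier R \<and>
      (\<exists>m. x [^] N x \<in> G m \<and> x' [^] N x' \<oplus> v x' \<ominus> x [^] N x \<in> below m)"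
        unfolding z(1) by simp
    qed
  qed simp
  ultimately have reg': "regular_mod {\<zero>} ys"
    by (rule regular_mod_of_top_forms[OF zeroideal homogeneous_zero initial_ideal_zero])
  have ysM: "set ys \<subseteq> M" unfolding ys_def using vM xs by auto
  have "regular_sequence R ys"
    unfolding regular_sequence_iff
  proof (intro conjI reg')
    show "set ys \<subseteq> carrier R" using ysM Mo(1) by blast
    have "adjoin_list {\<zero>} ys \<subseteq> M" using Mo(2) ysM by (intro adjoin_list_least[OF Mi]) auto
    thus "adjoin_list {\<zero>} ys \<noteq> carrier R" using M1 by auto
  qed
  hence "enat (length ys) \<le> depth R M" unfolding depth_def using ysM by (intro Sup_upper) blast
  thus ?thesis by (simp add: ys_def)
qed

end

section \<open>Linear combinations and independence modulo an ideal\<close>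

text \<open>
  The coefficients are restricted to a set \<open>B\<close>, which is later a graded piece, a power of an ideal, or the intersection of the
  two.
\<close>

fun (in ring) lincombs :: "'a list \<Rightarrow> 'a set \<Rightarrow> 'a set" where
  "lincombs [] B = {\<zero>}"
| "lincombs (x # xs) B = {x \<otimes> b \<oplus> c | b c. b \<in> B \<and> c \<in> lincombs xs B}"

context cring
begin

lemma lincombs_carrier:
  assumes "set xs \<subseteq> carrier R" "B \<subseteq> carrier R" shows "lincombs xs B \<subseteq> carrier R"
  using assms by (induction xs) auto

lemma lincombs_mono: "B \<subseteq> B' \<Longrightarrow> lincombs xs B \<subseteq> lincombs xs B'"
  by (induction xs) auto

lemma adjoin_list_eq_lincombs:
  assumes "ideal Q R" "set xs \<subseteq> carrier R"
  shows "adjoin_list Q xs = {q \<oplus> c | q c. q \<in> Q \<and> c \<in> lincombs xs (carrier R)}"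
  using assms
proof (induction xs arbitrary: Q)
  case Nil
  show ?case using ideal_ops(8)[OF Nil(1)] by force
next
  case (Cons x xs)
  have x: "x \<in> carrier R" and xs: "set xs \<subseteq> carrier R" using Cons.prems by auto
  have L: "lincombs xs (carrier R) \<subseteq> carrier R" by (rule lincombs_carrier[OF xs]) simp
  have IH: "adjoin_list (adjoin Q x) xs = {q \<oplus> c | q c. q \<in> adjoin Q x \<and> c \<in> lincombs xs (carrier R)}"
    by (rule Cons.IH[OF adjoin_ideal[OF Cons.prems(1) x] xs])
  have e: "(q \<oplus> x \<otimes> r) \<oplus> c = q \<oplus> (x \<otimes> r \<oplus> c)"
    if "q \<in> Q" "r \<in> carrier R" "c \<in> lincombs xs (carrier R)" for q r c
    using that ideal_ops(8)[OF Cons.prems(1)] L x by (intro a_assoc) auto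
  show ?case
  proof
    show "adjoin_list Q (x # xs) \<subseteq> {q \<oplus> c | q c. q \<in> Q \<and> c \<in> lincombs (x # xs) (carrier R)}"
    proof
      fix a assume "a \<in> adjoin_list Q (x # xs)"
      hence "a \<in> adjoin_list (adjoin Q x) xs" by simp
      then obtain p c where p: "p \<in> adjoin Q x" "c \<in> lincombs xs (carrier R)" "a = p \<oplus> c"
        unfolding IH by blast
      from p(1) obtain q r where q: "q \<in> Q" "r \<in> carrier R" "p = q \<oplus> x \<otimes> r" by (rule adjoinE)
      have "a = q \<oplus> (x \<otimes> r \<oplus> c)" using e[OF q(1,2) p(2)] p(3) q(3) by simp
      moreover have "x \<otimes> r \<oplus> c \<in> lincombs (x # xs) (carrier R)" using q p by auto
      ultimately show "a \<in> {q \<oplus> c | q c. q \<in> Q \<and> c \<in> lincombs (x # xs) (carrier R)}" using q(1) by blast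
    qed
    show "{q \<oplus> c | q c. q \<in> Q \<and> c \<in> lincombs (x # xs) (carrier R)} \<subseteq> adjoin_list Q (x # xs)"
    proof
      fix a assume "a \<in> {q \<oplus> c | q c. q \<in> Q \<and> c \<in> lincombs (x # xs) (carrier R)}"
      then obtain q r c where q: "q \<in> Q" "r \<in> carrier R" "c \<in> lincombs xs (carrier R)" "a = q \<oplus> (x \<otimes> r \<oplus> c)"
        by auto
      hence "a = (q \<oplus> x \<otimes> r) \<oplus> c" using e[OF q(1-3)] by simp
      moreover have "q \<oplus> x \<otimes> r \<in> adjoin Q x" using q by (intro adjoinI)
      ultimately have "a \<in> adjoin_list (adjoin Q x) xs" unfolding IH using q(3) by blast
      thus "a \<in> adjoin_list Q (x # xs)" by simp
    qed
  qed
qed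

lemma genideal_eq_lincombs:
  assumes "set xs \<subseteq> carrier R" shows "Idl (set xs) = lincombs xs (carrier R)"
proof -
  have "{q \<oplus> c | q c. q \<in> {\<zero>} \<and> c \<in> lincombs xs (carrier R)} = lincombs xs (carrier R)"
    using lincombs_carrier[OF assms, of "carrier R"] by force
  thus ?thesis
    using adjoin_list_zero[OF assms] adjoin_list_eq_lincombs[OF zeroideal assms] by simp
qed

lemma Span_mult:
  assumes K: "subfield K R" and x: "x \<in> carrier R" and Us: "set Us \<subseteq> carrier R"
  shows "b \<in> Span K Us \<Longrightarrow> x \<otimes> b \<in> Span K (map ((\<otimes>) x) Us)"
  using Us
proof (induction Us arbitrary: b)
  case Nil thus ?case using x by simp
next
  case (Cons u Us)
  have Kc: "K \<subseteq> carrier R" using subringE(1)[OF subfieldE(1)[OF K]] .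
  have "b \<in> line_extension K u (Span K Us)" using Cons.prems(1) by simp
  then obtain c v where b: "c \<in> K" "v \<in> Span K Us" "b = c \<otimes> u \<oplus> v" by (auto simp: line_extension_mem_iff)
  have cc: "c \<in> carrier R" "u \<in> carrier R" "v \<in> carrier R"
    using b Kc Cons.prems(2) Span_in_carrier[OF Kc, of Us] by auto
  have "x \<otimes> b = c \<otimes> (x \<otimes> u) \<oplus> x \<otimes> v" unfolding b(3) using cc x by algebra
  moreover have "x \<otimes> v \<in> Span K (map ((\<otimes>) x) Us)" using Cons b by simp
  ultimately show ?case using b(1) by (auto simp: line_extension_mem_iff)
qed

lemma independent_length_le_spanning:
  assumes K: "subfield K R" and "independent K Us" "set Vs \<subseteq> carrier R" "set Us \<subseteq> Span K Vs"
  shows "length Us \<le> length Vs"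
proof -
  have "\<exists>Ws. independent K Ws \<and> Span K Ws = Span K Vs \<and> length Ws \<le> length Vs"
    using assms(3)
  proof (induction Vs)
    case Nil show ?case by (intro exI[of _ "[]"]) auto
  next
    case (Cons v Vs)
    then obtain Ws where Ws: "independent K Ws" "Span K Ws = Span K Vs" "length Ws \<le> length Vs" by auto
    show ?case
    proof (cases "v \<in> Span K Vs")
      case True
      have "set (v # Vs) \<subseteq> Span K Vs" using True Span_base_incl[OF K, of Vs] Cons.prems by auto
      hence "Span K (v # Vs) \<subseteq> Span K Vs" using Cons.prems by (intro mono_Span_subset[OF K]) auto
      moreover have "Span K Vs \<subseteq> Span K (v # Vs)" using Cons.prems by (intro mono_Span[OF K]) auto
      ultimately have "Span K Ws = Span K (v # Vs)" using Ws(2) by blast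
      thus ?thesis using Ws(1,3) by (intro exI[of _ Ws]) simp
    next
      case False
      hence "independent K (v # Ws)" using Ws Cons.prems by (intro li_Cons) auto
      moreover have "Span K (v # Ws) = Span K (v # Vs)" using Ws(2) by simp
      ultimately show ?thesis using Ws(3) by (intro exI[of _ "v # Ws"]) simp
    qed
  qed
  then obtain Ws where Ws: "independent K Ws" "Span K Ws = Span K Vs" "length Ws \<le> length Vs" by blast
  have "length Us \<le> length Ws" using independent_length_le[OF K assms(2) Ws(1)] assms(4) Ws(2) by simp
  thus ?thesis using Ws(3) by simp
qed

definition independent_mod :: "'a set \<Rightarrow> 'a set \<Rightarrow> 'a list \<Rightarrow> bool" where
  "independent_mod K P Us \<longleftrightarrow> set Us \<subseteq> carrier R \<and>
     (\<forall>cs. length cs = length Us \<longrightarrow> set cs \<subseteq> K \<longrightarrow> combine cs Us \<in> P \<longrightarrow> set cs \<subseteq> {\<zero>})"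

lemma independent_mod_imp_independent:
  assumes K: "subfield K R" and P: "ideal P R" and ind: "independent_mod K P Us"
  shows "independent K Us"
proof (rule trivial_combine_imp_independent[OF K])
  show Us: "set Us \<subseteq> carrier R" using ind by (simp add: independent_mod_def)
  fix Ks assume Ks: "set Ks \<subseteq> K" "combine Ks Us = \<zero>"
  have sub: "subring K R" using K by (rule subfieldE(1))
  have Kc: "set Ks \<subseteq> carrier R" using Ks(1) subringE(1)[OF sub] by auto
  obtain cs where cs: "set (take (length Us) Ks) \<subseteq> set cs" "set cs \<subseteq> set (take (length Us) Ks) \<union> {\<zero>}"
    "length cs = length Us" "combine cs Us = \<zero>"
    using combine_normalize[OF Kc Us Ks(2)] by blast
  have "set cs \<subseteq> K" using cs(2) Ks(1) set_take_subset[of "length Us" Ks] subringE(2)[OF sub] by blast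
  moreover have "combine cs Us \<in> P" using cs(4) ideal_ops(2)[OF P] by simp
  ultimately have "set cs \<subseteq> {\<zero>}" using ind cs(3) unfolding independent_mod_def by blast
  thus "set (take (length Us) Ks) \<subseteq> {\<zero>}" using cs(1) by blast
qed

lemma independent_mod_one:
  assumes K: "subfield K R" and P: "ideal P R" "P \<noteq> carrier R"
  shows "independent_mod K P [\<one>]"
  unfolding independent_mod_def
proof (intro conjI allI impI)
  fix cs assume cs: "length cs = length [\<one>]" "set cs \<subseteq> K" "combine cs [\<one>] \<in> P"
  then obtain c where c: "cs = [c]" by (cases cs) auto
  have cK: "c \<in> K" "c \<in> carrier R" using cs(2) c subringE(1)[OF subfieldE(1)[OF K]] by auto
  hence cP: "c \<in> P" using cs(3) c by simp
  have "c = \<zero>"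
  proof (rule ccontr)
    assume "c \<noteq> \<zero>"
    hence inv: "inv c \<in> K" "inv c \<otimes> c = \<one>" using subfield_m_inv[OF K, of c] cK by auto
    hence "\<one> \<in> P" using ideal_ops(6)[OF P(1) cP, of "inv c"] subringE(1)[OF subfieldE(1)[OF K]] by auto
    thus False using P ideal.one_imp_carrier by blast
  qed
  thus "set cs \<subseteq> {\<zero>}" using c by simp
qed simp

text \<open>
  Multiplication by \<open>z \<in> P' - P\<close> is injective on \<open>R/P\<close> with image inside \<open>P'/P\<close>, so a family independent in \<open>R/P\<close>,
  multiplied by \<open>z\<close>, extends a family that is independent even modulo \<open>P'\<close>.
\<close>

lemma independent_mod_append:
  assumes K: "subfield K R" and P: "primeideal P R" and P': "ideal P' R" and sub: "P \<subseteq> P'"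
    and z: "z \<in> P'" "z \<notin> P" and U: "independent_mod K P' Us" and V: "independent_mod K P Vs"
  shows "independent_mod K P (Us @ map ((\<otimes>) z) Vs)"
  unfolding independent_mod_def
proof (intro conjI allI impI)
  note Po' = ideal_ops[OF P'] and Po = ideal_ops[OF primeideal.axioms(1)[OF P]]
  have Kc: "K \<subseteq> carrier R" by (rule subringE(1)[OF subfieldE(1)[OF K]])
  have zc: "z \<in> carrier R" using z Po'(8) by simp
  have Uc: "set Us \<subseteq> carrier R" and Vc: "set Vs \<subseteq> carrier R" using U V by (auto simp: independent_mod_def)
  have zV: "set (map ((\<otimes>) z) Vs) \<subseteq> carrier R" using zc Vc by auto
  show "set (Us @ map ((\<otimes>) z) Vs) \<subseteq> carrier R" using Uc zV by simp
  fix cs assume cs: "length cs = length (Us @ map ((\<otimes>) z) Vs)" "set cs \<subseteq> K"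
    "combine cs (Us @ map ((\<otimes>) z) Vs) \<in> P"
  define as where "as = take (length Us) cs"
  define bs where "bs = drop (length Us) cs"
  have ab: "cs = as @ bs" "length as = length Us" "length bs = length Vs"
    using cs(1) by (auto simp: as_def bs_def)
  have K': "set as \<subseteq> K" "set bs \<subseteq> K" using cs(2) ab(1) by auto
  hence c: "set as \<subseteq> carrier R" "set bs \<subseteq> carrier R" using Kc by auto
  have e: "combine cs (Us @ map ((\<otimes>) z) Vs) = combine as Us \<oplus> combine bs (map ((\<otimes>) z) Vs)"
    unfolding ab(1) by (rule combine_append[OF ab(2) c(1) Uc c(2) zV, symmetric])
  have m: "map ((\<otimes>) z) Vs = map (\<lambda>u. u \<otimes> z) Vs" using Vc zc m_comm by auto
  have e2: "combine bs (map ((\<otimes>) z) Vs) = z \<otimes> combine bs Vs"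
    unfolding m combine_l_distr[OF c(2) Vc zc, symmetric] using zc c(2) Vc by (simp add: m_comm)
  have cc: "combine as Us \<in> carrier R" "combine bs Vs \<in> carrier R" using c Uc Vc by auto
  have "z \<otimes> combine bs Vs \<in> P'" using Po'(7)[OF z(1) cc(2)] .
  moreover have "combine as Us \<oplus> z \<otimes> combine bs Vs \<in> P'" using cs(3) e e2 sub by auto
  ultimately have "(combine as Us \<oplus> z \<otimes> combine bs Vs) \<ominus> z \<otimes> combine bs Vs \<in> P'" by (intro Po'(4))
  moreover have "(combine as Us \<oplus> z \<otimes> combine bs Vs) \<ominus> z \<otimes> combine bs Vs = combine as Us"
    using cc zc by algebra
  ultimately have "combine as Us \<in> P'" by simp
  hence as: "set as \<subseteq> {\<zero>}" using U ab(2) K'(1) unfolding independent_mod_def by blast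
  hence "combine as Us = \<zero>"
    using Uc
  proof (induction as Us rule: combine.induct)
    case (1 a as u us) thus ?case by auto
  qed auto
  hence "z \<otimes> combine bs Vs \<in> P" using cs(3) e e2 cc zc by simp
  hence "combine bs Vs \<in> P" using primeideal.I_prime[OF P zc cc(2)] z(2) by blast
  hence "set bs \<subseteq> {\<zero>}" using V ab(3) K'(2) unfolding independent_mod_def by blast
  thus "set cs \<subseteq> {\<zero>}" using as ab(1) by auto
qed

fun monomial_multiples :: "'a list \<Rightarrow> nat \<Rightarrow> 'a list \<Rightarrow> 'a list" where
  "monomial_multiples [] n Us = Us"
| "monomial_multiples (z # zs) n Us =
    concat (map (\<lambda>i. map ((\<otimes>) (z [^] i)) (monomial_multiples zs n Us)) [0..<Suc n])"

lemma length_monomial_multiples: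
  "length (monomial_multiples zs n Us) = Suc n ^ length zs * length Us"
proof (induction zs)
  case (Cons z zs)
  have "length (monomial_multiples (z # zs) n Us) =
      sum_list (map (\<lambda>i. length (monomial_multiples zs n Us)) [0..<Suc n])"
    unfolding monomial_multiples.simps length_concat map_map by (simp add: comp_def)
  also have "\<dots> = Suc n * length (monomial_multiples zs n Us)"
    unfolding sum_list_triv by simp
  finally show ?case unfolding Cons.IH by (simp only: power_Suc length_Cons mult.assoc)
qed simp

lemma set_monomial_multiples_Cons:
  "set (monomial_multiples (z # zs) n Us) =
    {z [^] i \<otimes> w | i w. i \<le> n \<and> w \<in> set (monomial_multiples zs n Us)}"
  by (auto simp del: upt_Suc simp: image_iff less_Suc_eq_le) (metis atLeastLessThan_iff le0 less_Suc_eq_le)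

lemma monomial_multiples_carrier:
  "set zs \<subseteq> carrier R \<Longrightarrow> set Us \<subseteq> carrier R \<Longrightarrow> set (monomial_multiples zs n Us) \<subseteq> carrier R"
proof (induction zs)
  case (Cons z zs)
  thus ?case unfolding set_monomial_multiples_Cons by auto
qed simp

lemma monomial_multiples_mono:
  "m \<le> n \<Longrightarrow> set (monomial_multiples zs m Us) \<subseteq> set (monomial_multiples zs n Us)"
proof (induction zs)
  case (Cons z zs)
  thus ?case unfolding set_monomial_multiples_Cons using le_trans by blast
qed simp

lemma monomial_multiples_base:
  "set zs \<subseteq> carrier R \<Longrightarrow> set Us \<subseteq> carrier R \<Longrightarrow> set Us \<subseteq> set (monomial_multiples zs n Us)"
proof (induction zs)
  case (Cons z zs)
  show ?case
  proof
    fix u assume u: "u \<in> set Us"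
    hence "u \<in> set (monomial_multiples zs n Us)" using Cons by auto
    moreover have "z [^] (0::nat) \<otimes> u = u" using u Cons.prems by auto
    ultimately show "u \<in> set (monomial_multiples (z # zs) n Us)"
      unfolding set_monomial_multiples_Cons by (metis (mono_tags, lifting) le0 mem_Collect_eq)
  qed
qed simp

lemma monomial_multiples_mult:
  "set zs \<subseteq> carrier R \<Longrightarrow> set Us \<subseteq> carrier R \<Longrightarrow> z \<in> set zs \<Longrightarrow> u \<in> set (monomial_multiples zs n Us) \<Longrightarrow>
    z \<otimes> u \<in> set (monomial_multiples zs (Suc n) Us)"
proof (induction zs arbitrary: u)
  case (Cons y zs)
  obtain i w where u: "i \<le> n" "w \<in> set (monomial_multiples zs n Us)" "u = y [^] i \<otimes> w"
    using Cons.prems(4) unfolding set_monomial_multiples_Cons by blast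
  have c: "y \<in> carrier R" "z \<in> carrier R" "w \<in> carrier R"
    using Cons.prems u monomial_multiples_carrier[of zs Us n] by auto
  show ?case
  proof (cases "z = y")
    case True
    have "z \<otimes> u = y [^] Suc i \<otimes> w" unfolding u(3) True using c by (simp add: m_ac)
    moreover have "w \<in> set (monomial_multiples zs (Suc n) Us)" using u(2) monomial_multiples_mono[of n "Suc n"] by auto
    ultimately show ?thesis unfolding set_monomial_multiples_Cons using u(1) by blast
  next
    case False
    hence "z \<otimes> w \<in> set (monomial_multiples zs (Suc n) Us)" using Cons u by auto
    moreover have "z \<otimes> u = y [^] i \<otimes> (z \<otimes> w)" unfolding u(3) using c by (simp add: m_ac)
    moreover have "i \<le> Suc n" using u(1) by simp
    ultimately show ?thesis unfolding set_monomial_multiples_Cons by blast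
  qed
qed simp

end

section \<open>Growth of graded pieces and dimension\<close>

context standard_graded_ring
begin

lemma component_lincombs:
  assumes B: "B \<subseteq> carrier R" "\<And>b i. b \<in> B \<Longrightarrow> component b i \<in> B" and xs: "set xs \<subseteq> G e"
    and a: "a \<in> lincombs xs B"
  shows "component a (e + m) \<in> lincombs xs (B \<inter> G m)"
  using xs a
proof (induction xs arbitrary: a)
  case (Cons x xs)
  then obtain b c where bc: "b \<in> B" "c \<in> lincombs xs B" "a = x \<otimes> b \<oplus> c" by auto
  have x: "x \<in> G e" and xs: "set xs \<subseteq> G e" using Cons.prems by auto
  have xsc: "set xs \<subseteq> carrier R" using xs G_carrier by blast
  have c: "b \<in> carrier R" "c \<in> carrier R" "x \<in> carrier R"
    using bc B(1) lincombs_carrier[OF xsc B(1)] x by auto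
  have "component a (e + m) = x \<otimes> component b m \<oplus> component c (e + m)"
    unfolding bc(3) using c by (simp add: component_add component_mult_homogeneous[OF x])
  moreover have "component b m \<in> B \<inter> G m" using B(2)[OF bc(1)] component_spec(1)[OF c(1)] by simp
  moreover have "component c (e + m) \<in> lincombs xs (B \<inter> G m)" using Cons.IH[OF xs bc(2)] .
  ultimately show ?case by auto
qed simp

lemma lincombs_homogeneous:
  assumes "B \<subseteq> carrier R" "\<And>b i. b \<in> B \<Longrightarrow> component b i \<in> B" "set xs \<subseteq> G e"
    and "a \<in> lincombs xs B" "a \<in> G (e + m)"
  shows "a \<in> lincombs xs (B \<inter> G m)"
  using component_lincombs[OF assms(1-4), of m] assms(5) component_homogeneous[of a "e + m" "e + m"] by simp

lemma genideal_homogeneous: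
  assumes xs: "set xs \<subseteq> G 1" and a: "a \<in> Idl (set xs)" "a \<in> G (Suc m)"
  shows "a \<in> lincombs xs (G m)"
proof -
  have "set xs \<subseteq> carrier R" using xs G_carrier by blast
  hence "a \<in> lincombs xs (carrier R)" using a(1) genideal_eq_lincombs by simp
  hence "a \<in> lincombs xs (carrier R \<inter> G m)" using a(2) by (intro lincombs_homogeneous[OF _ _ xs]) auto
  thus ?thesis using G_carrier[of m] by (simp add: Int_absorb1)
qed

lemma lincombs_Span:
  assumes xs: "set xs \<subseteq> carrier R" and Us: "set Us \<subseteq> carrier R" and Vs: "set Vs \<subseteq> carrier R"
    and B: "B \<subseteq> Span k Us" and prod: "\<And>x u. x \<in> set xs \<Longrightarrow> u \<in> set Us \<Longrightarrow> x \<otimes> u \<in> set Vs"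
  shows "lincombs xs B \<subseteq> Span k Vs"
  using xs prod
proof (induction xs)
  case Nil thus ?case using Span_subgroup_props(2)[OF subfield_k Vs] by simp
next
  case (Cons x xs)
  have x: "x \<in> carrier R" using Cons.prems by simp
  have "set (map ((\<otimes>) x) Us) \<subseteq> set Vs" using Cons.prems(2) by auto
  hence "set (map ((\<otimes>) x) Us) \<subseteq> Span k Vs" using Span_base_incl[OF subfield_k Vs] by blast
  from mono_Span_subset[OF subfield_k this Vs]
  have 1: "x \<otimes> b \<in> Span k Vs" if "b \<in> B" for b
    using Span_mult[OF subfield_k x Us, of b] that B by blast
  have "lincombs xs B \<subseteq> Span k Vs" using Cons by auto
  thus ?case using 1 Span_subgroup_props(3)[OF subfield_k Vs] by auto
qed

lemma finite_dimensional_piece: "\<exists>Us. set Us \<subseteq> carrier R \<and> G n \<subseteq> Span k Us"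
proof (induction n)
  case 0
  have "c \<in> Span k [\<one>]" if "c \<in> k" for c
    using Span_smult_closed[OF subfield_k _ that, of "[\<one>]" \<one>] Span_base_incl[OF subfield_k, of "[\<one>]"]
      that k_carrier by auto
  thus ?case by (intro exI[of _ "[\<one>]"]) (auto simp: degree_zero)
next
  case (Suc n)
  then obtain Us where Us: "set Us \<subseteq> carrier R" "G n \<subseteq> Span k Us" by blast
  obtain S where S: "finite S" "S \<subseteq> G 1" "generate_ring R (k \<union> S) = carrier R" using generated by blast
  obtain ss where ss: "set ss = S" using finite_list[OF S(1)] by blast
  have ssc: "set ss \<subseteq> carrier R" using S(2) ss G_carrier by blast
  define Vs where "Vs = concat (map (\<lambda>x. map ((\<otimes>) x) Us) ss)"
  have Vs: "set Vs \<subseteq> carrier R" using ssc Us(1) by (auto simp: Vs_def)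
  have "G (Suc n) \<subseteq> lincombs ss (G n)"
  proof
    fix a assume a: "a \<in> G (Suc n)"
    hence "a \<in> Idl (set ss)"
      using positive_part_subset_genideal[OF S(2,3)] ss by (auto simp: component_homogeneous)
    thus "a \<in> lincombs ss (G n)" using a S(2) ss by (intro genideal_homogeneous) auto
  qed
  also have "\<dots> \<subseteq> Span k Vs" by (rule lincombs_Span[OF ssc Us(1) Vs Us(2)]) (auto simp: Vs_def)
  finally show ?case using Vs by blast
qed

lemma Span_append_mono:
  assumes "set Us \<subseteq> carrier R" "set Vs \<subseteq> carrier R"
  shows "Span k Us \<subseteq> Span k (Us @ Vs)" "Span k Vs \<subseteq> Span k (Us @ Vs)"
proof -
  have c: "set (Us @ Vs) \<subseteq> carrier R" using assms by simp
  show "Span k Us \<subseteq> Span k (Us @ Vs)" "Span k Vs \<subseteq> Span k (Us @ Vs)"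
    by (intro mono_Span_subset[OF subfield_k _ c] subset_trans[OF _ Span_base_incl[OF subfield_k c]], simp)+
qed

lemma finite_dimensional_pieces: "\<exists>Us. set Us \<subseteq> carrier R \<and> (\<forall>i\<le>n. G i \<subseteq> Span k Us)"
proof (induction n)
  case 0 show ?case using finite_dimensional_piece[of 0] by auto
next
  case (Suc n)
  then obtain Us where Us: "set Us \<subseteq> carrier R" "\<And>i. i \<le> n \<Longrightarrow> G i \<subseteq> Span k Us" by blast
  obtain Vs where Vs: "set Vs \<subseteq> carrier R" "G (Suc n) \<subseteq> Span k Vs" using finite_dimensional_piece by blast
  have "G i \<subseteq> Span k (Us @ Vs)" if "i \<le> Suc n" for i
  proof (cases "i = Suc n")
    case True
    thus ?thesis using Vs(2) Span_append_mono(2)[OF Us(1) Vs(1)] by (simp only:)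
  next
    case False
    hence "i \<le> n" using that by simp
    from subset_trans[OF Us(2)[OF this] Span_append_mono(1)[OF Us(1) Vs(1)]] show ?thesis .
  qed
  moreover have "set (Us @ Vs) \<subseteq> carrier R" using Us(1) Vs(1) by simp
  ultimately show ?case by blast
qed

text \<open>
  From degree \<open>N\<close> on, every form is a combination of the \<open>zs\<close> with coefficients one degree lower, so the forms of degree at most
  \<open>N\<close> and the monomials in \<open>zs\<close> generate everything. The spanning set is far from minimal; only its growth, polynomial of
  degree \<open>length zs\<close> in \<open>n\<close>, matters.
\<close>

lemma below_Span_monomial_multiples:
  assumes zs: "set zs \<subseteq> G 1" and big: "\<And>m. m \<ge> N \<Longrightarrow> G m \<subseteq> Idl (set zs)"
  shows "\<exists>Us. set Us \<subseteq> carrier R \<and> (\<forall>n. below (Suc n) \<subseteq> Span k (monomial_multiples zs n Us))"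
proof -
  have zsc: "set zs \<subseteq> carrier R" using zs G_carrier by blast
  obtain Us where Us: "set Us \<subseteq> carrier R" "\<And>i. i \<le> N \<Longrightarrow> G i \<subseteq> Span k Us"
    using finite_dimensional_pieces by blast
  note mc = monomial_multiples_carrier[OF zsc Us(1)]
  have piece: "G i \<subseteq> Span k (monomial_multiples zs i Us)" for i
  proof (induction i)
    case 0
    have "Span k Us \<subseteq> Span k (monomial_multiples zs 0 Us)"
      using monomial_multiples_base[OF zsc Us(1)] Span_base_incl[OF subfield_k mc]
      by (intro mono_Span_subset[OF subfield_k _ mc]) blast
    thus ?case using Us(2)[of 0] by auto
  next
    case (Suc i)
    show ?case
    proof (cases "Suc i \<le> N")
      case True
      have "Span k Us \<subseteq> Span k (monomial_multiples zs (Suc i) Us)"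
        using monomial_multiples_base[OF zsc Us(1)] Span_base_incl[OF subfield_k mc]
        by (intro mono_Span_subset[OF subfield_k _ mc]) blast
      thus ?thesis using Us(2)[OF True] by auto
    next
      case False
      hence "G (Suc i) \<subseteq> lincombs zs (G i)" using big[of "Suc i"] genideal_homogeneous[OF zs] by fastforce
      also have "\<dots> \<subseteq> Span k (monomial_multiples zs (Suc i) Us)"
        by (rule lincombs_Span[OF zsc mc mc Suc.IH]) (rule monomial_multiples_mult[OF zsc Us(1)])
      finally show ?thesis .
    qed
  qed
  have "below (Suc n) \<subseteq> Span k (monomial_multiples zs n Us)" for n
  proof
    fix a assume a: "a \<in> below (Suc n)"
    have ac: "a \<in> carrier R" using a by (rule below_carrier)
    have "a = (\<Oplus>i\<in>{..<Suc n}. component a i)" using a ac by (intro component_sum) (auto simp: below_def)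
    also have "\<dots> \<in> Span k (monomial_multiples zs n Us)"
    proof (rule finsum_in_subset)
      fix i assume i: "i \<in> {..<Suc n}"
      have "Span k (monomial_multiples zs i Us) \<subseteq> Span k (monomial_multiples zs n Us)"
        using monomial_multiples_mono[of i n zs Us] i Span_base_incl[OF subfield_k mc[of n]]
        by (intro mono_Span_subset[OF subfield_k _ mc]) auto
      thus "component a i \<in> Span k (monomial_multiples zs n Us)" using piece component_spec(1)[OF ac] by blast
    qed (use Span_subgroup_props[OF subfield_k mc] in auto)
    finally show "a \<in> Span k (monomial_multiples zs n Us)" .
  qed
  thus ?thesis using Us(1) by blast
qed

text \<open>
  With \<open>z\<^sub>i\<close> in the difference of consecutive primes, a family for \<open>(j + 1, s)\<close> modulo the larger prime and \<open>z\<^sub>i\<close> times a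
  family for \<open>(j, s + 1)\<close> modulo the smaller one combine to a family for \<open>(j + 1, s + 1)\<close>. The sizes add up by
  Pascal's rule.
\<close>

lemma independent_mod_prime_chain:
  assumes C: "prime_chain R r C" and e: "\<And>i. i < r \<Longrightarrow> z i \<in> C (Suc i) - C i" "\<And>i. i < r \<Longrightarrow> z i \<in> below (Suc e)"
  shows "s \<le> r \<Longrightarrow> \<exists>Us. independent_mod k (C (r - s)) Us \<and> set Us \<subseteq> below (Suc (j * e)) \<and>
    length Us = (j + s) choose s"
proof (induction s arbitrary: j)
  have prime: "primeideal (C i) R" if "i \<le> r" for i using C that by (simp add: prime_chain_def)
  have one: "independent_mod k (C i) [\<one>]" if "i \<le> r" for i
    using primeideal.I_notcarr[OF prime[OF that]]
    by (intro independent_mod_one[OF subfield_k primeideal.axioms(1)[OF prime[OF that]]]) auto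
  have b1: "\<one> \<in> below (Suc m)" for m by (rule below_homogeneous[OF one_G]) simp
  {
    case 0
    show ?case using one[of r] b1 by (intro exI[of _ "[\<one>]"]) auto
  next
    case (Suc s)
    note IHs = Suc.IH[OF Suc_leD[OF Suc.prems]] and sr = Suc.prems
    show ?case
    proof (induction j)
      case 0
      show ?case using one[of "r - Suc s"] b1 by (intro exI[of _ "[\<one>]"]) auto
    next
      case (Suc j)
      obtain Us where U: "independent_mod k (C (r - s)) Us" "set Us \<subseteq> below (Suc (Suc j * e))"
        "length Us = (Suc j + s) choose s" using IHs[of "Suc j"] by blast
      obtain Vs where V: "independent_mod k (C (r - Suc s)) Vs" "set Vs \<subseteq> below (Suc (j * e))"
        "length Vs = (j + Suc s) choose Suc s" using Suc.IH by blast
      let ?i = "r - Suc s"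
      have i: "?i < r" "Suc ?i = r - s" using sr by auto
      have "C ?i \<subset> C (Suc ?i)" using C i(1) unfolding prime_chain_def by blast
      hence sub: "C ?i \<subseteq> C (r - s)" unfolding i(2) by blast
      have zi: "z ?i \<in> C (r - s)" "z ?i \<notin> C ?i" using e(1)[OF i(1)] i(2) by auto
      have "independent_mod k (C ?i) (Us @ map ((\<otimes>) (z ?i)) Vs)"
        by (rule independent_mod_append[OF subfield_k prime primeideal.axioms(1)[OF prime] sub zi U(1) V(1)]) (use i in auto)
      moreover have "set (Us @ map ((\<otimes>) (z ?i)) Vs) \<subseteq> below (Suc (Suc j * e))"
      proof -
        have "z ?i \<otimes> v \<in> below (Suc (Suc j * e))" if "v \<in> set Vs" for v
          using below_mult[OF e(2)[OF i(1)], of v "Suc (j * e)"] V(2) that by auto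
        thus ?thesis using U(2) by auto
      qed
      moreover have "length (Us @ map ((\<otimes>) (z ?i)) Vs) = (Suc j + Suc s) choose Suc s"
        using U(3) V(3) by simp
      ultimately show ?case by blast
    qed
  }
qed

lemma power_le_fact_binomial: "j ^ r \<le> fact r * ((j + r) choose r)"
proof (induction r)
  case (Suc r)
  have "j ^ Suc r \<le> (j + Suc r) * (fact r * ((j + r) choose r))"
    unfolding power_Suc by (rule mult_le_mono[OF _ Suc]) simp
  also have "\<dots> = fact r * (Suc (j + r) * ((j + r) choose r))" by (simp only: add_Suc_right ac_simps)
  also have "\<dots> = fact r * (Suc r * (Suc (j + r) choose Suc r))" by (simp only: Suc_times_binomial)
  also have "\<dots> = fact (Suc r) * ((j + Suc r) choose Suc r)"
    by (simp only: fact_Suc of_nat_id add_Suc_right ac_simps)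
  finally show ?case .
qed simp

text \<open>
  A prime chain of length \<open>r\<close> yields \<open>(j + r) choose r\<close> independent elements of degree at most \<open>j e\<close>, which grows like
  \<open>j\<^sup>r\<close>, while the space of all elements of degree at most \<open>j e\<close> has dimension at most a constant times
  \<open>(j e + 1)\<^sup>g\<close>, where \<open>g = length zs\<close>. For large \<open>j\<close> this forces \<open>r \<le> g\<close>.
\<close>

theorem krull_dim_le_parameters:
  assumes zs: "set zs \<subseteq> G 1" and big: "\<And>m. m \<ge> N \<Longrightarrow> G m \<subseteq> Idl (set zs)"
  shows "krull_dim R \<le> enat (length zs)"
proof -
  define g where "g = length zs"
  have zsc: "set zs \<subseteq> carrier R" using zs G_carrier by blast
  obtain Us where Us: "set Us \<subseteq> carrier R" "\<And>n. below (Suc n) \<subseteq> Span k (monomial_multiples zs n Us)"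
    using below_Span_monomial_multiples[OF zs big] by blast
  have False if C: "prime_chain R n C" and n: "n > g" for n C
  proof -
    \<comment> \<open>A chain longer than \<open>g\<close> may be cut off at length \<open>g + 1\<close>.\<close>
    define r where "r = Suc g"
    have C': "prime_chain R r C" using C n by (auto simp: prime_chain_def r_def)
    have "\<forall>i. \<exists>z. i < r \<longrightarrow> z \<in> C (Suc i) - C i" using C' unfolding prime_chain_def by blast
    then obtain z where z: "\<And>i. i < r \<Longrightarrow> z i \<in> C (Suc i) - C i" by metis
    have zc: "z i \<in> carrier R" if i: "i < r" for i
    proof -
      have "primeideal (C (Suc i)) R" using C' i by (simp add: prime_chain_def)
      thus ?thesis using z[OF i] ideal_ops(8)[OF primeideal.axioms(1)] by blast
    qed
    hence "\<forall>i. \<exists>n. i < r \<longrightarrow> z i \<in> below n" using below_exhausts by blast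
    then obtain d where d: "\<And>i. i < r \<Longrightarrow> z i \<in> below (d i)" by metis
    \<comment> \<open>A common degree bound for all \<open>z i\<close>.\<close>
    define e where "e = (\<Sum>i<r. d i)"
    have "d i \<le> Suc e" if "i < r" for i
      unfolding e_def using that member_le_sum[of i "{..<r}" d] by auto
    hence ze: "z i \<in> below (Suc e)" if "i < r" for i using d[OF that] below_mono that by blast
    have bound: "(j + r) choose r \<le> Suc (j * e) ^ g * length Us" for j
    proof -
      obtain Vs where V: "independent_mod k (C 0) Vs" "set Vs \<subseteq> below (Suc (j * e))" "length Vs = (j + r) choose r"
        using independent_mod_prime_chain[OF C' z ze, of r j] by auto
      have "primeideal (C 0) R" using C' by (simp add: prime_chain_def)
      hence "independent k Vs" using independent_mod_imp_independent[OF subfield_k _ V(1)] primeideal.axioms(1) by blast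
      moreover have "set Vs \<subseteq> Span k (monomial_multiples zs (j * e) Us)" using V(2) Us(2) by blast
      ultimately have "length Vs \<le> length (monomial_multiples zs (j * e) Us)"
        by (rule independent_length_le_spanning[OF subfield_k _ monomial_multiples_carrier[OF zsc Us(1)]])
      thus ?thesis unfolding V(3) length_monomial_multiples g_def .
    qed
    define c where "c = fact r * (Suc e ^ g * length Us)"
    have "j \<le> c" if j: "j > 0" for j
    proof -
      have "Suc (j * e) ^ g \<le> (j * Suc e) ^ g" using j by (intro power_mono) auto
      hence "Suc (j * e) ^ g \<le> j ^ g * Suc e ^ g" by (simp only: power_mult_distrib)
      hence "Suc (j * e) ^ g * length Us \<le> (j ^ g * Suc e ^ g) * length Us" by (rule mult_le_mono1)
      hence "Suc (j * e) ^ g * length Us \<le> j ^ g * (Suc e ^ g * length Us)" by (simp only: mult.assoc)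
      hence "(j + r) choose r \<le> j ^ g * (Suc e ^ g * length Us)" using bound[of j] by linarith
      hence "fact r * ((j + r) choose r) \<le> fact r * (j ^ g * (Suc e ^ g * length Us))" by (rule mult_le_mono2)
      also have "\<dots> = j ^ g * c" by (simp add: c_def)
      finally have "j ^ r \<le> j ^ g * c" using power_le_fact_binomial[of j r] by linarith
      hence "j ^ g * j \<le> j ^ g * c" by (simp add: r_def mult.commute)
      thus ?thesis using j by simp
    qed
    from this[of "Suc c"] show False by simp
  qed
  hence "n \<le> g" if "prime_chain R n C" for n C using that by (meson not_le)
  thus ?thesis unfolding krull_dim_def g_def[symmetric] by (intro Sup_least) auto
qed

end

section \<open>Exchange in regular sequences\<close>

context cring
begin

text \<open>
  An element killed by \<open>u + c v\<close> is an eigenvector of the pencil \<open>(u, v)\<close> for the eigenvalue \<open>c\<close>. As in linear algebra,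
  eigenvectors \<open>a\<^sub>0, a\<^sub>1, \<dots>\<close> for distinct \<open>c\<^sub>i\<close> are independent: the product of the \<open>u + c\<^sub>i v\<close> with \<open>i < m\<close> kills
  the first \<open>m\<close> of them but no other. So infinitely many would generate a strictly increasing chain of ideals.
\<close>

lemma finite_zerodivisors_on_line:
  assumes noeth: "noetherian_ring R" and K: "subfield K R" and Q: "ideal Q R"
    and u: "u \<in> carrier R" and v: "v \<in> carrier R"
    and nzd: "nonzerodivisor_mod Q u \<or> nonzerodivisor_mod Q v"
  shows "finite {c \<in> K. \<not> nonzerodivisor_mod Q (u \<oplus> c \<otimes> v)}"
proof (rule ccontr)
  assume "infinite {c \<in> K. \<not> nonzerodivisor_mod Q (u \<oplus> c \<otimes> v)}"
  then obtain c :: "nat \<Rightarrow> 'a" where inj: "inj c" and c: "range c \<subseteq> {c \<in> K. \<not> nonzerodivisor_mod Q (u \<oplus> c \<otimes> v)}"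
    using infinite_countable_subset by blast
  note Qo = ideal_ops[OF Q]
  have cK: "c i \<in> K" for i using c by blast
  have cc: "c i \<in> carrier R" for i using cK subringE(1)[OF subfieldE(1)[OF K]] by blast
  have "\<forall>i. \<exists>a. a \<in> carrier R \<and> (u \<oplus> c i \<otimes> v) \<otimes> a \<in> Q \<and> a \<notin> Q"
    using c unfolding nonzerodivisor_mod_def by blast
  then obtain a where a: "\<And>i. a i \<in> carrier R" "\<And>i. (u \<oplus> c i \<otimes> v) \<otimes> a i \<in> Q" "\<And>i. a i \<notin> Q" by metis
  define p :: "nat \<Rightarrow> 'a" where "p = rec_nat \<one> (\<lambda>i q. (u \<oplus> c i \<otimes> v) \<otimes> q)"
  have p0: "p 0 = \<one>" and pS: "p (Suc i) = (u \<oplus> c i \<otimes> v) \<otimes> p i" for i by (simp_all add: p_def)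
  have pc: "p i \<in> carrier R" for i using u v cc by (induction i) (simp_all add: p0 pS)
  \<comment> \<open>\<open>p m\<close> kills \<open>a i\<close> for \<open>i < m\<close>, but acts injectively on the other eigenvectors.\<close>
  have kill: "p m \<otimes> a i \<in> Q" if "i < m" for i m
    using that
  proof (induction m)
    case (Suc m)
    show ?case
    proof (cases "i = m")
      case True
      have "p (Suc m) \<otimes> a i = p m \<otimes> ((u \<oplus> c m \<otimes> v) \<otimes> a m)"
        unfolding pS True using pc[of m] a(1)[of m] u v cc[of m] by algebra
      thus ?thesis using Qo(6)[OF a(2) pc] by simp
    next
      case False
      have "p (Suc m) \<otimes> a i = (u \<oplus> c m \<otimes> v) \<otimes> (p m \<otimes> a i)"
        unfolding pS using pc[of m] a(1)[of i] u v cc[of m] by algebra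
      thus ?thesis using Suc False Qo(6) u v cc by simp
    qed
  qed simp
  have inj_act: "b \<in> Q" if b: "b \<in> carrier R" "(u \<oplus> e \<otimes> v) \<otimes> b \<in> Q" "e \<in> K" "\<And>i. i < m \<Longrightarrow> e \<noteq> c i" "p m \<otimes> b \<in> Q" for b e m
    using that
  proof (induction m)
    case 0 thus ?case by (simp add: p0)
  next
    case (Suc m)
    have ec: "e \<in> carrier R" using Suc.prems(3) subringE(1)[OF subfieldE(1)[OF K]] by blast
    define f where "f = c m \<ominus> e"
    have fne: "f \<noteq> \<zero>"
    proof
      assume "f = \<zero>"
      moreover have "f \<oplus> e = c m" unfolding f_def using cc[of m] ec by algebra
      ultimately show False using Suc.prems(4)[of m] ec by simp
    qed
    have "f \<in> K" unfolding f_def a_minus_def using cK Suc.prems(3) subringE(5,7)[OF subfieldE(1)[OF K]] by blast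
    with fne have inv: "inv f \<in> carrier R" "inv f \<otimes> f = \<one>" "f \<in> carrier R"
      using subfield_m_inv[OF K, of f] subringE(1)[OF subfieldE(1)[OF K]] by auto
    define w where "w = p m \<otimes> b"
    have wc: "w \<in> carrier R" using pc Suc.prems(1) by (simp add: w_def)
    have uvw: "(u \<oplus> c m \<otimes> v) \<otimes> w \<in> Q"
    proof -
      have "p (Suc m) \<otimes> b = (u \<oplus> c m \<otimes> v) \<otimes> w" unfolding pS w_def using pc[of m] Suc.prems(1) u v cc[of m] by algebra
      thus ?thesis using Suc.prems(5) by simp
    qed
    have uew: "(u \<oplus> e \<otimes> v) \<otimes> w \<in> Q"
    proof -
      have "(u \<oplus> e \<otimes> v) \<otimes> w = p m \<otimes> ((u \<oplus> e \<otimes> v) \<otimes> b)" unfolding w_def using pc[of m] Suc.prems(1) u v ec by algebra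
      thus ?thesis using Qo(6)[OF Suc.prems(2) pc] by simp
    qed
    have cancel: "y \<in> Q" if "f \<otimes> y \<in> Q" "y \<in> carrier R" for y
    proof -
      have "inv f \<otimes> (f \<otimes> y) = (inv f \<otimes> f) \<otimes> y" using m_assoc[OF inv(1) inv(3) that(2)] by simp
      thus ?thesis using Qo(6)[OF that(1) inv(1)] inv(2) that(2) by simp
    qed
    have "f \<otimes> (v \<otimes> w) = (u \<oplus> c m \<otimes> v) \<otimes> w \<ominus> (u \<oplus> e \<otimes> v) \<otimes> w"
      unfolding f_def using wc u v cc[of m] ec by algebra
    hence vw: "v \<otimes> w \<in> Q" using cancel Qo(4)[OF uvw uew] v wc by simp
    have "f \<otimes> (u \<otimes> w) = c m \<otimes> ((u \<oplus> e \<otimes> v) \<otimes> w) \<ominus> e \<otimes> ((u \<oplus> c m \<otimes> v) \<otimes> w)"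
      unfolding f_def using wc u v cc[of m] ec by algebra
    hence uw: "u \<otimes> w \<in> Q" using cancel Qo(4)[OF Qo(6)[OF uew cc] Qo(6)[OF uvw ec]] u wc by simp
    have "w \<in> Q" using nzd uw vw wc unfolding nonzerodivisor_mod_def by blast
    thus ?case using Suc.IH[OF Suc.prems(1-3)] Suc.prems(4) unfolding w_def by simp
  qed
  obtain m where m: "a m \<in> Idl (Q \<union> a ` {..<m})"
    using noetherian_Idl_sequence_stabilizes[OF noeth Qo(1), of a] a(1) by blast
  have "ideal {y \<in> carrier R. p m \<otimes> y \<in> Q} R"
  proof (rule idealI_simple)
    fix y r assume y: "y \<in> {y \<in> carrier R. p m \<otimes> y \<in> Q}" and r: "r \<in> carrier R"
    have "p m \<otimes> (r \<otimes> y) = r \<otimes> (p m \<otimes> y)" using y r pc by (simp add: m_lcomm)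
    thus "r \<otimes> y \<in> {y \<in> carrier R. p m \<otimes> y \<in> Q}" using y r Qo(6) by auto
  qed (use pc Qo in \<open>auto simp: r_distr\<close>)
  moreover have "Q \<union> a ` {..<m} \<subseteq> {y \<in> carrier R. p m \<otimes> y \<in> Q}"
    using Qo(1) Qo(6)[OF _ pc] kill a(1) by blast
  ultimately have "Idl (Q \<union> a ` {..<m}) \<subseteq> {y \<in> carrier R. p m \<otimes> y \<in> Q}" by (rule genideal_minimal)
  hence "p m \<otimes> a m \<in> Q" using m by blast
  moreover have "c m \<noteq> c i" if "i < m" for i using injD[OF inj, of m i] that by auto
  ultimately have "a m \<in> Q" using inj_act[OF a(1,2) cK] by blast
  thus False using a(3) by blast
qed

text \<open>
  If \<open>v\<close> serves the ideals treated so far and \<open>u\<close> serves the next one, then \<open>u + c v\<close> serves all of them for all but finitely many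
  scalars \<open>c\<close>, and the field is infinite.
\<close>

lemma common_nonzerodivisor:
  assumes noeth: "noetherian_ring R" and K: "subfield K R" "infinite K" and M: "ideal M R"
    and fin: "finite \<Q>" and ex: "\<And>Q. Q \<in> \<Q> \<Longrightarrow> ideal Q R \<and> (\<exists>z\<in>M. nonzerodivisor_mod Q z)"
  shows "\<exists>z\<in>M. \<forall>Q\<in>\<Q>. nonzerodivisor_mod Q z"
  using fin ex
proof (induction \<Q> rule: finite_induct)
  case empty thus ?case using ideal_ops(2)[OF M] by blast
next
  case (insert Q \<Q>)
  note Mo = ideal_ops[OF M]
  obtain v where v: "v \<in> M" "\<And>Q. Q \<in> \<Q> \<Longrightarrow> nonzerodivisor_mod Q v" using insert by auto
  obtain u where u: "u \<in> M" "nonzerodivisor_mod Q u" using insert by auto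
  have cc: "u \<in> carrier R" "v \<in> carrier R" using u v Mo(8) by auto
  define bad where "bad Q' = {c \<in> K. \<not> nonzerodivisor_mod Q' (u \<oplus> c \<otimes> v)}" for Q'
  have "finite (bad Q')" if Q': "Q' \<in> insert Q \<Q>" for Q'
  proof -
    have "nonzerodivisor_mod Q' u \<or> nonzerodivisor_mod Q' v" using Q' u(2) v(2) by blast
    moreover have "ideal Q' R" using insert.prems Q' by blast
    ultimately show ?thesis unfolding bad_def using cc by (intro finite_zerodivisors_on_line[OF noeth K(1)])
  qed
  hence "finite (\<Union>Q'\<in>insert Q \<Q>. bad Q')" using insert.hyps(1) by (intro finite_UN_I) auto
  hence "\<not> K \<subseteq> (\<Union>Q'\<in>insert Q \<Q>. bad Q')" using K(2) finite_subset by blast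
  then obtain c where c: "c \<in> K" "c \<notin> (\<Union>Q'\<in>insert Q \<Q>. bad Q')" by blast
  have "u \<oplus> c \<otimes> v \<in> M" using u(1) v(1) c(1) subringE(1)[OF subfieldE(1)[OF K(1)]] by (intro Mo(3,6)) auto
  moreover have "\<forall>Q'\<in>insert Q \<Q>. nonzerodivisor_mod Q' (u \<oplus> c \<otimes> v)" using c unfolding bad_def by blast
  ultimately show ?case by blast
qed

lemma regular_mod_adjoin:
  assumes "ideal Q R" "set xs \<subseteq> carrier R" "z \<in> carrier R" "regular_mod Q xs"
    and "\<And>i. i \<le> length xs \<Longrightarrow> nonzerodivisor_mod (adjoin_list Q (take i xs)) z"
  shows "regular_mod (adjoin Q z) xs"
  using assms
proof (induction xs arbitrary: Q)
  case (Cons x xs)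
  have x: "x \<in> carrier R" using Cons.prems by simp
  have nx: "nonzerodivisor_mod Q x" "regular_mod (adjoin Q x) xs" using Cons.prems by auto
  have nz: "nonzerodivisor_mod (adjoin_list (adjoin Q x) (take i xs)) z" if "i \<le> length xs" for i
    using Cons.prems(5)[of "Suc i"] that by simp
  have "nonzerodivisor_mod (adjoin Q z) x"
    using nz[of 0] by (simp add: nonzerodivisor_mod_swap[OF Cons.prems(1) x Cons.prems(3) nx(1)])
  moreover have "regular_mod (adjoin (adjoin Q x) z) xs"
    using Cons.prems by (intro Cons.IH adjoin_ideal x nx nz) auto
  ultimately show ?case using adjoin_commute[OF Cons.prems(1) x Cons.prems(3)] by simp
qed simp

lemma adjoin_list_adjoin:
  assumes "ideal Q R" "set xs \<subseteq> carrier R" "z \<in> carrier R"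
  shows "adjoin_list (adjoin Q z) xs = adjoin (adjoin_list Q xs) z"
proof -
  have "adjoin_list (adjoin Q z) xs = adjoin_list Q (z # xs)" by simp
  also have "\<dots> = adjoin_list Q (xs @ [z])"
    using assms by (subst (1 2) adjoin_list_eq_genideal) auto
  finally show ?thesis by simp
qed

text \<open>
  The relation \<open>z s \<equiv> x t\<close> modulo \<open>Q\<close> turns an element \<open>s\<close> that \<open>M\<close> kills modulo \<open>Q + (x)\<close> into an element \<open>t\<close> that
  \<open>M\<close> kills modulo \<open>Q + (z)\<close>, and it is symmetric in the two. If \<open>M\<close> is an ideal, it is the identification of both annihilators
  with \<open>Ext\<^sup>1(R/M, R/Q)\<close>.
\<close>

lemma socle_exchange:
  assumes Q: "ideal Q R" and M: "M \<subseteq> carrier R" and x: "x \<in> M" and z: "z \<in> M"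
    and nx: "nonzerodivisor_mod Q x" and nz: "nonzerodivisor_mod Q z"
    and s: "s \<in> carrier R" "s \<notin> adjoin Q x" "\<And>m. m \<in> M \<Longrightarrow> m \<otimes> s \<in> adjoin Q x"
  shows "\<exists>t\<in>carrier R. t \<notin> adjoin Q z \<and> (\<forall>m\<in>M. m \<otimes> t \<in> adjoin Q z)"
proof -
  note Qo = ideal_ops[OF Q]
  have xc: "x \<in> carrier R" and zc: "z \<in> carrier R" using x z M by auto
  obtain q t where t: "q \<in> Q" "t \<in> carrier R" "z \<otimes> s = q \<oplus> x \<otimes> t" using s(3)[OF z] by (rule adjoinE)
  have qc: "q \<in> carrier R" using t Qo(8) by blast
  have "t \<notin> adjoin Q z"
  proof
    assume "t \<in> adjoin Q z"
    then obtain q' b where b: "q' \<in> Q" "b \<in> carrier R" "t = q' \<oplus> z \<otimes> b" by (rule adjoinE)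
    have qc': "q' \<in> carrier R" using b Qo(8) by blast
    have "z \<otimes> (s \<ominus> x \<otimes> b) = z \<otimes> s \<ominus> x \<otimes> (z \<otimes> b)" using zc s(1) xc b(2) by algebra
    also have "\<dots> = q \<oplus> x \<otimes> q'" unfolding t(3) b(3) using qc qc' xc zc b(2) by algebra
    also have "\<dots> \<in> Q" by (intro Qo(3) Qo(6) t b xc)
    finally have "s \<ominus> x \<otimes> b \<in> Q" using nz s(1) xc b(2) unfolding nonzerodivisor_mod_def by simp
    hence "(s \<ominus> x \<otimes> b) \<oplus> x \<otimes> b \<in> adjoin Q x" using b(2) by (intro adjoinI)
    moreover have "(s \<ominus> x \<otimes> b) \<oplus> x \<otimes> b = s" using s(1) xc b(2) by algebra
    ultimately show False using s(2) by simp
  qed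
  moreover have "m \<otimes> t \<in> adjoin Q z" if m: "m \<in> M" for m
  proof -
    have mc: "m \<in> carrier R" using m M by blast
    obtain q' b where b: "q' \<in> Q" "b \<in> carrier R" "m \<otimes> s = q' \<oplus> x \<otimes> b" using s(3)[OF m] by (rule adjoinE)
    have qc': "q' \<in> carrier R" using b Qo(8) by blast
    have "x \<otimes> (m \<otimes> t \<ominus> z \<otimes> b) = m \<otimes> (x \<otimes> t) \<ominus> z \<otimes> (x \<otimes> b)" using mc t(2) zc xc b(2) by algebra
    also have "x \<otimes> t = z \<otimes> s \<ominus> q" unfolding t(3) using qc xc t(2) by algebra
    also have "x \<otimes> b = m \<otimes> s \<ominus> q'" unfolding b(3) using qc' xc b(2) by algebra
    also have "m \<otimes> (z \<otimes> s \<ominus> q) \<ominus> z \<otimes> (m \<otimes> s \<ominus> q') = z \<otimes> q' \<ominus> m \<otimes> q"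
      using mc zc s(1) qc qc' by algebra
    also have "\<dots> \<in> Q" by (intro Qo(4) Qo(6) t b zc mc)
    finally have "m \<otimes> t \<ominus> z \<otimes> b \<in> Q" using nx mc t(2) zc b(2) unfolding nonzerodivisor_mod_def by simp
    hence "(m \<otimes> t \<ominus> z \<otimes> b) \<oplus> z \<otimes> b \<in> adjoin Q z" using b(2) by (intro adjoinI)
    moreover have "(m \<otimes> t \<ominus> z \<otimes> b) \<oplus> z \<otimes> b = m \<otimes> t" using mc t(2) zc b(2) by algebra
    ultimately show ?thesis by simp
  qed
  ultimately show ?thesis using t(2) by blast
qed

text \<open>
  Choose \<open>z \<in> M\<close> that is a nonzerodivisor modulo every proper initial segment of both sequences. The last member of each sequence
  can be exchanged for \<open>z\<close>, the socle element surviving by \<open>socle_exchange\<close>, and \<open>z\<close> can be moved to the front. Modulo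
  \<open>Q + (z)\<close> both sequences are one shorter, and induction applies.
\<close>

theorem regular_mod_length_le_of_socle:
  assumes noeth: "noetherian_ring R" and K: "subfield K R" "infinite K" and M: "ideal M R"
    and Q: "ideal Q R" and xs: "set xs \<subseteq> M" "regular_mod Q xs"
    and s: "s \<in> carrier R" "s \<notin> adjoin_list Q xs" "\<And>m. m \<in> M \<Longrightarrow> m \<otimes> s \<in> adjoin_list Q xs"
    and ys: "set ys \<subseteq> M" "regular_mod Q ys"
  shows "length ys \<le> length xs"
  using Q xs s ys
proof (induction "length xs" arbitrary: Q xs ys s)
  case 0
  hence xs: "xs = []" by simp
  show ?case
  proof (cases ys)
    case (Cons y ys')
    hence "y \<otimes> s \<in> Q" "nonzerodivisor_mod Q y" using 0 xs by auto
    hence "s \<in> Q" using 0(5) unfolding nonzerodivisor_mod_def by blast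
    thus ?thesis using 0 xs by simp
  qed simp
next
  case (Suc n)
  note Mo = ideal_ops[OF M]
  show ?case
  proof (cases "ys = []")
    case False
    obtain xs' x where xs': "xs = xs' @ [x]" using Suc.hyps(2) by (metis Zero_not_Suc length_0_conv rev_exhaust)
    obtain ys' y where ys': "ys = ys' @ [y]" using False by (metis rev_exhaust)
    have xsc: "set xs \<subseteq> carrier R" and ysc: "set ys \<subseteq> carrier R" using Suc.prems Mo(1) by auto
    define \<Q> where "\<Q> = (\<lambda>i. adjoin_list Q (take i xs)) ` {..<length xs} \<union> (\<lambda>i. adjoin_list Q (take i ys)) ` {..<length ys}"
    have one: "ideal (adjoin_list Q (take i zs)) R \<and> (\<exists>z\<in>M. nonzerodivisor_mod (adjoin_list Q (take i zs)) z)"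
      if "set zs \<subseteq> M" "regular_mod Q zs" "i < length zs" for i zs
    proof -
      have "set (take i zs) \<subseteq> carrier R" using that(1) Mo(1) set_take_subset[of i zs] by blast
      moreover have "zs ! i \<in> M" using that by auto
      ultimately show ?thesis using that regular_mod_iff_nth[of Q zs] adjoin_list_ideal[OF Suc.prems(1)] by blast
    qed
    have "\<exists>z\<in>M. \<forall>Q'\<in>\<Q>. nonzerodivisor_mod Q' z"
    proof (rule common_nonzerodivisor[OF noeth K M])
      show "finite \<Q>" by (simp add: \<Q>_def)
      fix Q' assume "Q' \<in> \<Q>"
      thus "ideal Q' R \<and> (\<exists>z\<in>M. nonzerodivisor_mod Q' z)"
        unfolding \<Q>_def using one[OF Suc.prems(2,3)] one[OF Suc.prems(7,8)] by auto
    qed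
    then obtain z where z: "z \<in> M" "\<And>Q'. Q' \<in> \<Q> \<Longrightarrow> nonzerodivisor_mod Q' z" by blast
    have zc: "z \<in> carrier R" using z(1) Mo(8) by blast
    have zx: "nonzerodivisor_mod (adjoin_list Q (take i xs')) z" if "i \<le> length xs'" for i
    proof -
      have "adjoin_list Q (take i xs) \<in> \<Q>" using that xs' unfolding \<Q>_def by auto
      moreover have "take i xs = take i xs'" using that xs' by simp
      ultimately show ?thesis using z(2) by metis
    qed
    have zy: "nonzerodivisor_mod (adjoin_list Q (take i ys')) z" if "i \<le> length ys'" for i
    proof -
      have "adjoin_list Q (take i ys) \<in> \<Q>" using that ys' unfolding \<Q>_def by auto
      moreover have "take i ys = take i ys'" using that ys' by simp
      ultimately show ?thesis using z(2) by metis
    qed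
    have xsc': "set xs' \<subseteq> carrier R" "set xs' \<subseteq> M" "x \<in> M" and ysc': "set ys' \<subseteq> carrier R" "set ys' \<subseteq> M"
      using xsc ysc xs' ys' Suc.prems(2,7) by auto
    have rx: "regular_mod Q xs'" "nonzerodivisor_mod (adjoin_list Q xs') x"
      using Suc.prems(3) xs' by (auto simp: regular_mod_append)
    have ry: "regular_mod Q ys'" using Suc.prems(8) ys' by (auto simp: regular_mod_append)
    have Q1: "ideal (adjoin_list Q xs') R" by (rule adjoin_list_ideal[OF Suc.prems(1) xsc'(1)])
    have "\<exists>t\<in>carrier R. t \<notin> adjoin (adjoin_list Q xs') z \<and> (\<forall>m\<in>M. m \<otimes> t \<in> adjoin (adjoin_list Q xs') z)"
      using Suc.prems(4-6) xs' zx[of "length xs'"]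
      by (intro socle_exchange[OF Q1 Mo(1) xsc'(3) z(1) rx(2), of s]) auto
    then obtain t where t: "t \<in> carrier R" "t \<notin> adjoin_list (adjoin Q z) xs'"
      "\<And>m. m \<in> M \<Longrightarrow> m \<otimes> t \<in> adjoin_list (adjoin Q z) xs'"
      unfolding adjoin_list_adjoin[OF Suc.prems(1) xsc'(1) zc] by blast
    have "length ys' \<le> length xs'"
    proof (rule Suc.hyps(1)[of xs' "adjoin Q z" t ys'])
      show "n = length xs'" using Suc.hyps(2) xs' by simp
      show "ideal (adjoin Q z) R" by (rule adjoin_ideal[OF Suc.prems(1) zc])
      show "regular_mod (adjoin Q z) xs'" by (rule regular_mod_adjoin[OF Suc.prems(1) xsc'(1) zc rx(1) zx])
      show "regular_mod (adjoin Q z) ys'" by (rule regular_mod_adjoin[OF Suc.prems(1) ysc'(1) zc ry zy])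
    qed (use xsc' ysc' t in auto)
    thus ?thesis using xs' ys' by simp
  qed simp
qed

end

section \<open>Cohen--Macaulay standard graded rings\<close>

context standard_graded_ring
begin

lemma noetherian: "noetherian_ring R"
proof -
  obtain S where S: "finite S" "S \<subseteq> G 1" "generate_ring R (k \<union> S) = carrier R" using generated by blast
  have "S \<subseteq> carrier R" using S(2) G_carrier by blast
  from noetherian_generate_ring[OF subfield_k S(1) this] show ?thesis unfolding S(3) by simp
qed

text \<open>
  For every maximal ideal \<open>M\<close>: \<open>length xs \<le> depth M \<le> height M \<le> dim R \<le> length xs\<close>.
\<close>

lemma cohen_macaulay_of_regular_parameters:
  assumes inf: "infinite k" and xs: "set xs \<subseteq> G 1" and dim: "krull_dim R \<le> enat (length xs)"
    and reg: "regular_mod {\<zero>} xs"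
  shows "cohen_macaulay R"
  unfolding cohen_macaulay_def
proof (intro conjI allI impI is_cring noetherian)
  fix M assume M: "maximalideal M R"
  have "ideal_height R M \<le> krull_dim R" by (rule ideal_height_le_krull_dim[OF maximalideal_prime[OF M]])
  moreover note dim
  moreover have "enat (length xs) \<le> depth R M" by (rule length_le_depth_maximalideal[OF inf xs reg M])
  moreover have "depth R M \<le> ideal_height R M" by (rule depth_le_ideal_height)
  ultimately show "depth R M = ideal_height R M" by (meson order.antisym order.trans)
qed

abbreviation (input) "Rplus \<equiv> irrelevant_ideal R G"

context
  fixes xs x N
  assumes xs: "set xs \<subseteq> G 1" and x: "x \<in> G 1" and reg: "regular_mod {\<zero>} xs"
    and big: "\<And>m. m \<ge> N \<Longrightarrow> G m \<subseteq> Idl (insert x (set xs))"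
begin

abbreviation (input) "Qxs \<equiv> adjoin_list {\<zero>} xs"

lemma xs_carrier: "set xs \<subseteq> carrier R" using xs G_carrier by blast
lemma x_carrier: "x \<in> carrier R" using x by simp
lemma Qxs_ideal: "ideal Qxs R" by (rule adjoin_list_ideal[OF zeroideal xs_carrier])
lemma Qxs_eq_Idl: "Qxs = Idl (set xs)" by (rule adjoin_list_zero[OF xs_carrier])
lemma Qxs_homogeneous: "homogeneous Qxs" using xs by (intro homogeneous_adjoin_list homogeneous_zero) auto
lemma pieces_in_adjoin: "m \<ge> N \<Longrightarrow> G m \<subseteq> adjoin Qxs x"
  using big[of m] adjoin_list_zero[of "xs @ [x]"] xs_carrier x_carrier by simp
lemma G1_Rplus: "G 1 \<subseteq> Rplus" unfolding irrelevant_ideal_def by (rule genideal_self[OF G_carrier])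

text \<open>
  Otherwise all forms of large degree would already lie in the ideal of \<open>xs\<close>, and the dimension would be at most \<open>length xs\<close>.
\<close>

lemma pow_notin_Qxs:
  assumes dim: "krull_dim R = enat (Suc (length xs))"
  shows "x [^] (i::nat) \<notin> Qxs"
proof
  assume nil: "x [^] i \<in> Qxs"
  note Qo = ideal_ops[OF Qxs_ideal]
  \<comment> \<open>Modulo \<open>xs\<close> every form of degree \<open>m \<ge> N\<close> is \<open>x\<close> times a form of degree \<open>m - 1\<close>; iterate \<open>j\<close> times.\<close>
  have step: "G m \<subseteq> adjoin Qxs (x [^] j)" if "m \<ge> N + j" for m j :: nat
    using that
  proof (induction j arbitrary: m)
    case 0
    have "a \<in> adjoin Qxs (x [^] (0::nat))" if "a \<in> carrier R" for a
      using adjoinI[OF Qo(2) that, of \<one>] that by simp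
    thus ?case using G_carrier by blast
  next
    case (Suc j)
    obtain m' where m': "m = Suc m'" using Suc.prems by (cases m) auto
    show ?case
    proof
      fix a assume a: "a \<in> G m"
      have "a \<in> Idl (set (x # xs))" using big[of m] a Suc.prems by auto
      hence "a \<in> lincombs (x # xs) (G m')" using a m' xs x by (intro genideal_homogeneous) auto
      then obtain b c where bc: "b \<in> G m'" "c \<in> lincombs xs (G m')" "a = x \<otimes> b \<oplus> c" by auto
      have cQ: "c \<in> Qxs"
        using bc(2) lincombs_mono[OF G_carrier[of m'], of xs] genideal_eq_lincombs[OF xs_carrier] Qxs_eq_Idl by blast
      have cc: "c \<in> carrier R" using cQ Qo(8) by blast
      have "b \<in> adjoin Qxs (x [^] j)" using Suc.IH[of m'] Suc.prems m' bc(1) by auto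
      then obtain q r where q: "q \<in> Qxs" "r \<in> carrier R" "b = q \<oplus> x [^] j \<otimes> r" by (rule adjoinE)
      have qc: "q \<in> carrier R" "x [^] j \<in> carrier R" using q Qo(8) x_carrier by auto
      have "a = (x \<otimes> q \<oplus> c) \<oplus> (x [^] j \<otimes> x) \<otimes> r" unfolding bc(3) q(3) using qc q(2) x_carrier cc by algebra
      moreover have "x \<otimes> q \<oplus> c \<in> Qxs" by (intro Qo(3) Qo(6) q cQ x_carrier)
      ultimately show "a \<in> adjoin Qxs (x [^] Suc j)" using adjoinI[of "x \<otimes> q \<oplus> c" Qxs r "x [^] j \<otimes> x"] q(2) by simp
    qed
  qed
  have "adjoin Qxs (x [^] i) \<subseteq> Qxs" using nil by (intro adjoin_least Qxs_ideal) auto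
  hence "krull_dim R \<le> enat (length xs)"
    using step Qxs_eq_Idl by (intro krull_dim_le_parameters[OF xs, of "N + i"]) blast
  thus False using dim by simp
qed

text \<open>
  Since \<open>x\<close> is not nilpotent modulo the ideal of \<open>xs\<close>, some prime inside \<open>R\<^sub>+\<close> contains \<open>xs\<close> but not \<open>x\<close>. It has
  height at least \<open>length xs\<close> because \<open>xs\<close> is regular, and it is strictly smaller than \<open>R\<^sub>+\<close>.
\<close>

lemma height_irrelevant_ideal:
  assumes dim: "krull_dim R = enat (Suc (length xs))"
  shows "enat (Suc (length xs)) \<le> ideal_height R Rplus"
proof -
  note Qo = ideal_ops[OF Qxs_ideal]
  have Rplus: "primeideal Rplus R" by (rule maximalideal_prime[OF irrelevant_ideal_maximal])
  have "\<exists>P'. primeideal P' R \<and> Qxs \<subseteq> P' \<and> P' \<subseteq> Rplus \<and> x \<notin> P'"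
  proof (rule primeideal_omitting[OF Qxs_ideal Rplus x_carrier])
    fix i :: nat and b assume b: "b \<in> carrier R - Rplus"
    show "x [^] i \<otimes> b \<notin> Qxs"
    proof
      assume "x [^] i \<otimes> b \<in> Qxs"
      hence "component (x [^] i \<otimes> b) i \<in> Qxs" by (rule homogeneousD[OF Qxs_homogeneous])
      hence 1: "x [^] i \<otimes> component b 0 \<in> Qxs" using b by (simp add: component_mult_homogeneous[OF pow_G[OF x]])
      have "component b 0 \<in> k - {\<zero>}"
        using b component_spec(1)[of b 0] by (auto simp: irrelevant_ideal_eq degree_zero)
      from subfield_m_inv[OF subfield_k this]
      have inv: "inv (component b 0) \<in> carrier R" "component b 0 \<otimes> inv (component b 0) = \<one>" using k_carrier by auto
      have "x [^] i \<otimes> component b 0 \<otimes> inv (component b 0) \<in> Qxs" by (rule Qo(7)[OF 1 inv(1)])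
      hence "x [^] i \<in> Qxs" using inv b x_carrier by (simp add: m_assoc)
      thus False using pow_notin_Qxs[OF dim] by blast
    qed
  qed
  then obtain p where p: "primeideal p R" "Qxs \<subseteq> p" "p \<subseteq> Rplus" "x \<notin> p" by (elim exE conjE)
  have xsp: "set xs \<subseteq> p" using adjoin_list_superset[OF zeroideal xs_carrier] p(2) by blast
  have "\<zero> \<in> p" using ideal_ops(2)[OF primeideal.axioms(1)[OF p(1)]] .
  then obtain C where C: "prime_chain R (length xs) C" "C (length xs) = p"
    using regular_mod_imp_prime_chain[OF zeroideal xsp _ p(1) reg] by blast
  show ?thesis
    unfolding ideal_height_def
  proof (rule Inf_greatest, clarify)
    fix P assume P: "primeideal P R" "Rplus \<subseteq> P"
    have lt: "p \<subset> P" using p(3,4) P(2) x G1_Rplus by blast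
    define C' where "C' = (\<lambda>i. if i \<le> length xs then C i else P)"
    have "prime_chain R (Suc (length xs)) C'"
      unfolding prime_chain_def
    proof (intro conjI allI impI)
      fix i assume "i \<le> Suc (length xs)"
      thus "primeideal (C' i) R" using C(1) P(1) by (simp add: prime_chain_def C'_def)
    next
      fix i assume "i < Suc (length xs)"
      thus "C' i \<subset> C' (Suc i)" using C lt by (cases "i = length xs") (simp_all add: prime_chain_def C'_def)
    qed
    moreover have "C' (Suc (length xs)) = P" by (simp add: C'_def)
    ultimately show "enat (Suc (length xs)) \<le> prime_height R P"
      unfolding prime_height_def by (intro Sup_upper) blast
  qed
qed

text \<open>
  If \<open>x c\<close> is zero modulo \<open>xs\<close> but \<open>c\<close> is not, then all forms of large degree kill \<open>c\<close>. Multiplying \<open>c\<close> by a form of the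
  largest degree in which some form does not kill it yields a nonzero element killed by \<open>R\<^sub>+\<close>.
\<close>

lemma depth_irrelevant_ideal_of_zerodivisor:
  assumes inf: "infinite k" and zd: "\<not> nonzerodivisor_mod Qxs x"
  shows "depth R Rplus \<le> enat (length xs)"
proof -
  note Qo = ideal_ops[OF Qxs_ideal]
  obtain c where c: "c \<in> carrier R" "x \<otimes> c \<in> Qxs" "c \<notin> Qxs" using zd unfolding nonzerodivisor_mod_def by blast
  \<comment> \<open>The condition that \<open>G j\<close> kills \<open>c\<close> modulo \<open>xs\<close>; the least such \<open>j\<close> is positive, as \<open>c\<close> itself is not zero modulo \<open>xs\<close>.\<close>
  define kills where "kills j \<longleftrightarrow> (\<forall>a\<in>G j. a \<otimes> c \<in> Qxs)" for j
  have "kills N"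
    unfolding kills_def
  proof
    fix a assume "a \<in> G N"
    hence "a \<in> adjoin Qxs x" using pieces_in_adjoin[of N] by blast
    then obtain q r where q: "q \<in> Qxs" "r \<in> carrier R" "a = q \<oplus> x \<otimes> r" by (rule adjoinE)
    have qc: "q \<in> carrier R" using q Qo(8) by blast
    have "a \<otimes> c = q \<otimes> c \<oplus> r \<otimes> (x \<otimes> c)" unfolding q(3) using qc q(2) x_carrier c(1) by algebra
    also have "\<dots> \<in> Qxs" by (intro Qo(3) Qo(6,7) q c)
    finally show "a \<otimes> c \<in> Qxs" .
  qed
  define j where "j = (LEAST j. kills j)"
  have j: "kills j" unfolding j_def using \<open>kills N\<close> by (rule LeastI)
  have "\<not> kills 0" using c(1,3) one_G unfolding kills_def by force
  then obtain i where i: "j = Suc i" using j by (cases j) auto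
  have "\<not> kills i" using not_less_Least[of i kills] i unfolding j_def by simp
  then obtain b where b: "b \<in> G i" "b \<otimes> c \<notin> Qxs" unfolding kills_def by blast
  have bc: "b \<in> carrier R" using b by simp
  have "ideal {m \<in> carrier R. m \<otimes> (b \<otimes> c) \<in> Qxs} R"
    by (rule idealI_simple) (use Qo bc c(1) in \<open>auto simp: l_distr m_assoc[of _ _ "b \<otimes> c"]\<close>)
  moreover have "G 1 \<subseteq> {m \<in> carrier R. m \<otimes> (b \<otimes> c) \<in> Qxs}"
  proof
    fix m assume m: "m \<in> G 1"
    have "m \<otimes> b \<in> G j" using piece_mult[OF m b(1)] i by simp
    hence "m \<otimes> b \<otimes> c \<in> Qxs" using j unfolding kills_def by blast
    thus "m \<in> {m \<in> carrier R. m \<otimes> (b \<otimes> c) \<in> Qxs}" using m bc c(1) by (simp add: m_assoc)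
  qed
  ultimately have "Rplus \<subseteq> {m \<in> carrier R. m \<otimes> (b \<otimes> c) \<in> Qxs}" unfolding irrelevant_ideal_def by (rule genideal_minimal)
  hence soc: "\<And>m. m \<in> Rplus \<Longrightarrow> m \<otimes> (b \<otimes> c) \<in> Qxs" by blast
  have xsRplus: "set xs \<subseteq> Rplus" using xs G1_Rplus by blast
  have "length ys \<le> length xs" if "set ys \<subseteq> Rplus" "regular_sequence R ys" for ys
    using that bc c(1)
    by (intro regular_mod_length_le_of_socle[OF noetherian subfield_k inf irrelevant_ideal_ideal zeroideal xsRplus reg
          _ b(2) soc]) (auto simp: regular_sequence_iff)
  thus ?thesis unfolding depth_def by (intro Sup_least) auto
qed

theorem cohen_macaulay_iff_nonzerodivisor:
  assumes inf: "infinite k" and dim: "krull_dim R = enat (Suc (length xs))"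
  shows "cohen_macaulay R \<longleftrightarrow> nonzerodivisor_mod Qxs x"
proof
  assume "nonzerodivisor_mod Qxs x"
  hence "regular_mod {\<zero>} (xs @ [x])" using reg by (simp add: regular_mod_append)
  thus "cohen_macaulay R" using xs x dim by (intro cohen_macaulay_of_regular_parameters[OF inf, of "xs @ [x]"]) auto
next
  assume "cohen_macaulay R"
  hence eq: "depth R Rplus = ideal_height R Rplus" using irrelevant_ideal_maximal by (simp add: cohen_macaulay_def)
  show "nonzerodivisor_mod Qxs x"
  proof (rule ccontr)
    assume "\<not> nonzerodivisor_mod Qxs x"
    from depth_irrelevant_ideal_of_zerodivisor[OF inf this] height_irrelevant_ideal[OF dim]
    have "enat (Suc (length xs)) \<le> enat (length xs)" unfolding eq by (rule order.trans[rotated])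
    thus False by simp
  qed
qed

end

end

section \<open>Regular sequences in quotient rings\<close>

lemma (in cring) proj_mem_genideal_iff:
  assumes E: "ideal E R" and ss: "set ss \<subseteq> carrier R" and a: "a \<in> carrier R"
  shows "E +> a \<in> genideal (R Quot E) ((+>) E ` set ss) \<longleftrightarrow> a \<in> adjoin_list E ss"
proof -
  interpret E: ideal E R by (rule E)
  interpret F: cring "R Quot E" by (rule E.quotient_is_cring[OF is_cring])
  interpret h: ring_hom_ring R "R Quot E" "(+>) E" by (rule E.rcos_ring_hom_ring)
  let ?J = "adjoin_list E ss"
  have J: "ideal ?J R" "E \<union> set ss \<subseteq> ?J" by (rule adjoin_list_ideal[OF E ss], rule adjoin_list_superset[OF E ss])
  have hs: "(+>) E ` set ss \<subseteq> carrier (R Quot E)" using ss by auto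
  have gi: "ideal (genideal (R Quot E) ((+>) E ` set ss)) (R Quot E)" by (rule F.genideal_ideal[OF hs])
  show ?thesis
  proof
    have "ideal ((+>) E ` ?J) (R Quot E)" by (rule ring_ideal_imp_quot_ideal[OF E J(1)])
    moreover have "(+>) E ` set ss \<subseteq> (+>) E ` ?J" using J(2) by blast
    ultimately have "genideal (R Quot E) ((+>) E ` set ss) \<subseteq> (+>) E ` ?J" by (rule F.genideal_minimal)
    moreover assume "E +> a \<in> genideal (R Quot E) ((+>) E ` set ss)"
    ultimately have "E +> a \<in> (+>) E ` ?J" by (rule subsetD)
    then obtain b where b: "b \<in> ?J" "E +> a = E +> b" by (elim imageE)
    have bc: "b \<in> carrier R" using b(1) ideal_ops(8)[OF J(1)] by blast
    have "a \<ominus> b \<in> E" using b(2) quotient_eq_iff_same_a_r_cos[OF E a bc] by (rule iffD2[rotated])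
    hence "a \<ominus> b \<in> ?J" using J(2) by blast
    from ideal_ops(3)[OF J(1) this b(1)] have m: "(a \<ominus> b) \<oplus> b \<in> ?J" .
    have e: "(a \<ominus> b) \<oplus> b = a" using a bc by algebra
    from m show "a \<in> ?J" unfolding e .
  next
    define Z where "Z = genideal (R Quot E) ((+>) E ` set ss)"
    note Zo = F.ideal_ops[OF gi[folded Z_def]]
    define V where "V = {r \<in> carrier R. E +> r \<in> Z}"
    have V: "ideal V R" unfolding V_def Z_def by (rule h.ideal_vimage[OF gi])
    have "E \<subseteq> V"
    proof
      fix e assume e: "e \<in> E"
      have "E +> e = E +> \<zero>" by (simp only: a_rcos_zero[OF E e] a_rcos_zero[OF E ideal_ops(2)[OF E]])
      hence "E +> e = \<zero>\<^bsub>R Quot E\<^esub>" using h.hom_zero by (simp only:)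
      thus "e \<in> V" using Zo(2) E.Icarr[OF e] by (simp add: V_def)
    qed
    moreover have "set ss \<subseteq> V"
    proof
      fix s assume s: "s \<in> set ss"
      hence "E +> s \<in> Z" unfolding Z_def using F.genideal_self[OF hs] by blast
      thus "s \<in> V" using s ss by (auto simp: V_def)
    qed
    ultimately have "?J \<subseteq> V" by (intro adjoin_list_least[OF V])
    moreover assume "a \<in> ?J"
    ultimately have "a \<in> V" by (rule subsetD)
    thus "E +> a \<in> genideal (R Quot E) ((+>) E ` set ss)" by (simp add: V_def Z_def)
  qed
qed

lemma (in cring) regular_mod_of_regular_sequence_quotient:
  assumes E: "ideal E R" and ss: "set ss \<subseteq> carrier R"
    and reg: "regular_sequence (R Quot E) (map ((+>) E) ss)"
  shows "regular_mod E ss"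
  unfolding regular_mod_iff_nth nonzerodivisor_mod_def
proof (intro allI impI ballI)
  interpret E: ideal E R by (rule E)
  interpret h: ring_hom_ring R "R Quot E" "(+>) E" by (rule E.rcos_ring_hom_ring)
  fix i a assume i: "i < length ss" and a: "a \<in> carrier R" "ss ! i \<otimes> a \<in> adjoin_list E (take i ss)"
  have t: "set (take i ss) \<subseteq> carrier R" using ss set_take_subset[of i ss] by blast
  have sc: "ss ! i \<in> carrier R" using ss i by auto
  have st: "set (take i (map ((+>) E) ss)) = (+>) E ` set (take i ss)" by (simp add: take_map)
  have reg': "\<And>b. b \<in> carrier (R Quot E) \<Longrightarrow> map ((+>) E) ss ! i \<otimes>\<^bsub>R Quot E\<^esub> b \<in> genideal (R Quot E) ((+>) E ` set (take i ss))
     \<Longrightarrow> b \<in> genideal (R Quot E) ((+>) E ` set (take i ss))"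
    using reg i unfolding regular_sequence_def st[symmetric] by simp
  have "map ((+>) E) ss ! i \<otimes>\<^bsub>R Quot E\<^esub> (E +> a) = E +> (ss ! i \<otimes> a)"
    using i sc a(1) by simp
  hence "E +> a \<in> genideal (R Quot E) ((+>) E ` set (take i ss))"
    using reg'[of "E +> a"] proj_mem_genideal_iff[OF E t, of "ss ! i \<otimes> a"] a sc by simp
  thus "a \<in> adjoin_list E (take i ss)" using proj_mem_genideal_iff[OF E t a(1)] by simp
qed

section \<open>Powers of an ideal and the Rees algebra\<close>

context cring
begin

lemma ideal_power_ideal: "ideal I R \<Longrightarrow> ideal (ideal_power R I n) R"
proof -
  assume I: "ideal I R"
  interpret M: comm_monoid "ideals_set R" by (rule ideals_set_is_comm_monoid)
  have "I \<in> carrier (ideals_set R)" using I by (simp add: ideals_set_def)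
  hence "ideal_power R I n \<in> carrier (ideals_set R)" by (rule M.nat_pow_closed)
  thus ?thesis by (simp add: ideals_set_def)
qed

lemma ideal_power_0: "ideal_power R I 0 = carrier R"
  by (simp add: ideals_set_def)

lemma ideal_power_Suc: "ideal I R \<Longrightarrow> ideal_power R I (Suc n) = ideal_prod R I (ideal_power R I n)"
  using ideal_prod_commute[OF ideal_power_ideal[of I n]] by (simp add: ideals_set_def)

lemma ideal_power_mult:
  assumes I: "ideal I R"
  shows "a \<in> ideal_power R I m \<Longrightarrow> b \<in> ideal_power R I n \<Longrightarrow> a \<otimes> b \<in> ideal_power R I (m + n)"
proof -
  assume ab: "a \<in> ideal_power R I m" "b \<in> ideal_power R I n"
  interpret M: comm_monoid "ideals_set R" by (rule ideals_set_is_comm_monoid)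
  have "I \<in> carrier (ideals_set R)" using I by (simp add: ideals_set_def)
  hence "ideal_prod R (ideal_power R I m) (ideal_power R I n) = ideal_power R I (m + n)"
    using M.nat_pow_mult[of I m n] by (simp add: ideals_set_def)
  thus ?thesis using ideal_prod.prod[OF ab, of R] by simp
qed

lemma ideal_power_1: "ideal I R \<Longrightarrow> ideal_power R I (Suc 0) = I"
  unfolding ideal_power_Suc ideal_power_0 by (rule ideal_prod_one)

lemma ideal_power_Suc_subset: "ideal I R \<Longrightarrow> ideal_power R I (Suc n) \<subseteq> ideal_power R I n"
  using ideal_prod_inter[OF _ ideal_power_ideal[of I n], of I] ideal_power_Suc[of I n] by auto

lemma ideal_power_antimono: "ideal I R \<Longrightarrow> m \<le> n \<Longrightarrow> ideal_power R I n \<subseteq> ideal_power R I m"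
  using lift_Suc_antimono_le[of "ideal_power R I" m n] ideal_power_Suc_subset by blast

lemma lincombs_add:
  assumes "B \<subseteq> carrier R" "\<And>a b. a \<in> B \<Longrightarrow> b \<in> B \<Longrightarrow> a \<oplus> b \<in> B" "set xs \<subseteq> carrier R"
  shows "u \<in> lincombs xs B \<Longrightarrow> v \<in> lincombs xs B \<Longrightarrow> u \<oplus> v \<in> lincombs xs B"
  using assms(3)
proof (induction xs arbitrary: u v)
  case (Cons x xs)
  obtain b c where u: "b \<in> B" "c \<in> lincombs xs B" "u = x \<otimes> b \<oplus> c" using Cons.prems by auto
  obtain b' c' where v: "b' \<in> B" "c' \<in> lincombs xs B" "v = x \<otimes> b' \<oplus> c'" using Cons.prems by auto
  have c: "b \<in> carrier R" "b' \<in> carrier R" "c \<in> carrier R" "c' \<in> carrier R" "x \<in> carrier R"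
    using u v assms(1) lincombs_carrier[of xs B] Cons.prems(3) by auto
  have "u \<oplus> v = x \<otimes> (b \<oplus> b') \<oplus> (c \<oplus> c')" unfolding u(3) v(3) using c by algebra
  moreover have "c \<oplus> c' \<in> lincombs xs B" using Cons.IH[OF u(2) v(2)] Cons.prems(3) by simp
  ultimately show ?case using assms(2)[OF u(1) v(1)] by auto
qed simp

lemma lincombs_mult:
  assumes "B \<subseteq> carrier R" "y \<in> carrier R" "\<And>b. b \<in> B \<Longrightarrow> y \<otimes> b \<in> B'" "set xs \<subseteq> carrier R"
  shows "u \<in> lincombs xs B \<Longrightarrow> y \<otimes> u \<in> lincombs xs B'"
  using assms(4)
proof (induction xs arbitrary: u)
  case Nil thus ?case using assms(2) by simp
next
  case (Cons x xs)
  obtain b c where u: "b \<in> B" "c \<in> lincombs xs B" "u = x \<otimes> b \<oplus> c" using Cons.prems by auto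
  have c: "b \<in> carrier R" "c \<in> carrier R" "x \<in> carrier R"
    using u assms(1) lincombs_carrier[of xs B] Cons.prems(2) by auto
  have "y \<otimes> u = x \<otimes> (y \<otimes> b) \<oplus> y \<otimes> c" unfolding u(3) using c assms(2) by algebra
  moreover have "y \<otimes> c \<in> lincombs xs B'" using Cons.IH[OF u(2)] Cons.prems(2) by simp
  ultimately show ?case using assms(3)[OF u(1)] by auto
qed

lemma lincombs_snoc:
  assumes "B \<subseteq> carrier R" "set xs \<subseteq> carrier R" "x \<in> carrier R"
  shows "lincombs (xs @ [x]) B = {c \<oplus> x \<otimes> b | b c. b \<in> B \<and> c \<in> lincombs xs B}"
  using assms(2)
proof (induction xs)
  case Nil
  have "x \<otimes> b \<oplus> \<zero> = \<zero> \<oplus> x \<otimes> b" if "b \<in> B" for b using that assms(1,3) by (simp add: subset_iff)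
  thus ?case by auto metis+
next
  case (Cons y xs)
  have y: "y \<in> carrier R" and xs: "set xs \<subseteq> carrier R" using Cons.prems by auto
  have L: "lincombs xs B \<subseteq> carrier R" by (rule lincombs_carrier[OF xs assms(1)])
  have e: "y \<otimes> b' \<oplus> (c \<oplus> x \<otimes> b) = (y \<otimes> b' \<oplus> c) \<oplus> x \<otimes> b"
    if "b \<in> B" "b' \<in> B" "c \<in> lincombs xs B" for b b' c
    using that y assms(1,3) L by (intro a_assoc[symmetric]) auto
  show ?case
  proof (rule Set.set_eqI, rule iffI)
    fix a assume "a \<in> lincombs ((y # xs) @ [x]) B"
    then obtain b' b c where "b' \<in> B" "b \<in> B" "c \<in> lincombs xs B" "a = y \<otimes> b' \<oplus> (c \<oplus> x \<otimes> b)"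
      using Cons.IH[OF xs] by auto
    thus "a \<in> {c \<oplus> x \<otimes> b | b c. b \<in> B \<and> c \<in> lincombs (y # xs) B}" using e by auto
  next
    fix a assume "a \<in> {c \<oplus> x \<otimes> b | b c. b \<in> B \<and> c \<in> lincombs (y # xs) B}"
    then obtain b' b c where b: "b' \<in> B" "b \<in> B" "c \<in> lincombs xs B" "a = (y \<otimes> b' \<oplus> c) \<oplus> x \<otimes> b" by auto
    hence "a = y \<otimes> b' \<oplus> (c \<oplus> x \<otimes> b)" using e by simp
    moreover have "c \<oplus> x \<otimes> b \<in> lincombs (xs @ [x]) B" using b Cons.IH[OF xs] by blast
    ultimately show "a \<in> lincombs ((y # xs) @ [x]) B" using b(1) by auto
  qed
qed

lemma ideal_prod_genideal_lincombs:
  assumes xs: "set xs \<subseteq> carrier R" and L: "ideal L R"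
  shows "ideal_prod R (Idl (set xs)) L \<subseteq> lincombs xs L"
proof
  note Lo = ideal_ops[OF L]
  fix a assume "a \<in> ideal_prod R (Idl (set xs)) L"
  thus "a \<in> lincombs xs L"
  proof (induction rule: ideal_prod.induct)
    case (prod i j)
    have "i \<in> lincombs xs (carrier R)" using prod(1) genideal_eq_lincombs[OF xs] by simp
    hence "j \<otimes> i \<in> lincombs xs L" using prod(2) Lo by (intro lincombs_mult[of "carrier R"] xs) auto
    moreover have "i \<in> carrier R" using prod(1) ideal_ops(8)[OF genideal_ideal[OF xs]] by blast
    ultimately show ?case using prod(2) Lo(8) m_comm by simp
  next
    case (sum a b) thus ?case using Lo by (intro lincombs_add xs) auto
  qed
qed

lemma lincombs_subset_genideal:
  assumes "set xs \<subseteq> carrier R" "B \<subseteq> carrier R" shows "lincombs xs B \<subseteq> Idl (set xs)"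
  using lincombs_mono[OF assms(2)] genideal_eq_lincombs[OF assms(1)] by simp

end

locale ring_with_ideal = cring R for R :: "('a, 'b) ring_scheme" (structure) +
  fixes I :: "'a set" assumes I: "ideal I R"
begin

definition Ipow where "Ipow n = ideal_power R I n"
abbreviation Rees where "Rees \<equiv> rees_algebra R I"

lemmas Ipow_ideal = ideal_power_ideal[OF I, folded Ipow_def]
lemmas Ipow_ops = ideal_ops[OF Ipow_ideal]
lemmas Ipow_mult = ideal_power_mult[OF I, folded Ipow_def]
lemmas Ipow_Suc = ideal_power_Suc[OF I, folded Ipow_def]
lemma Ipow_0: "Ipow 0 = carrier R" unfolding Ipow_def by (rule ideal_power_0)
lemma Ipow_1: "Ipow (Suc 0) = I" unfolding Ipow_def by (rule ideal_power_1[OF I])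
lemma Ipow_Suc_subset: "Ipow (Suc n) \<subseteq> Ipow n" unfolding Ipow_def by (rule ideal_power_Suc_subset[OF I])
lemma Ipow_antimono: "m \<le> n \<Longrightarrow> Ipow n \<subseteq> Ipow m" unfolding Ipow_def by (rule ideal_power_antimono[OF I])

sublocale U: UP_cring R "UP R" by unfold_locales

lemma Rees_carrier: "carrier Rees = {p \<in> carrier (UP R). \<forall>i. up_coeff R p i \<in> Ipow i}"
  by (simp add: rees_algebra_def Ipow_def)

lemma Rees_simps [simp]:
  "p \<oplus>\<^bsub>Rees\<^esub> q = p \<oplus>\<^bsub>UP R\<^esub> q" "p \<otimes>\<^bsub>Rees\<^esub> q = p \<otimes>\<^bsub>UP R\<^esub> q"
  "\<zero>\<^bsub>Rees\<^esub> = \<zero>\<^bsub>UP R\<^esub>" "\<one>\<^bsub>Rees\<^esub> = \<one>\<^bsub>UP R\<^esub>"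
  by (simp_all add: rees_algebra_def)

lemma Rees_subring: "subring (carrier Rees) (UP R)"
proof (rule U.P.subringI)
  show "carrier Rees \<subseteq> carrier (UP R)" by (auto simp: Rees_carrier)
  show "\<one>\<^bsub>UP R\<^esub> \<in> carrier Rees" using Ipow_ops(2) Ipow_0 by (auto simp: Rees_carrier)
  fix p assume p: "p \<in> carrier Rees"
  thus "\<ominus>\<^bsub>UP R\<^esub> p \<in> carrier Rees" using Ipow_ops(5) by (auto simp: Rees_carrier)
  fix q assume q: "q \<in> carrier Rees"
  show "p \<oplus>\<^bsub>UP R\<^esub> q \<in> carrier Rees" using p q Ipow_ops(3) by (auto simp: Rees_carrier)
  have "(\<Oplus>i\<in>{..n}. up_coeff R p i \<otimes> up_coeff R q (n - i)) \<in> Ipow n" for n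
  proof (rule finsum_in_subset)
    fix i assume "i \<in> {..n}"
    thus "up_coeff R p i \<otimes> up_coeff R q (n - i) \<in> Ipow n"
      using Ipow_mult[of "up_coeff R p i" i "up_coeff R q (n - i)" "n - i"] p q by (auto simp: Rees_carrier)
  qed (use Ipow_ops in auto)
  thus "p \<otimes>\<^bsub>UP R\<^esub> q \<in> carrier Rees" using p q by (auto simp: Rees_carrier)
qed

lemma Rees_cring: "cring Rees"
proof -
  have "(UP R)\<lparr>carrier := carrier Rees\<rparr> = Rees" by (simp add: rees_algebra_def)
  thus ?thesis
    using U.P.subcringI'[OF Rees_subring] U.P.subcring_iff[OF subringE(1)[OF Rees_subring]] by simp
qed

sublocale A: cring Rees by (rule Rees_cring)

lemma Rees_closed: "p \<in> carrier Rees \<Longrightarrow> p \<in> carrier (UP R)" by (simp add: Rees_carrier)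

lemma Rees_coeff: "p \<in> carrier Rees \<Longrightarrow> up_coeff R p i \<in> Ipow i" by (simp add: Rees_carrier)

lemma Rees_minus:
  assumes "p \<in> carrier Rees" "q \<in> carrier Rees"
  shows "up_coeff R (p \<ominus>\<^bsub>Rees\<^esub> q) n = up_coeff R p n \<ominus> up_coeff R q n"
proof -
  let ?d = "p \<ominus>\<^bsub>Rees\<^esub> q"
  have d: "?d \<in> carrier Rees" using assms by simp
  have "?d \<oplus>\<^bsub>Rees\<^esub> q = p" using assms by (simp del: Rees_simps add: a_minus_def A.a_assoc A.l_neg)
  hence "up_coeff R (?d \<oplus>\<^bsub>UP R\<^esub> q) n = up_coeff R p n" by simp
  hence "up_coeff R ?d n \<oplus> up_coeff R q n = up_coeff R p n" using assms d Rees_closed by simp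
  moreover have "(up_coeff R ?d n \<oplus> up_coeff R q n) \<ominus> up_coeff R q n = up_coeff R ?d n"
    using U.coeff_closed[OF Rees_closed[OF d], of n] U.coeff_closed[OF Rees_closed[OF assms(2)], of n] by algebra
  ultimately show ?thesis by simp
qed

lemma monom_Rees: "a \<in> Ipow n \<Longrightarrow> up_monom R a n \<in> carrier Rees"
  using Ipow_ops(2,8) by (auto simp: Rees_carrier)

lemma monom_mult_Rees:
  assumes "a \<in> Ipow m" "b \<in> Ipow n"
  shows "up_monom R a m \<otimes>\<^bsub>Rees\<^esub> up_monom R b n = up_monom R (a \<otimes> b) (m + n)"
  using assms Ipow_ops(8) by simp

lemma monom_add_Rees:
  assumes "a \<in> Ipow n" "b \<in> Ipow n"
  shows "up_monom R a n \<oplus>\<^bsub>Rees\<^esub> up_monom R b n = up_monom R (a \<oplus> b) n"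
  using assms Ipow_ops(8) by simp

lemma Rees_terms_induct:
  assumes B: "B \<subseteq> carrier Rees" "\<zero>\<^bsub>Rees\<^esub> \<in> B" "\<And>p q. p \<in> B \<Longrightarrow> q \<in> B \<Longrightarrow> p \<oplus>\<^bsub>Rees\<^esub> q \<in> B"
    and p: "p \<in> carrier Rees" and t: "\<And>n. up_monom R (up_coeff R p n) n \<in> B"
  shows "p \<in> B"
proof -
  have pc: "p \<in> carrier (UP R)" by (rule Rees_closed[OF p])
  have "finsum (UP R) (\<lambda>i. up_monom R (up_coeff R p i) i) {..deg R p} \<in> B"
    by (rule U.P.finsum_in_subset) (use B t Rees_closed in auto)
  thus ?thesis using U.up_repr[OF pc] by simp
qed

text \<open>
  The coefficient of \<open>t\<^sup>n\<close> in an element of the extended ideal \<open>L \<R>(I)\<close> is a sum of products of an element of \<open>L\<close> and an element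
  of \<open>I\<^sup>n\<close>.
\<close>

lemma rees_extension_eq:
  assumes L: "ideal L R"
  shows "rees_extension R I L = {p \<in> carrier Rees. \<forall>n. up_coeff R p n \<in> ideal_prod R L (Ipow n)}" (is "?E = ?P")
proof
  note LI = ideal_prod_is_ideal[OF L Ipow_ideal]
  note LIo = ideal_ops[OF LI]
  have base: "(\<lambda>x. up_monom R x 0) ` L \<subseteq> carrier Rees"
    using monom_Rees[of _ 0] ideal_ops(1)[OF L] by (auto simp: Ipow_0)
  have P: "ideal ?P Rees"
  proof (rule A.idealI_simple)
    show "\<zero>\<^bsub>Rees\<^esub> \<in> ?P" using LIo(2) A.zero_closed by simp
    fix p assume p: "p \<in> ?P"
    { fix q assume q: "q \<in> ?P"
      show "p \<oplus>\<^bsub>Rees\<^esub> q \<in> ?P" using p q LIo(3) A.a_closed[of p q] Rees_closed by simp }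
    fix r assume r: "r \<in> carrier Rees"
    have "(\<Oplus>i\<in>{..n}. up_coeff R r i \<otimes> up_coeff R p (n - i)) \<in> ideal_prod R L (Ipow n)" for n
    proof (rule finsum_in_subset)
      fix i assume i: "i \<in> {..n}"
      have rc: "up_coeff R r i \<in> Ipow i" by (rule Rees_coeff[OF r])
      have "up_coeff R p (n - i) \<in> ideal_prod R L (Ipow (n - i))" using p by simp
      hence "up_coeff R r i \<otimes> up_coeff R p (n - i) \<in> ideal_prod R L (Ipow (i + (n - i)))"
      proof (induction rule: ideal_prod.induct)
        case (prod x y)
        have c: "x \<in> carrier R" "y \<in> carrier R" "up_coeff R r i \<in> carrier R"
          using prod ideal_ops(8)[OF L] Ipow_ops(8) rc by auto
        have "up_coeff R r i \<otimes> (x \<otimes> y) = x \<otimes> (up_coeff R r i \<otimes> y)" using c by (simp add: m_lcomm)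
        thus ?case using ideal_prod.prod[OF prod(1) Ipow_mult[OF rc prod(2)]] by simp
      next
        case (sum x y)
        have c: "x \<in> carrier R" "y \<in> carrier R" "up_coeff R r i \<in> carrier R"
          using sum LIo(8) Ipow_ops(8) rc by auto
        thus ?case using sum LIo(3) by (simp add: r_distr)
      qed
      thus "up_coeff R r i \<otimes> up_coeff R p (n - i) \<in> ideal_prod R L (Ipow n)" using i by simp
    qed (use LIo in auto)
    thus "r \<otimes>\<^bsub>Rees\<^esub> p \<in> ?P" using p r A.m_closed[of r p] Rees_closed by simp
  qed auto
  show "?E \<subseteq> ?P"
    unfolding rees_extension_def
  proof (rule A.genideal_minimal[OF P], clarify)
    fix x assume x: "x \<in> L"
    have xc: "x \<in> carrier R" using x ideal_ops(8)[OF L] by simp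
    have "x \<otimes> \<one> \<in> ideal_prod R L (Ipow 0)" by (rule ideal_prod.prod[OF x]) (simp add: Ipow_0)
    hence "x \<in> ideal_prod R L (Ipow 0)" using xc by simp
    thus "up_monom R x 0 \<in> carrier Rees \<and> (\<forall>n. up_coeff R (up_monom R x 0) n \<in> ideal_prod R L (Ipow n))"
      using xc LIo(2) monom_Rees[of x 0] by (simp add: Ipow_0)
  qed
  have E: "ideal ?E Rees" unfolding rees_extension_def by (rule A.genideal_ideal[OF base])
  note Eo = A.ideal_ops[OF E]
  have mono: "up_monom R a n \<in> ?E" if "a \<in> ideal_prod R L (Ipow n)" for a n
    using that
  proof (induction rule: ideal_prod.induct)
    case (prod x y)
    have "up_monom R x 0 \<in> ?E" unfolding rees_extension_def using A.genideal_self[OF base] prod(1) by blast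
    hence "up_monom R x 0 \<otimes>\<^bsub>Rees\<^esub> up_monom R y n \<in> ?E" by (rule Eo(7)[OF _ monom_Rees[OF prod(2)]])
    moreover have "up_monom R x 0 \<otimes>\<^bsub>Rees\<^esub> up_monom R y n = up_monom R (x \<otimes> y) (0 + n)"
      using prod ideal_ops(8)[OF L] by (intro monom_mult_Rees) (auto simp: Ipow_0)
    ultimately show ?case by simp
  next
    case (sum x y)
    have "x \<in> carrier R" "y \<in> carrier R" using sum LIo(8) by auto
    hence "up_monom R (x \<oplus> y) n = up_monom R x n \<oplus>\<^bsub>Rees\<^esub> up_monom R y n" by simp
    thus ?case using Eo(3)[OF sum(3,4)] by simp
  qed
  show "?P \<subseteq> ?E"
  proof
    fix p assume p: "p \<in> ?P"
    show "p \<in> ?E"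
      by (rule Rees_terms_induct) (use p mono Eo in auto)
  qed
qed

section \<open>Regular leading forms in the associated graded ring\<close>

text \<open>
  The coefficient of \<open>t\<^sup>n\<close> in \<open>f t \<cdot> p\<close>, for \<open>p\<close> in the Rees algebra, is \<open>f\<close> times an element of \<open>I\<^bsup>n-1\<^esup>\<close>, and it is
  zero for \<open>n = 0\<close>. So \<open>I\<^bsup>-1\<^esup>\<close> has to be read as zero here, and not as the whole ring.
\<close>

definition Ipow_pred :: "nat \<Rightarrow> 'a set" where
  "Ipow_pred n = (case n of 0 \<Rightarrow> {\<zero>} | Suc m \<Rightarrow> Ipow m)"

lemma Ipow_pred_subset: "Ipow_pred n \<subseteq> carrier R"
  using Ipow_ops(1) by (auto simp: Ipow_pred_def split: nat.splits)

lemma coeff_lincombs_monom: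
  assumes xs: "set xs \<subseteq> I"
  shows "c \<in> A.lincombs (map (\<lambda>f. up_monom R f 1) xs) (carrier Rees) \<Longrightarrow> up_coeff R c n \<in> lincombs xs (Ipow_pred n)"
  using xs
proof (induction xs arbitrary: c)
  case (Cons x xs)
  obtain b e where b: "b \<in> carrier Rees" "e \<in> A.lincombs (map (\<lambda>f. up_monom R f 1) xs) (carrier Rees)"
    "c = up_monom R x 1 \<otimes>\<^bsub>Rees\<^esub> b \<oplus>\<^bsub>Rees\<^esub> e" using Cons.prems(1) by auto
  have x: "x \<in> carrier R" "x \<in> Ipow 1" using Cons.prems(2) ideal_ops(8)[OF I] Ipow_1 by auto
  have mx: "set (map (\<lambda>f. up_monom R f 1) xs) \<subseteq> carrier Rees"
    using Cons.prems(2) Ipow_1 monom_Rees[of _ 1] by auto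
  have ec: "e \<in> carrier Rees" using A.lincombs_carrier[OF mx, of "carrier Rees"] b(2) by blast
  have coef: "up_coeff R (up_monom R x 1 \<otimes>\<^bsub>UP R\<^esub> b) n = x \<otimes> (case n of 0 \<Rightarrow> \<zero> | Suc m \<Rightarrow> up_coeff R b m)"
  proof (cases n)
    case 0 thus ?thesis using x Rees_closed[OF b(1)] by simp
  next
    case (Suc m)
    have "up_coeff R (up_monom R x 1 \<otimes>\<^bsub>UP R\<^esub> b) n = (\<Oplus>i\<in>{..n}. if 1 = i then x \<otimes> up_coeff R b (n - i) else \<zero>)"
      using x Rees_closed[OF b(1)] by (subst U.coeff_mult) (auto intro!: finsum_cong')
    also have "\<dots> = x \<otimes> up_coeff R b (n - 1)"
      using x Rees_closed[OF b(1)] Suc by (intro finsum_singleton) auto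
    finally show ?thesis using Suc by simp
  qed
  have "up_coeff R c n = x \<otimes> (case n of 0 \<Rightarrow> \<zero> | Suc m \<Rightarrow> up_coeff R b m) \<oplus> up_coeff R e n"
    unfolding b(3) coef[symmetric] using x Rees_closed[OF b(1)] Rees_closed[OF ec] by simp
  moreover have "(case n of 0 \<Rightarrow> \<zero> | Suc m \<Rightarrow> up_coeff R b m) \<in> Ipow_pred n"
    using Rees_coeff[OF b(1)] by (simp add: Ipow_pred_def split: nat.splits)
  moreover have "up_coeff R e n \<in> lincombs xs (Ipow_pred n)" using Cons.IH[OF b(2)] Cons.prems(2) by simp
  ultimately show ?case by auto
qed simp

lemma monom_lincombs:
  assumes xs: "set xs \<subseteq> I"
  shows "a \<in> lincombs xs (Ipow n) \<Longrightarrow>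
    up_monom R a (Suc n) \<in> A.lincombs (map (\<lambda>f. up_monom R f 1) xs) (carrier Rees)"
  using xs
proof (induction xs arbitrary: a)
  case (Cons x xs)
  obtain b c where b: "b \<in> Ipow n" "c \<in> lincombs xs (Ipow n)" "a = x \<otimes> b \<oplus> c" using Cons.prems(1) by auto
  have x: "x \<in> carrier R" "x \<in> Ipow 1" using Cons.prems(2) ideal_ops(8)[OF I] Ipow_1 by auto
  have xsc: "set xs \<subseteq> carrier R" using Cons.prems(2) ideal_ops(8)[OF I] by auto
  have cc: "b \<in> carrier R" "c \<in> carrier R" using b Ipow_ops(8) lincombs_carrier[OF xsc Ipow_ops(1)] by auto
  have "up_monom R a (Suc n) = up_monom R x 1 \<otimes>\<^bsub>Rees\<^esub> up_monom R b n \<oplus>\<^bsub>Rees\<^esub> up_monom R c (Suc n)"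
    unfolding b(3) using monom_mult_Rees[OF x(2) b(1)] x cc by simp
  moreover have "up_monom R c (Suc n) \<in> A.lincombs (map (\<lambda>f. up_monom R f 1) xs) (carrier Rees)"
    using Cons.IH[OF b(2)] Cons.prems(2) by simp
  ultimately show ?case using monom_Rees[OF b(1)] by auto
qed simp

lemma rees_extension_ideal: assumes "ideal L R" shows "ideal (rees_extension R I L) Rees"
  unfolding rees_extension_def
  using monom_Rees[of _ 0] ideal_ops(1)[OF assms] by (intro A.genideal_ideal) (auto simp: Ipow_0)

text \<open>
  Regularity of the classes \<open>f\<^sub>i + I\<^sup>2\<close> in the associated graded ring, tested on homogeneous elements \<open>a + I\<^bsup>n+1\<^esup>\<close> and written
  with representatives: \<open>f\<^sub>i a \<in> (f\<^sub>1, \<dots>, f\<^bsub>i-1\<^esub>) I\<^sup>n + I\<^bsup>n+2\<^esup>\<close> implies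
  \<open>a \<in> (f\<^sub>1, \<dots>, f\<^bsub>i-1\<^esub>) I\<^bsup>n-1\<^esup> + I\<^bsup>n+1\<^esup>\<close>.
\<close>

definition leading_forms_regular :: "'a list \<Rightarrow> bool" where
  "leading_forms_regular xs \<longleftrightarrow> (\<forall>i<length xs. \<forall>n. \<forall>a\<in>Ipow n. \<forall>c\<in>lincombs (take i xs) (Ipow n). \<forall>b\<in>Ipow (Suc (Suc n)).
     xs ! i \<otimes> a = c \<oplus> b \<longrightarrow> (\<exists>c'\<in>lincombs (take i xs) (Ipow_pred n). \<exists>b'\<in>Ipow (Suc n). a = c' \<oplus> b'))"

lemma leading_forms_regularI:
  assumes xs: "set xs \<subseteq> I"
    and reg: "regular_sequence (associated_graded_ring R I) (map (degree_one_class R I) xs)"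
  shows "leading_forms_regular xs"
  unfolding leading_forms_regular_def
proof (intro allI impI ballI)
  let ?E = "rees_extension R I I"
  let ?ss = "map (\<lambda>f. up_monom R f 1) xs"
  have E: "ideal ?E Rees" by (rule rees_extension_ideal[OF I])
  have Ec: "?E = {p \<in> carrier Rees. \<forall>n. up_coeff R p n \<in> Ipow (Suc n)}"
    using rees_extension_eq[OF I] Ipow_Suc by simp
  have ss: "set ?ss \<subseteq> carrier Rees" using xs Ipow_1 monom_Rees[of _ 1] by auto
  have "map (degree_one_class R I) xs = map ((+>\<^bsub>Rees\<^esub>) ?E) ?ss" by (simp add: degree_one_class_def)
  hence "regular_sequence (Rees Quot ?E) (map ((+>\<^bsub>Rees\<^esub>) ?E) ?ss)"
    using reg by (simp only: associated_graded_ring_def)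
  hence reg': "A.regular_mod ?E ?ss" by (rule A.regular_mod_of_regular_sequence_quotient[OF E ss])
  fix i n a c b assume i: "i < length xs" and a: "a \<in> Ipow n" and c: "c \<in> lincombs (take i xs) (Ipow n)"
    and b: "b \<in> Ipow (Suc (Suc n))" and eq: "xs ! i \<otimes> a = c \<oplus> b"
  have txs: "set (take i xs) \<subseteq> I" "set (take i xs) \<subseteq> carrier R"
    using xs set_take_subset[of i xs] ideal_ops(1)[OF I] by auto
  have tss: "set (take i ?ss) \<subseteq> carrier Rees" using ss set_take_subset[of i ?ss] by blast
  have mt: "take i ?ss = map (\<lambda>f. up_monom R f 1) (take i xs)" by (simp add: take_map)
  note adj = A.adjoin_list_eq_lincombs[OF E tss, unfolded mt]
  have fI: "xs ! i \<in> Ipow 1" using xs i Ipow_1 by auto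
  have cb: "c \<in> carrier R" "b \<in> carrier R"
    using c b lincombs_carrier[OF txs(2) Ipow_ops(1)] Ipow_ops(8) by auto
  have "up_monom R (xs ! i) 1 \<otimes>\<^bsub>Rees\<^esub> up_monom R a n = up_monom R (c \<oplus> b) (Suc n)"
    using monom_mult_Rees[OF fI a] eq by simp
  also have "\<dots> = up_monom R b (Suc n) \<oplus>\<^bsub>Rees\<^esub> up_monom R c (Suc n)" using cb by (simp add: a_comm)
  also have "\<dots> \<in> A.adjoin_list ?E (take i ?ss)"
  proof -
    have "up_monom R b (Suc n) \<in> ?E"
      unfolding Ec using monom_Rees[of b "Suc n"] b cb Ipow_ops(2) Ipow_Suc_subset[of "Suc n"] by auto
    thus ?thesis unfolding mt adj using monom_lincombs[OF txs(1) c] by blast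
  qed
  finally have "up_monom R (xs ! i) 1 \<otimes>\<^bsub>Rees\<^esub> up_monom R a n \<in> A.adjoin_list ?E (take i ?ss)" .
  moreover have "A.nonzerodivisor_mod (A.adjoin_list ?E (take i ?ss)) (up_monom R (xs ! i) 1)"
    using reg' i by (simp add: A.regular_mod_iff_nth)
  ultimately have "up_monom R a n \<in> A.adjoin_list ?E (take i ?ss)"
    using monom_Rees[OF a] unfolding A.nonzerodivisor_mod_def by blast
  then obtain q e where q: "q \<in> ?E" "e \<in> A.lincombs (map (\<lambda>f. up_monom R f 1) (take i xs)) (carrier Rees)"
    "up_monom R a n = q \<oplus>\<^bsub>Rees\<^esub> e" unfolding mt adj by blast
  have ec: "e \<in> carrier Rees" using A.lincombs_carrier[OF tss, of "carrier Rees"] q(2) mt by auto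
  have qc: "q \<in> carrier Rees" "up_coeff R q n \<in> Ipow (Suc n)" using q(1) unfolding Ec by auto
  have "a = up_coeff R (up_monom R a n) n" using a Ipow_ops(8) by simp
  also have "\<dots> = up_coeff R e n \<oplus> up_coeff R q n"
    unfolding q(3) using Rees_closed[OF ec] Rees_closed[OF qc(1)] by (simp add: a_comm)
  finally show "\<exists>c'\<in>lincombs (take i xs) (Ipow_pred n). \<exists>b'\<in>Ipow (Suc n). a = c' \<oplus> b'"
    using coeff_lincombs_monom[OF txs(1) q(2)] qc(2) by blast
qed

text \<open>
  Write \<open>a = c + x r\<close> with \<open>x\<close> the last of the elements. As \<open>a \<in> I\<^bsup>s+2\<^esup>\<close>, the product \<open>x r\<close> is in the ideal of the other leading
  forms, so \<open>r = u + r'\<close> with \<open>u\<close> a combination of the others and \<open>r' \<in> I\<^bsup>s+1\<^esup>\<close>. Then \<open>c + x u\<close> is a combination of the others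
  that again lies in \<open>I\<^bsup>s+2\<^esup>\<close>, and induction applies to it.
\<close>

lemma lincombs_inter_Ipow_step:
  assumes "set xs \<subseteq> I" "leading_forms_regular xs" "a \<in> lincombs xs (Ipow s)" "a \<in> Ipow (Suc (Suc s))"
  shows "a \<in> lincombs xs (Ipow (Suc s))"
  using assms
proof (induction xs arbitrary: a rule: rev_induct)
  case (snoc x xs)
  have xs: "set xs \<subseteq> I" "set xs \<subseteq> carrier R" and x: "x \<in> I" "x \<in> carrier R"
    using snoc.prems(1) ideal_ops(8)[OF I] by auto
  have lf: "leading_forms_regular xs"
    unfolding leading_forms_regular_def
  proof (intro allI impI ballI)
    fix i n a' c b assume "i < length xs" "a' \<in> Ipow n" "c \<in> lincombs (take i xs) (Ipow n)"
      "b \<in> Ipow (Suc (Suc n))" "xs ! i \<otimes> a' = c \<oplus> b"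
    thus "\<exists>c'\<in>lincombs (take i xs) (Ipow_pred n). \<exists>b'\<in>Ipow (Suc n). a' = c' \<oplus> b'"
      using snoc.prems(2)[unfolded leading_forms_regular_def, rule_format, of i a' n c b] by (simp add: nth_append)
  qed
  obtain r c where r: "r \<in> Ipow s" "c \<in> lincombs xs (Ipow s)" "a = c \<oplus> x \<otimes> r"
    using snoc.prems(3) unfolding lincombs_snoc[OF Ipow_ops(1) xs(2) x(2)] by blast
  have cc: "r \<in> carrier R" "c \<in> carrier R" "a \<in> carrier R"
    using r(1,2) lincombs_carrier[OF xs(2) Ipow_ops(1)] Ipow_ops(8) snoc.prems(4) by auto
  have mc: "\<ominus> c \<in> lincombs xs (Ipow s)"
  proof -
    have "\<ominus> \<one> \<otimes> c \<in> lincombs xs (Ipow s)" using Ipow_ops(1,6) by (intro lincombs_mult[OF _ _ _ xs(2) r(2)]) auto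
    thus ?thesis using cc by (simp add: l_minus)
  qed
  have "x \<otimes> r = \<ominus> c \<oplus> a" unfolding r(3) using cc x by algebra
  then obtain u r' where u: "u \<in> lincombs xs (Ipow_pred s)" "r' \<in> Ipow (Suc s)" "r = u \<oplus> r'"
    using snoc.prems(2)[unfolded leading_forms_regular_def, rule_format, of "length xs" r s "\<ominus> c" a] r(1) mc snoc.prems(4)
    by auto
  have uc: "u \<in> carrier R" "r' \<in> carrier R" using u lincombs_carrier[OF xs(2) Ipow_pred_subset] Ipow_ops(8) by auto
  have "x \<otimes> u \<in> lincombs xs (Ipow s)"
  proof (rule lincombs_mult[OF Ipow_pred_subset x(2) _ xs(2) u(1)])
    fix b assume b: "b \<in> Ipow_pred s"
    show "x \<otimes> b \<in> Ipow s"
    proof (cases s)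
      case 0 thus ?thesis using b x by (simp add: Ipow_pred_def Ipow_0)
    next
      case (Suc m)
      have "x \<in> Ipow 1" using x Ipow_1 by simp
      from Ipow_mult[OF this, of b m] show ?thesis using b Suc by (simp add: Ipow_pred_def)
    qed
  qed
  hence "c \<oplus> x \<otimes> u \<in> lincombs xs (Ipow s)"
    by (intro lincombs_add[OF Ipow_ops(1) _ xs(2) r(2)] Ipow_ops(3))
  moreover have e: "c \<oplus> x \<otimes> u = a \<ominus> x \<otimes> r'" unfolding r(3) u(3) using cc x uc by algebra
  moreover have "x \<otimes> r' \<in> Ipow (1 + Suc s)" using x Ipow_1 u(2) by (intro Ipow_mult) auto
  hence "a \<ominus> x \<otimes> r' \<in> Ipow (Suc (Suc s))" using Ipow_ops(4)[OF snoc.prems(4)] by simp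
  ultimately have "c \<oplus> x \<otimes> u \<in> lincombs xs (Ipow (Suc s))" using snoc.IH[OF xs(1) lf] by simp
  moreover have "a = (c \<oplus> x \<otimes> u) \<oplus> x \<otimes> r'" unfolding r(3) u(3) using cc x uc by algebra
  ultimately show ?case unfolding lincombs_snoc[OF Ipow_ops(1) xs(2) x(2)] using u(2) by blast
qed simp

text \<open>
  By Valabrega and Valla, regular leading forms give
  \<open>(xs) \<inter> I\<^bsup>n+1\<^esup> = (xs) I\<^sup>n\<close>. The coefficients are moved up one power of \<open>I\<close> at a time.
\<close>

lemma genideal_inter_Ipow:
  assumes xs: "set xs \<subseteq> I" and lf: "leading_forms_regular xs"
    and a: "a \<in> Idl (set xs)" "a \<in> Ipow (Suc n)"
  shows "a \<in> lincombs xs (Ipow n)"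
proof -
  have xsc: "set xs \<subseteq> carrier R" using xs ideal_ops(1)[OF I] by blast
  have "t \<le> n \<Longrightarrow> a \<in> lincombs xs (Ipow t)" for t
  proof (induction t)
    case 0 thus ?case using a(1) genideal_eq_lincombs[OF xsc] by (simp add: Ipow_0)
  next
    case (Suc t)
    have "a \<in> Ipow (Suc (Suc t))" using Ipow_antimono[of "Suc (Suc t)" "Suc n"] a(2) Suc.prems by auto
    thus ?case using lincombs_inter_Ipow_step[OF xs lf] Suc by simp
  qed
  thus ?thesis by simp
qed

end

section \<open>Forms of lowest degree in the powers of an equigenerated ideal\<close>

locale equigenerated = standard_graded_ring R k G + ring_with_ideal R I
  for R :: "('a, 'b) ring_scheme" (structure) and k and G and I +
  fixes d :: nat
  assumes equi: "equigenerated_ideal R G d I"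
begin

definition Ipiece :: "nat \<Rightarrow> 'a set" where "Ipiece n = Ipow n \<inter> G (n * d)"

lemma I_Rplus: "I \<subseteq> Rplus" using equi by (simp add: equigenerated_ideal_def)
lemma I_gen: "I = Idl (I \<inter> G d)" using equi by (simp add: equigenerated_ideal_def)
lemma Ipiece_Ipow: "a \<in> Ipiece n \<Longrightarrow> a \<in> Ipow n" by (simp add: Ipiece_def)
lemma Ipiece_G: "a \<in> Ipiece n \<Longrightarrow> a \<in> G (n * d)" by (simp add: Ipiece_def)
lemma Ipiece_carrier: "a \<in> Ipiece n \<Longrightarrow> a \<in> carrier R" using Ipiece_G by blast
lemma Ipiece_1: "Ipiece 1 = I \<inter> G d" by (simp add: Ipiece_def Ipow_1)

lemma Ipow_forms: "Ipow n = Idl (Ipiece n)"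
proof (induction n)
  case 0
  have c: "Ipiece 0 \<subseteq> carrier R" using Ipiece_carrier by blast
  have "\<one> \<in> Ipiece 0" by (simp add: Ipiece_def Ipow_0 one_G)
  hence "\<one> \<in> Idl (Ipiece 0)" using genideal_self[OF c] by blast
  thus ?case using ideal.one_imp_carrier[OF genideal_ideal[OF c]] Ipow_0 by simp
next
  case (Suc n)
  have c: "Ipiece (Suc n) \<subseteq> carrier R" using Ipiece_carrier by blast
  let ?T = "Idl (Ipiece (Suc n))"
  note T = genideal_ideal[OF c]
  note To = ideal_ops[OF T]
  have 1: "i \<otimes> j \<in> ?T" if "i \<in> Ipiece 1" "j \<in> Ipiece n" for i j
  proof -
    have "i \<otimes> j \<in> Ipow (1 + n)" using that by (intro Ipow_mult Ipiece_Ipow)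
    moreover have "i \<otimes> j \<in> G (1 * d + n * d)" using that by (intro piece_mult Ipiece_G)
    ultimately have "i \<otimes> j \<in> Ipiece (Suc n)" by (simp add: Ipiece_def)
    thus ?thesis using genideal_self[OF c] by blast
  qed
  have 2: "i \<otimes> j \<in> ?T" if i: "i \<in> Ipiece 1" and j: "j \<in> Ipow n" for i j
  proof -
    have ic: "i \<in> carrier R" using i by (rule Ipiece_carrier)
    have "ideal {j \<in> carrier R. i \<otimes> j \<in> ?T} R"
    proof (rule idealI_simple)
      fix a r assume a: "a \<in> {j \<in> carrier R. i \<otimes> j \<in> ?T}" and r: "r \<in> carrier R"
      have "i \<otimes> (r \<otimes> a) = r \<otimes> (i \<otimes> a)" using a r ic by (simp add: m_lcomm)
      thus "r \<otimes> a \<in> {j \<in> carrier R. i \<otimes> j \<in> ?T}" using To(6)[OF _ r] a r by simp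
    qed (use ic To(2,3) in \<open>auto simp: r_distr\<close>)
    hence "Idl (Ipiece n) \<subseteq> {j \<in> carrier R. i \<otimes> j \<in> ?T}"
      using 1[OF i] Ipiece_carrier by (intro genideal_minimal) auto
    thus ?thesis using j Suc.IH by blast
  qed
  have 3: "i \<otimes> j \<in> ?T" if i: "i \<in> I" and j: "j \<in> Ipow n" for i j
  proof -
    have jc: "j \<in> carrier R" using j Ipow_ops(8) by simp
    have "ideal {i \<in> carrier R. i \<otimes> j \<in> ?T} R"
    proof (rule idealI_simple)
      fix a r assume a: "a \<in> {i \<in> carrier R. i \<otimes> j \<in> ?T}" and r: "r \<in> carrier R"
      have "(r \<otimes> a) \<otimes> j = r \<otimes> (a \<otimes> j)" using a r jc by (simp add: m_assoc)
      thus "r \<otimes> a \<in> {i \<in> carrier R. i \<otimes> j \<in> ?T}" using To(6)[OF _ r] a r by simp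
    qed (use jc To(2,3) in \<open>auto simp: l_distr\<close>)
    hence "Idl (I \<inter> G d) \<subseteq> {i \<in> carrier R. i \<otimes> j \<in> ?T}"
      using 2[OF _ j] Ipiece_1 by (intro genideal_minimal) auto
    thus ?thesis using i I_gen by blast
  qed
  show ?case
  proof
    show "Ipow (Suc n) \<subseteq> ?T"
    proof
      fix a assume "a \<in> Ipow (Suc n)"
      hence "a \<in> ideal_prod R I (Ipow n)" by (simp add: Ipow_Suc)
      thus "a \<in> ?T" by (induction rule: ideal_prod.induct) (auto intro: 3 To(3))
    qed
    show "?T \<subseteq> Ipow (Suc n)" by (rule genideal_minimal[OF Ipow_ideal]) (auto simp: Ipiece_def)
  qed
qed

lemma Ipiece_sub: "Ipiece n \<subseteq> G (n * d)" by (auto simp: Ipiece_def)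

lemma Ipow_component: "a \<in> Ipow n \<Longrightarrow> component a i \<in> Ipow n"
  using genideal_of_forms(1)[OF Ipiece_sub, of a n i] Ipow_forms[of n] by simp

lemma Ipow_low: "a \<in> Ipow n \<Longrightarrow> i < n * d \<Longrightarrow> component a i = \<zero>"
  using genideal_of_forms(2)[OF Ipiece_sub, of a n i] Ipow_forms[of n] by simp

lemma component_Ipiece: "a \<in> Ipow n \<Longrightarrow> component a (n * d) \<in> Ipiece n"
  using Ipow_component component_spec(1)[OF Ipow_ops(8)] by (simp add: Ipiece_def)

lemma component_of_Ipiece: "a \<in> Ipiece n \<Longrightarrow> component a (n * d) = a"
  using component_homogeneous[OF Ipiece_G, of a n "n * d"] by simp

lemma Ipow_Suc_component: assumes "b \<in> Ipow (Suc n)" shows "component b (n * d) = \<zero>"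
proof (cases "d = 0")
  case False
  thus ?thesis using Ipow_low[OF assms, of "n * d"] by simp
next
  case True
  \<comment> \<open>Here \<open>I\<close> is generated by elements of \<open>k \<inter> R\<^sub>+ = {0}\<close>.\<close>
  have "I \<inter> G d \<subseteq> {\<zero>}"
    using I_Rplus True by (auto simp: irrelevant_ideal_eq component_homogeneous)
  hence "I \<subseteq> {\<zero>}" using I_gen genideal_minimal[OF zeroideal, of "I \<inter> G d"] by simp
  moreover have "b \<in> I" using assms Ipow_antimono[of 1 "Suc n"] Ipow_1 by auto
  ultimately show ?thesis by auto
qed

lemma Rplus_ideal: "ideal Rplus R" by (rule irrelevant_ideal_ideal)
lemma RI_ideal: "ideal (ideal_prod R Rplus (Ipow n)) R" by (rule ideal_prod_is_ideal[OF Rplus_ideal Ipow_ideal])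

text \<open>
  Together with \<open>Ipow_minus_component\<close> this identifies \<open>I\<^sup>n / R\<^sub>+ I\<^sup>n\<close> with \<open>[I\<^sup>n]\<^bsub>nd\<^esub>\<close>: the component of degree \<open>n d\<close> is
  the lowest possible one, and multiplication by \<open>R\<^sub>+\<close> raises degrees.
\<close>

lemma component_Rplus_prod:
  assumes "a \<in> ideal_prod R Rplus (Ipow n)" shows "component a (n * d) = \<zero>"
  using assms
proof (induction rule: ideal_prod.induct)
  case (prod x y)
  have x: "x \<in> carrier R" "component x 0 = \<zero>" using prod(1) by (auto simp: irrelevant_ideal_eq)
  have y: "y \<in> carrier R" using prod(2) Ipow_ops(8) by simp
  have "component (x \<otimes> y) (0 + n * d) = component x 0 \<otimes> component y (n * d)"
    using x y Ipow_low[OF prod(2)] by (intro component_mult_low) auto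
  thus ?case using x y by simp
next
  case (sum a b)
  thus ?case using ideal_ops(8)[OF RI_ideal] by (simp add: component_add)
qed

lemma Ipow_minus_component:
  assumes "a \<in> Ipow n" shows "a \<ominus> component a (n * d) \<in> ideal_prod R Rplus (Ipow n)"
proof -
  let ?L = "ideal_prod R Rplus (Ipow n)"
  note Lo = ideal_ops[OF RI_ideal[of n]]
  define T where "T = {a \<in> Ipow n. a \<ominus> component a (n * d) \<in> ?L}"
  have "ideal T R"
  proof (rule idealI_simple)
    show "T \<subseteq> carrier R" using Ipow_ops(8) by (auto simp: T_def)
    show "\<zero> \<in> T" using Ipow_ops(2) Lo(2) by (simp add: T_def a_minus_def)
    fix u assume u: "u \<in> T"
    hence uI: "u \<in> Ipow n" "u \<ominus> component u (n * d) \<in> ?L" by (auto simp: T_def)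
    have uc: "u \<in> carrier R" "component u (n * d) \<in> carrier R" using uI(1) Ipow_ops(8) by auto
    { fix v assume v: "v \<in> T"
      hence vI: "v \<in> Ipow n" "v \<ominus> component v (n * d) \<in> ?L" by (auto simp: T_def)
      have vc: "v \<in> carrier R" "component v (n * d) \<in> carrier R" using vI(1) Ipow_ops(8) by auto
      have "(u \<oplus> v) \<ominus> component (u \<oplus> v) (n * d) = (u \<ominus> component u (n * d)) \<oplus> (v \<ominus> component v (n * d))"
        unfolding component_add[OF uc(1) vc(1)] using uc vc by algebra
      thus "u \<oplus> v \<in> T" using Lo(3)[OF uI(2) vI(2)] Ipow_ops(3)[OF uI(1) vI(1)] by (simp add: T_def) }
    fix r assume r: "r \<in> carrier R"
    have r0: "component r 0 \<in> carrier R" using r by simp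
    have "component (r \<otimes> u) (0 + n * d) = component r 0 \<otimes> component u (n * d)"
      using r uc(1) Ipow_low[OF uI(1)] by (intro component_mult_low) auto
    hence e: "component (r \<otimes> u) (n * d) = component r 0 \<otimes> component u (n * d)" by simp
    have "(r \<otimes> u) \<ominus> component (r \<otimes> u) (n * d)
        = r \<otimes> (u \<ominus> component u (n * d)) \<oplus> (r \<ominus> component r 0) \<otimes> component u (n * d)"
      unfolding e using r r0 uc by algebra
    also have "\<dots> \<in> ?L"
    proof (rule Lo(3)[OF Lo(6)[OF uI(2) r]])
      have "r \<ominus> component r 0 \<in> Rplus"
        using r component_spec(1)[OF r, of 0] by (simp add: irrelevant_ideal_eq component_minus component_homogeneous)
      thus "(r \<ominus> component r 0) \<otimes> component u (n * d) \<in> ?L" by (rule ideal_prod.prod[OF _ Ipow_component[OF uI(1)]])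
    qed
    finally show "r \<otimes> u \<in> T" using Ipow_ops(6)[OF uI(1) r] by (simp add: T_def)
  qed
  moreover have "Ipiece n \<subseteq> T"
    using component_of_Ipiece Ipiece_carrier Lo(2) by (auto simp: T_def Ipiece_Ipow a_minus_def r_neg)
  ultimately have "Idl (Ipiece n) \<subseteq> T" by (rule genideal_minimal)
  thus ?thesis using assms Ipow_forms[of n] by (auto simp: T_def)
qed

section \<open>The special fiber as a standard graded ring\<close>

text \<open>
  The special fiber \<open>F\<close> is the quotient of the Rees algebra by \<open>fiber_ideal\<close>; \<open>cls a n\<close> is the class of \<open>a t\<^sup>n\<close> in \<open>F\<close>, and
  \<open>Fpiece n\<close> is the \<open>n\<close>-th graded piece, which is a copy of \<open>Ipiece n\<close>.
\<close>

definition fiber_ideal where "fiber_ideal = rees_extension R I Rplus"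
abbreviation F where "F \<equiv> Rees Quot fiber_ideal"
definition cls :: "'a \<Rightarrow> nat \<Rightarrow> (nat \<Rightarrow> 'a) set" where "cls a n = fiber_ideal +>\<^bsub>Rees\<^esub> up_monom R a n"
definition Fpiece :: "nat \<Rightarrow> (nat \<Rightarrow> 'a) set set" where "Fpiece n = (\<lambda>a. cls a n) ` Ipiece n"

lemma special_fiber_eq: "special_fiber R G I = F" by (simp add: special_fiber_def fiber_ideal_def)

lemma fiber_ideal_eq: "fiber_ideal = {p \<in> carrier Rees. \<forall>n. up_coeff R p n \<in> ideal_prod R Rplus (Ipow n)}"
  unfolding fiber_ideal_def by (rule rees_extension_eq[OF Rplus_ideal])

lemma fiber_ideal_ideal: "ideal fiber_ideal Rees" unfolding fiber_ideal_def by (rule rees_extension_ideal[OF Rplus_ideal])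

sublocale F: cring F by (rule ideal.quotient_is_cring[OF fiber_ideal_ideal A.is_cring])

sublocale proj: ring_hom_ring Rees F "(+>\<^bsub>Rees\<^esub>) fiber_ideal" by (rule ideal.rcos_ring_hom_ring[OF fiber_ideal_ideal])

lemma proj_eq_iff:
  "p \<in> carrier Rees \<Longrightarrow> q \<in> carrier Rees \<Longrightarrow> fiber_ideal +>\<^bsub>Rees\<^esub> p = fiber_ideal +>\<^bsub>Rees\<^esub> q \<longleftrightarrow> p \<ominus>\<^bsub>Rees\<^esub> q \<in> fiber_ideal"
  using A.quotient_eq_iff_same_a_r_cos[OF fiber_ideal_ideal] by blast

lemma F_carrierE:
  assumes "Y \<in> carrier F" obtains p where "p \<in> carrier Rees" "Y = fiber_ideal +>\<^bsub>Rees\<^esub> p"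
  using assms by (auto simp: FactRing_def A_RCOSETS_def')

lemma cls_closed: "a \<in> Ipow n \<Longrightarrow> cls a n \<in> carrier F"
  unfolding cls_def by (rule proj.hom_closed[OF monom_Rees])

lemma cls_add: "a \<in> Ipow n \<Longrightarrow> b \<in> Ipow n \<Longrightarrow> cls (a \<oplus> b) n = cls a n \<oplus>\<^bsub>F\<^esub> cls b n"
  unfolding cls_def using proj.hom_add[OF monom_Rees monom_Rees, of a n b n] monom_add_Rees[of a n b] by simp

lemma cls_mult: "a \<in> Ipow m \<Longrightarrow> b \<in> Ipow n \<Longrightarrow> cls (a \<otimes> b) (m + n) = cls a m \<otimes>\<^bsub>F\<^esub> cls b n"
  unfolding cls_def using proj.hom_mult[OF monom_Rees monom_Rees, of a m b n] monom_mult_Rees[of a m b n] by simp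

lemma cls_zero: "cls \<zero> n = \<zero>\<^bsub>F\<^esub>"
  unfolding cls_def using proj.hom_zero by simp

lemma cls_one: "cls \<one> 0 = \<one>\<^bsub>F\<^esub>"
  unfolding cls_def using proj.hom_one by simp

lemma cls_eq_iff:
  assumes "a \<in> Ipow n" "b \<in> Ipow n"
  shows "cls a n = cls b n \<longleftrightarrow> component a (n * d) = component b (n * d)"
proof -
  have ab: "a \<in> carrier R" "b \<in> carrier R" using assms Ipow_ops(8) by auto
  let ?p = "up_monom R a n \<ominus>\<^bsub>Rees\<^esub> up_monom R b n"
  have p: "?p \<in> carrier Rees" using assms monom_Rees by (intro A.minus_closed)
  have co: "up_coeff R ?p m = (if m = n then a \<ominus> b else \<zero>)" for m
    using Rees_minus[OF monom_Rees monom_Rees] assms ab by (simp add: a_minus_def r_neg)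
  have "cls a n = cls b n \<longleftrightarrow> ?p \<in> fiber_ideal" unfolding cls_def by (rule proj_eq_iff[OF monom_Rees monom_Rees]) fact+
  also have "\<dots> \<longleftrightarrow> a \<ominus> b \<in> ideal_prod R Rplus (Ipow n)"
    using p ideal_ops(2)[OF RI_ideal] by (auto simp: fiber_ideal_eq co)
  also have "\<dots> \<longleftrightarrow> component (a \<ominus> b) (n * d) = \<zero>"
  proof
    assume z: "component (a \<ominus> b) (n * d) = \<zero>"
    have "a \<ominus> b \<ominus> component (a \<ominus> b) (n * d) = a \<ominus> b" unfolding z using ab by algebra
    thus "a \<ominus> b \<in> ideal_prod R Rplus (Ipow n)"
      using Ipow_minus_component[OF Ipow_ops(4)[OF assms]] by simp
  qed (rule component_Rplus_prod)
  also have "\<dots> \<longleftrightarrow> component a (n * d) = component b (n * d)"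
  proof
    assume "component (a \<ominus> b) (n * d) = \<zero>"
    hence z: "component a (n * d) \<ominus> component b (n * d) = \<zero>" using ab by (simp add: component_minus)
    have "component a (n * d) = (component a (n * d) \<ominus> component b (n * d)) \<oplus> component b (n * d)"
      using component_closed[OF ab(1), of "n * d"] component_closed[OF ab(2), of "n * d"] by algebra
    thus "component a (n * d) = component b (n * d)" unfolding z using ab by simp
  next
    assume "component a (n * d) = component b (n * d)"
    thus "component (a \<ominus> b) (n * d) = \<zero>" using ab by (simp add: component_minus)
  qed
  finally show ?thesis .
qed

lemma cls_inj: "a \<in> Ipiece n \<Longrightarrow> b \<in> Ipiece n \<Longrightarrow> cls a n = cls b n \<Longrightarrow> a = b"
  using cls_eq_iff[OF Ipiece_Ipow Ipiece_Ipow] component_of_Ipiece by metis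

lemma Fpiece_closed: "Y \<in> Fpiece n \<Longrightarrow> Y \<in> carrier F" using cls_closed Ipiece_Ipow by (auto simp: Fpiece_def)

lemma Ipiece_add: "a \<in> Ipiece n \<Longrightarrow> b \<in> Ipiece n \<Longrightarrow> a \<oplus> b \<in> Ipiece n" using Ipow_ops(3) G_add by (simp add: Ipiece_def)
lemma Ipiece_zero: "\<zero> \<in> Ipiece n" using Ipow_ops(2) by (simp add: Ipiece_def)
lemma Ipiece_uminus: "a \<in> Ipiece n \<Longrightarrow> \<ominus> a \<in> Ipiece n" using Ipow_ops(5) G_uminus by (simp add: Ipiece_def)
lemma Ipiece_mult: "a \<in> Ipiece m \<Longrightarrow> b \<in> Ipiece n \<Longrightarrow> a \<otimes> b \<in> Ipiece (m + n)"
  using Ipow_mult[of a m b n] piece_mult[of a "m * d" b "n * d"] by (simp add: Ipiece_def add_mult_distrib)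

lemma Rees_with_coeffs:
  assumes "\<And>n. a n \<in> Ipow n"
  shows "\<exists>p\<in>carrier Rees. (\<forall>n. up_coeff R p n = (if n < N then a n else \<zero>)) \<and>
    fiber_ideal +>\<^bsub>Rees\<^esub> p = (\<Oplus>\<^bsub>F\<^esub>n\<in>{..<N}. cls (a n) n)"
proof (induction N)
  case 0
  show ?case using A.zero_closed proj.hom_zero by (intro bexI[of _ "\<zero>\<^bsub>Rees\<^esub>"]) auto
next
  case (Suc N)
  then obtain p where p: "p \<in> carrier Rees" "\<And>n. up_coeff R p n = (if n < N then a n else \<zero>)"
    "fiber_ideal +>\<^bsub>Rees\<^esub> p = (\<Oplus>\<^bsub>F\<^esub>n\<in>{..<N}. cls (a n) n)" by blast
  let ?m = "up_monom R (a N) N"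
  have m: "?m \<in> carrier Rees" by (rule monom_Rees[OF assms])
  have ac: "a n \<in> carrier R" for n using assms Ipow_ops(8) by blast
  have "fiber_ideal +>\<^bsub>Rees\<^esub> (?m \<oplus>\<^bsub>Rees\<^esub> p) = cls (a N) N \<oplus>\<^bsub>F\<^esub> (\<Oplus>\<^bsub>F\<^esub>n\<in>{..<N}. cls (a n) n)"
    using proj.hom_add[OF m p(1)] p(3) by (simp add: cls_def)
  also have "\<dots> = (\<Oplus>\<^bsub>F\<^esub>n\<in>{..<Suc N}. cls (a n) n)"
    unfolding lessThan_Suc using cls_closed[OF assms] by (subst F.finsum_insert) auto
  finally have 1: "fiber_ideal +>\<^bsub>Rees\<^esub> (?m \<oplus>\<^bsub>Rees\<^esub> p) = (\<Oplus>\<^bsub>F\<^esub>n\<in>{..<Suc N}. cls (a n) n)" .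
  have 2: "up_coeff R (?m \<oplus>\<^bsub>Rees\<^esub> p) n = (if n < Suc N then a n else \<zero>)" for n
    using p(1,2) Rees_closed m ac by (auto simp: less_Suc_eq)
  have "?m \<oplus>\<^bsub>Rees\<^esub> p \<in> carrier Rees" by (rule A.a_closed[OF m p(1)])
  thus ?case using 1 2 by blast
qed

lemma F_decompose:
  assumes "Y \<in> carrier F"
  shows "\<exists>a N. (\<forall>n. a n \<in> Ipiece n) \<and> (\<forall>n\<ge>N. a n = \<zero>) \<and> Y = (\<Oplus>\<^bsub>F\<^esub>n\<in>{..<N}. cls (a n) n)"
proof -
  obtain p where p: "p \<in> carrier Rees" "Y = fiber_ideal +>\<^bsub>Rees\<^esub> p" using assms by (rule F_carrierE)
  define a where "a n = component (up_coeff R p n) (n * d)" for n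
  define N where "N = Suc (deg R p)"
  have a: "a n \<in> Ipiece n" for n unfolding a_def by (rule component_Ipiece[OF Rees_coeff[OF p(1)]])
  have aN: "a n = \<zero>" if "n \<ge> N" for n
    using that U.deg_aboveD[of p n] Rees_closed[OF p(1)] by (simp add: a_def N_def)
  obtain q where q: "q \<in> carrier Rees" "\<And>n. up_coeff R q n = (if n < N then a n else \<zero>)"
    "fiber_ideal +>\<^bsub>Rees\<^esub> q = (\<Oplus>\<^bsub>F\<^esub>n\<in>{..<N}. cls (a n) n)" using Rees_with_coeffs[of a N] Ipiece_Ipow[OF a] by blast
  have q': "up_coeff R q n = a n" for n using q(2)[of n] aN[of n] by simp
  have "up_coeff R (p \<ominus>\<^bsub>Rees\<^esub> q) n \<in> ideal_prod R Rplus (Ipow n)" for n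
    unfolding Rees_minus[OF p(1) q(1)] q' a_def by (rule Ipow_minus_component[OF Rees_coeff[OF p(1)]])
  hence "p \<ominus>\<^bsub>Rees\<^esub> q \<in> fiber_ideal" using A.minus_closed[OF p(1) q(1)] unfolding fiber_ideal_eq by blast
  hence "Y = (\<Oplus>\<^bsub>F\<^esub>n\<in>{..<N}. cls (a n) n)" using proj_eq_iff[OF p(1) q(1)] p(2) q(3) by simp
  thus ?thesis using a aN by blast
qed

lemma F_decompose_unique:
  assumes a: "\<And>n. a n \<in> Ipiece n" and b: "\<And>n. b n \<in> Ipiece n"
    and eq: "(\<Oplus>\<^bsub>F\<^esub>n\<in>{..<N}. cls (a n) n) = (\<Oplus>\<^bsub>F\<^esub>n\<in>{..<N}. cls (b n) n)" and n: "n < N"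
  shows "a n = b n"
proof -
  obtain p where p: "p \<in> carrier Rees" "\<And>n. up_coeff R p n = (if n < N then a n else \<zero>)"
    "fiber_ideal +>\<^bsub>Rees\<^esub> p = (\<Oplus>\<^bsub>F\<^esub>n\<in>{..<N}. cls (a n) n)" using Rees_with_coeffs[of a N] Ipiece_Ipow[OF a] by blast
  obtain q where q: "q \<in> carrier Rees" "\<And>n. up_coeff R q n = (if n < N then b n else \<zero>)"
    "fiber_ideal +>\<^bsub>Rees\<^esub> q = (\<Oplus>\<^bsub>F\<^esub>n\<in>{..<N}. cls (b n) n)" using Rees_with_coeffs[of b N] Ipiece_Ipow[OF b] by blast
  have "p \<ominus>\<^bsub>Rees\<^esub> q \<in> fiber_ideal" using proj_eq_iff[OF p(1) q(1)] p(3) q(3) eq by simp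
  hence "up_coeff R (p \<ominus>\<^bsub>Rees\<^esub> q) n \<in> ideal_prod R Rplus (Ipow n)" by (simp add: fiber_ideal_eq)
  hence "a n \<ominus> b n \<in> ideal_prod R Rplus (Ipow n)" using Rees_minus[OF p(1) q(1)] p(2) q(2) n by simp
  hence "component (a n \<ominus> b n) (n * d) = \<zero>" by (rule component_Rplus_prod)
  moreover have c: "a n \<in> carrier R" "b n \<in> carrier R" using Ipiece_carrier[OF a] Ipiece_carrier[OF b] by auto
  ultimately have z: "a n \<ominus> b n = \<zero>"
    by (simp add: component_minus component_of_Ipiece[OF a] component_of_Ipiece[OF b])
  have "a n = (a n \<ominus> b n) \<oplus> b n" using c by algebra
  thus ?thesis unfolding z using c by simp
qed

lemma finsum_extend_cls:
  assumes c: "\<And>n. c n \<in> Fpiece n" and fin: "finite {n. c n \<noteq> \<zero>\<^bsub>F\<^esub>}"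
  shows "\<exists>N. \<forall>M\<ge>N. (\<Oplus>\<^bsub>F\<^esub>n\<in>{n. c n \<noteq> \<zero>\<^bsub>F\<^esub>}. c n) = (\<Oplus>\<^bsub>F\<^esub>n\<in>{..<M}. c n) \<and> (\<forall>n\<ge>N. c n = \<zero>\<^bsub>F\<^esub>)"
proof -
  obtain N where N: "{n. c n \<noteq> \<zero>\<^bsub>F\<^esub>} \<subseteq> {..<N}" using fin finite_nat_iff_bounded by blast
  hence z: "c n = \<zero>\<^bsub>F\<^esub>" if "n \<ge> N" for n using that by force
  have "(\<Oplus>\<^bsub>F\<^esub>n\<in>{n. c n \<noteq> \<zero>\<^bsub>F\<^esub>}. c n) = (\<Oplus>\<^bsub>F\<^esub>n\<in>{..<M}. c n)" if "M \<ge> N" for M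
    using N that Fpiece_closed[OF c] by (intro F.add.finprod_mono_neutral_cong_left) force+
  thus ?thesis using z by blast
qed

lemma F_direct_sum:
  assumes Y: "Y \<in> carrier F"
  shows "\<exists>!c. (\<forall>i. c i \<in> Fpiece i) \<and> finite {i. c i \<noteq> \<zero>\<^bsub>F\<^esub>} \<and> Y = (\<Oplus>\<^bsub>F\<^esub>i\<in>{i. c i \<noteq> \<zero>\<^bsub>F\<^esub>}. c i)"
proof (rule ex_ex1I)
  obtain a N where a: "\<And>n. a n \<in> Ipiece n" "\<And>n. n \<ge> N \<Longrightarrow> a n = \<zero>" "Y = (\<Oplus>\<^bsub>F\<^esub>n\<in>{..<N}. cls (a n) n)"
    using F_decompose[OF Y] by blast
  define c where "c n = cls (a n) n" for n
  have c: "c n \<in> Fpiece n" for n using a(1) by (auto simp: c_def Fpiece_def)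
  have s: "{n. c n \<noteq> \<zero>\<^bsub>F\<^esub>} \<subseteq> {..<N}"
  proof
    fix n assume n: "n \<in> {n. c n \<noteq> \<zero>\<^bsub>F\<^esub>}"
    have "n < N"
    proof (rule ccontr)
      assume "\<not> n < N"
      hence "c n = \<zero>\<^bsub>F\<^esub>" using a(2)[of n] cls_zero[of n] by (simp only: c_def not_less)
      thus False using n by simp
    qed
    thus "n \<in> {..<N}" by simp
  qed
  have "(\<Oplus>\<^bsub>F\<^esub>n\<in>{n. c n \<noteq> \<zero>\<^bsub>F\<^esub>}. c n) = (\<Oplus>\<^bsub>F\<^esub>n\<in>{..<N}. c n)"
    using s Fpiece_closed[OF c] by (intro F.add.finprod_mono_neutral_cong_left) auto
  hence "Y = (\<Oplus>\<^bsub>F\<^esub>i\<in>{i. c i \<noteq> \<zero>\<^bsub>F\<^esub>}. c i)" using a(3) by (simp add: c_def)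
  moreover have "finite {n. c n \<noteq> \<zero>\<^bsub>F\<^esub>}" using s finite_subset by blast
  ultimately show "\<exists>c. (\<forall>i. c i \<in> Fpiece i) \<and> finite {i. c i \<noteq> \<zero>\<^bsub>F\<^esub>} \<and> Y = (\<Oplus>\<^bsub>F\<^esub>i\<in>{i. c i \<noteq> \<zero>\<^bsub>F\<^esub>}. c i)"
    using c by blast
next
  fix c c' assume c: "(\<forall>i. c i \<in> Fpiece i) \<and> finite {i. c i \<noteq> \<zero>\<^bsub>F\<^esub>} \<and> Y = (\<Oplus>\<^bsub>F\<^esub>i\<in>{i. c i \<noteq> \<zero>\<^bsub>F\<^esub>}. c i)"
    and c': "(\<forall>i. c' i \<in> Fpiece i) \<and> finite {i. c' i \<noteq> \<zero>\<^bsub>F\<^esub>} \<and> Y = (\<Oplus>\<^bsub>F\<^esub>i\<in>{i. c' i \<noteq> \<zero>\<^bsub>F\<^esub>}. c' i)"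
  have "\<forall>i. \<exists>a. a \<in> Ipiece i \<and> c i = cls a i" using c by (auto simp: Fpiece_def)
  then obtain a where a: "\<And>i. a i \<in> Ipiece i" "\<And>i. c i = cls (a i) i" by metis
  have "\<forall>i. \<exists>a. a \<in> Ipiece i \<and> c' i = cls a i" using c' by (auto simp: Fpiece_def)
  then obtain b where b: "\<And>i. b i \<in> Ipiece i" "\<And>i. c' i = cls (b i) i" by metis
  obtain N where N: "\<And>M. M \<ge> N \<Longrightarrow> Y = (\<Oplus>\<^bsub>F\<^esub>n\<in>{..<M}. c n)" using finsum_extend_cls[of c] c by metis
  obtain N' where N': "\<And>M. M \<ge> N' \<Longrightarrow> Y = (\<Oplus>\<^bsub>F\<^esub>n\<in>{..<M}. c' n)" using finsum_extend_cls[of c'] c' by metis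
  show "c = c'"
  proof
    fix n
    define M where "M = Suc (n + N + N')"
    have "(\<Oplus>\<^bsub>F\<^esub>n\<in>{..<M}. c n) = (\<Oplus>\<^bsub>F\<^esub>n\<in>{..<M}. c' n)" using N[of M] N'[of M] by (simp add: M_def)
    hence "(\<Oplus>\<^bsub>F\<^esub>n\<in>{..<M}. cls (a n) n) = (\<Oplus>\<^bsub>F\<^esub>n\<in>{..<M}. cls (b n) n)" unfolding a(2) b(2) .
    from F_decompose_unique[of a b, OF a(1) b(1) this, of n] show "c n = c' n" using a(2) b(2) by (simp add: M_def)
  qed
qed

lemma lincombs_Ipiece:
  assumes fs: "set fs \<subseteq> I \<inter> G d" shows "lincombs fs (Ipiece n) \<subseteq> Ipiece (Suc n)"
  using fs
proof (induction fs)
  case (Cons f fs)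
  have "f \<otimes> b \<in> Ipiece (Suc n)" if "b \<in> Ipiece n" for b
    using Ipiece_mult[of f 1 b n] that Cons.prems Ipiece_1 by simp
  thus ?case using Cons Ipiece_add by auto
qed (simp add: Ipiece_zero)

lemma cls_lincombs:
  assumes fs: "set fs \<subseteq> I \<inter> G d"
  shows "a \<in> lincombs fs (Ipiece n) \<Longrightarrow> cls a (Suc n) \<in> F.lincombs (map (\<lambda>f. cls f 1) fs) (Fpiece n)"
  using fs
proof (induction fs arbitrary: a)
  case Nil thus ?case by (simp add: cls_zero)
next
  case (Cons f fs)
  then obtain b c where b: "b \<in> Ipiece n" "c \<in> lincombs fs (Ipiece n)" "a = f \<otimes> b \<oplus> c" by auto
  have f: "f \<in> Ipiece 1" using Cons.prems Ipiece_1 by simp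
  have c: "c \<in> Ipiece (Suc n)" using lincombs_Ipiece[of fs n] b(2) Cons.prems(2) by auto
  have fb: "f \<otimes> b \<in> Ipiece (1 + n)" by (rule Ipiece_mult[OF f b(1)])
  have "cls a (Suc n) = cls f 1 \<otimes>\<^bsub>F\<^esub> cls b n \<oplus>\<^bsub>F\<^esub> cls c (Suc n)"
    unfolding b(3) using cls_add[OF Ipiece_Ipow[OF fb], of c] cls_mult[OF Ipiece_Ipow[OF f] Ipiece_Ipow[OF b(1)]] Ipiece_Ipow[OF c] by simp
  moreover have "cls c (Suc n) \<in> F.lincombs (map (\<lambda>f. cls f 1) fs) (Fpiece n)" using Cons.IH[OF b(2)] Cons.prems(2) by simp
  moreover have "cls b n \<in> Fpiece n" using b(1) by (simp add: Fpiece_def)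
  ultimately show ?case by auto
qed

lemma lincombs_cls:
  assumes fs: "set fs \<subseteq> I \<inter> G d"
  shows "Y \<in> F.lincombs (map (\<lambda>f. cls f 1) fs) (Fpiece n) \<Longrightarrow> \<exists>a\<in>lincombs fs (Ipiece n). Y = cls a (Suc n)"
  using fs
proof (induction fs arbitrary: Y)
  case Nil thus ?case by (simp add: cls_zero)
next
  case (Cons f fs)
  then obtain B C where B: "B \<in> Fpiece n" "C \<in> F.lincombs (map (\<lambda>f. cls f 1) fs) (Fpiece n)" "Y = cls f 1 \<otimes>\<^bsub>F\<^esub> B \<oplus>\<^bsub>F\<^esub> C"
    by auto
  obtain b where b: "b \<in> Ipiece n" "B = cls b n" using B(1) by (auto simp: Fpiece_def)
  obtain c where c: "c \<in> lincombs fs (Ipiece n)" "C = cls c (Suc n)" using Cons.IH[OF B(2)] Cons.prems(2) by auto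
  have f: "f \<in> Ipiece 1" using Cons.prems Ipiece_1 by simp
  have cA: "c \<in> Ipiece (Suc n)" using lincombs_Ipiece[of fs n] c(1) Cons.prems(2) by auto
  have fb: "f \<otimes> b \<in> Ipiece (1 + n)" by (rule Ipiece_mult[OF f b(1)])
  have "Y = cls (f \<otimes> b \<oplus> c) (Suc n)"
    unfolding B(3) b(2) c(2) using cls_add[OF Ipiece_Ipow[OF fb], of c] cls_mult[OF Ipiece_Ipow[OF f] Ipiece_Ipow[OF b(1)]] Ipiece_Ipow[OF cA] by simp
  moreover have "f \<otimes> b \<oplus> c \<in> lincombs (f # fs) (Ipiece n)" using b(1) c(1) by auto
  ultimately show ?case by blast
qed

lemma ideal_prod_forms:
  assumes fs: "set fs \<subseteq> I \<inter> G d" and a: "a \<in> ideal_prod R (Idl (set fs)) (Ipow n)" "a \<in> Ipiece (Suc n)"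
  shows "a \<in> lincombs fs (Ipiece n)"
proof -
  have fsc: "set fs \<subseteq> carrier R" using fs G_carrier by blast
  have "a \<in> lincombs fs (Ipow n)" using ideal_prod_genideal_lincombs[OF fsc Ipow_ideal] a(1) by blast
  moreover have "a \<in> G (d + n * d)" using Ipiece_G[OF a(2)] by simp
  ultimately show ?thesis
    unfolding Ipiece_def using fs by (intro lincombs_homogeneous[OF Ipow_ops(1) Ipow_component]) auto
qed

text \<open>
  The Noetherian property provides finitely many generators of \<open>I\<close>, not necessarily forms, but each of them involves only finitely
  many of the generating forms of degree \<open>d\<close>.
\<close>

lemma finitely_many_generating_forms: "\<exists>fs. set fs \<subseteq> I \<inter> G d \<and> I = Idl (set fs)"
proof -
  have Bc: "B \<subseteq> carrier R" if "B \<subseteq> I \<inter> G d" for B using that G_carrier by blast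
  define T where "T = {a. \<exists>B. finite B \<and> B \<subseteq> I \<inter> G d \<and> a \<in> Idl B}"
  have TI: "a \<in> T" if "finite B" "B \<subseteq> I \<inter> G d" "a \<in> Idl B" for a B using that by (auto simp: T_def)
  have Ti: "ideal T R"
  proof (rule idealI_simple)
    show "T \<subseteq> carrier R" using ideal_ops(8)[OF genideal_ideal[OF Bc]] by (auto simp: T_def)
    show "\<zero> \<in> T" using TI[of "{}"] ideal_ops(2)[OF genideal_ideal[of "{}"]] by simp
    fix a assume "a \<in> T"
    then obtain B where B: "finite B" "B \<subseteq> I \<inter> G d" "a \<in> Idl B" by (auto simp: T_def)
    { fix b assume "b \<in> T"
      then obtain C where C: "finite C" "C \<subseteq> I \<inter> G d" "b \<in> Idl C" by (auto simp: T_def)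
      have u: "B \<union> C \<subseteq> I \<inter> G d" using B(2) C(2) by blast
      have "a \<in> Idl (B \<union> C)" "b \<in> Idl (B \<union> C)"
        using B(3) C(3) subset_Idl_subset[OF Bc[OF u], of B] subset_Idl_subset[OF Bc[OF u], of C] by auto
      hence "a \<oplus> b \<in> Idl (B \<union> C)" by (rule ideal_ops(3)[OF genideal_ideal[OF Bc[OF u]]])
      thus "a \<oplus> b \<in> T" using TI[OF _ u] B(1) C(1) by simp }
    fix r assume "r \<in> carrier R"
    thus "r \<otimes> a \<in> T" using TI[OF B(1,2)] ideal_ops(6)[OF genideal_ideal[OF Bc[OF B(2)]] B(3)] by simp
  qed
  have "I \<inter> G d \<subseteq> T"
  proof
    fix b assume b: "b \<in> I \<inter> G d"
    hence "b \<in> Idl {b}" using G_carrier by (intro genideal_self') auto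
    thus "b \<in> T" using TI[of "{b}"] b by simp
  qed
  hence IT: "I \<subseteq> T" using I_gen genideal_minimal[OF Ti, of "I \<inter> G d"] by simp
  obtain S where S: "S \<subseteq> carrier R" "finite S" "I = Idl S" using noetherian_ring.finetely_gen[OF noetherian I] by blast
  have "S \<subseteq> T" using IT S genideal_self[OF S(1)] by blast
  with S(2) have "\<exists>B. finite B \<and> B \<subseteq> I \<inter> G d \<and> S \<subseteq> Idl B"
  proof (induction S rule: finite_induct)
    case empty show ?case by (intro exI[of _ "{}"]) simp
  next
    case (insert s S)
    then obtain B where B: "finite B" "B \<subseteq> I \<inter> G d" "S \<subseteq> Idl B" by auto
    obtain C where C: "finite C" "C \<subseteq> I \<inter> G d" "s \<in> Idl C" using insert.prems by (auto simp: T_def)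
    have u: "B \<union> C \<subseteq> I \<inter> G d" using B(2) C(2) by blast
    have "insert s S \<subseteq> Idl (B \<union> C)"
      using B(3) C(3) subset_Idl_subset[OF Bc[OF u], of B] subset_Idl_subset[OF Bc[OF u], of C] by auto
    thus ?case using u B(1) C(1) by (intro exI[of _ "B \<union> C"]) simp
  qed
  then obtain B where B: "finite B" "B \<subseteq> I \<inter> G d" "S \<subseteq> Idl B" by blast
  have "I \<subseteq> Idl B" unfolding S(3) by (rule genideal_minimal[OF genideal_ideal[OF Bc[OF B(2)]] B(3)])
  moreover have "Idl B \<subseteq> I" using B(2) by (intro genideal_minimal[OF ring_with_ideal.I]) (auto intro: ring_with_ideal_axioms)
  moreover obtain fs where "set fs = B" using finite_list[OF B(1)] by blast
  ultimately show ?thesis using B(2) by (intro exI[of _ fs]) auto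
qed

text \<open>
  Since \<open>I\<^bsup>n+1\<^esup> = (f\<^sub>1, \<dots>, f\<^sub>m) I\<^sup>n\<close> for forms \<open>f\<^sub>i\<close> of degree \<open>d\<close> generating \<open>I\<close>, every form of degree
  \<open>(n + 1) d\<close> in \<open>I\<^bsup>n+1\<^esup>\<close> is a combination of the \<open>f\<^sub>i\<close> with coefficients in \<open>[I\<^sup>n]\<^bsub>nd\<^esub>\<close>.
\<close>

lemma F_generated: "\<exists>S. finite S \<and> S \<subseteq> Fpiece 1 \<and> generate_ring F (Fpiece 0 \<union> S) = carrier F"
proof -
  obtain fs where fs: "set fs \<subseteq> I \<inter> G d" "I = Idl (set fs)" using finitely_many_generating_forms by blast
  define S where "S = (\<lambda>f. cls f 1) ` set fs"
  have S: "finite S" "S \<subseteq> Fpiece 1" using fs(1) Ipiece_1 by (auto simp: S_def Fpiece_def)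
  define H where "H = generate_ring F (Fpiece 0 \<union> S)"
  have Hc: "Fpiece 0 \<union> S \<subseteq> carrier F" using S(2) Fpiece_closed by auto
  have H: "subring H F" unfolding H_def by (rule F.generate_ring_is_subring[OF Hc])
  have sub: "Fpiece 0 \<union> S \<subseteq> H" by (auto simp: H_def generate_ring.incl)
  have lin: "F.lincombs Ys B \<subseteq> H" if "set Ys \<subseteq> H" "B \<subseteq> H" for Ys B
    using that
  proof (induction Ys)
    case (Cons y Ys)
    have "y \<otimes>\<^bsub>F\<^esub> b \<in> H" if "b \<in> B" for b using subringE(6)[OF H, of y b] Cons.prems that by auto
    moreover have "F.lincombs Ys B \<subseteq> H" using Cons by auto
    ultimately show ?case using subringE(7)[OF H] by auto
  qed (use subringE(2)[OF H] in simp)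
  have piece: "Fpiece n \<subseteq> H" for n
  proof (induction n)
    case 0 show ?case using sub by blast
  next
    case (Suc n)
    have "cls a (Suc n) \<in> H" if a: "a \<in> Ipiece (Suc n)" for a
    proof -
      have "a \<in> ideal_prod R (Idl (set fs)) (Ipow n)" using Ipiece_Ipow[OF a] Ipow_Suc[of n] fs(2) by simp
      hence "a \<in> lincombs fs (Ipiece n)" by (rule ideal_prod_forms[OF fs(1) _ a])
      hence "cls a (Suc n) \<in> F.lincombs (map (\<lambda>f. cls f 1) fs) (Fpiece n)" by (rule cls_lincombs[OF fs(1)])
      moreover have "set (map (\<lambda>f. cls f 1) fs) \<subseteq> H" using sub by (auto simp: S_def)
      ultimately show ?thesis using lin[OF _ Suc.IH] by blast
    qed
    thus ?case by (auto simp: Fpiece_def)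
  qed
  have "carrier F \<subseteq> H"
  proof
    fix Y assume "Y \<in> carrier F"
    then obtain a N where a: "\<And>n. a n \<in> Ipiece n" "Y = (\<Oplus>\<^bsub>F\<^esub>n\<in>{..<N}. cls (a n) n)" using F_decompose by blast
    have "(\<Oplus>\<^bsub>F\<^esub>n\<in>{..<N}. cls (a n) n) \<in> H"
    proof (rule F.finsum_in_subset)
      show "cls (a n) n \<in> H" for n using piece[of n] a(1)[of n] by (auto simp: Fpiece_def)
    qed (use subringE[OF H] in auto)
    thus "Y \<in> H" using a(2) by simp
  qed
  moreover have "H \<subseteq> carrier F" by (rule subringE(1)[OF H])
  ultimately show ?thesis using S unfolding H_def by blast
qed

lemma Fpiece_0: "Fpiece 0 = (\<lambda>c. cls c 0) ` k"
  by (simp add: Fpiece_def Ipiece_def Ipow_0 degree_zero Int_absorb1[OF k_carrier])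

lemma F_subfield: "subfield (Fpiece 0) F"
proof -
  have "(\<lambda>c. cls c 0) \<in> ring_hom R F"
    using cls_closed[of _ 0] cls_mult[of _ 0 _ 0] cls_add[of _ 0] cls_one
    by (intro ring_hom_memI) (auto simp: Ipow_0)
  hence h: "ring_hom_ring R F (\<lambda>c. cls c 0)" by (intro ring_hom_ringI2 ring_axioms F.ring_axioms)
  have "cls \<one> 0 \<noteq> cls \<zero> 0"
    using cls_inj[of \<one> 0 \<zero>] one_not_zero one_G Ipiece_zero by (auto simp: Ipiece_def Ipow_0)
  hence "\<one>\<^bsub>F\<^esub> \<noteq> \<zero>\<^bsub>F\<^esub>" by (simp only: cls_one cls_zero not_False_eq_True)
  thus ?thesis unfolding Fpiece_0 by (rule ring_hom_ring.img_is_subfield(2)[OF h subfield_k])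
qed

lemma F_piece_subgroup: "additive_subgroup (Fpiece n) F"
proof (rule additive_subgroup.intro, rule F.add.subgroupI)
  show "Fpiece n \<subseteq> carrier F" using Fpiece_closed by auto
  show "Fpiece n \<noteq> {}" using Ipiece_zero by (auto simp: Fpiece_def)
  fix A assume "A \<in> Fpiece n"
  then obtain a where a: "a \<in> Ipiece n" "A = cls a n" by (auto simp: Fpiece_def)
  have "cls (\<ominus> a) n \<oplus>\<^bsub>F\<^esub> cls a n = \<zero>\<^bsub>F\<^esub>"
    using cls_add[OF Ipiece_Ipow[OF Ipiece_uminus[OF a(1)]] Ipiece_Ipow[OF a(1)]] Ipiece_carrier[OF a(1)] by (simp add: l_neg cls_zero)
  hence "\<ominus>\<^bsub>F\<^esub> A = cls (\<ominus> a) n"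
    unfolding a(2) using cls_closed Ipiece_Ipow Ipiece_uminus a(1) by (intro F.minus_equality) auto
  thus "\<ominus>\<^bsub>F\<^esub> A \<in> Fpiece n" using Ipiece_uminus[OF a(1)] by (simp add: Fpiece_def)
  fix B assume "B \<in> Fpiece n"
  then obtain b where b: "b \<in> Ipiece n" "B = cls b n" by (auto simp: Fpiece_def)
  have "A \<oplus>\<^bsub>F\<^esub> B = cls (a \<oplus> b) n" using cls_add[OF Ipiece_Ipow[OF a(1)] Ipiece_Ipow[OF b(1)]] a(2) b(2) by simp
  thus "A \<oplus>\<^bsub>F\<^esub> B \<in> Fpiece n" using Ipiece_add[OF a(1) b(1)] by (simp add: Fpiece_def)
qed

lemma F_standard_graded: "standard_graded_ring F (Fpiece 0) Fpiece"
proof (intro standard_graded_ring.intro standard_graded_ring_axioms.intro)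
  show "cring F" by (rule F.is_cring)
  show "subfield (Fpiece 0) F" by (rule F_subfield)
  show "additive_subgroup (Fpiece i) F" for i by (rule F_piece_subgroup)
  show "Y \<otimes>\<^bsub>F\<^esub> Z \<in> Fpiece (i + j)" if YZ: "Y \<in> Fpiece i" "Z \<in> Fpiece j" for Y Z i j
  proof -
    obtain a where a: "a \<in> Ipiece i" "Y = cls a i" using YZ(1) by (auto simp: Fpiece_def)
    obtain b where b: "b \<in> Ipiece j" "Z = cls b j" using YZ(2) by (auto simp: Fpiece_def)
    note ab = a b
    hence "Y \<otimes>\<^bsub>F\<^esub> Z = cls (a \<otimes> b) (i + j)" using cls_mult[OF Ipiece_Ipow[OF ab(1)] Ipiece_Ipow[OF ab(3)]] by simp
    thus ?thesis using Ipiece_mult[OF ab(1,3)] by (simp add: Fpiece_def)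
  qed
  show "\<exists>!c. (\<forall>i. c i \<in> Fpiece i) \<and> finite {i. c i \<noteq> \<zero>\<^bsub>F\<^esub>} \<and> Y = (\<Oplus>\<^bsub>F\<^esub>i\<in>{i. c i \<noteq> \<zero>\<^bsub>F\<^esub>}. c i)"
    if "Y \<in> carrier F" for Y by (rule F_direct_sum[OF that])
  show "\<exists>S. finite S \<and> S \<subseteq> Fpiece 1 \<and> generate_ring F (Fpiece 0 \<union> S) = carrier F" by (rule F_generated)
qed simp

sublocale SF: standard_graded_ring F "Fpiece 0" Fpiece by (rule F_standard_graded)

section \<open>Regularity in the special fiber\<close>

lemma cls_mem_genideal_iff:
  assumes fs: "set fs \<subseteq> I \<inter> G d" and a: "a \<in> Ipiece (Suc n)"
  shows "cls a (Suc n) \<in> genideal F ((\<lambda>f. cls f 1) ` set fs) \<longleftrightarrow> a \<in> lincombs fs (Ipiece n)"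
proof
  have m: "(\<lambda>f. cls f 1) ` set fs = set (map (\<lambda>f. cls f 1) fs)" by simp
  have xs: "set (map (\<lambda>f. cls f 1) fs) \<subseteq> Fpiece 1" using fs Ipiece_1 by (auto simp: Fpiece_def)
  have xsc: "set (map (\<lambda>f. cls f 1) fs) \<subseteq> carrier F" using xs Fpiece_closed by blast
  {
    assume "cls a (Suc n) \<in> genideal F ((\<lambda>f. cls f 1) ` set fs)"
    moreover have "cls a (Suc n) \<in> Fpiece (Suc n)" using a by (simp add: Fpiece_def)
    ultimately have "cls a (Suc n) \<in> F.lincombs (map (\<lambda>f. cls f 1) fs) (Fpiece n)"
      unfolding m by (intro SF.genideal_homogeneous[OF xs])
    then obtain b where b: "b \<in> lincombs fs (Ipiece n)" "cls a (Suc n) = cls b (Suc n)" using lincombs_cls[OF fs] by blast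
    have "b \<in> Ipiece (Suc n)" using lincombs_Ipiece[OF fs] b(1) by blast
    thus "a \<in> lincombs fs (Ipiece n)" using cls_inj[OF a _ b(2)] b(1) by simp
  }
  assume "a \<in> lincombs fs (Ipiece n)"
  hence "cls a (Suc n) \<in> F.lincombs (map (\<lambda>f. cls f 1) fs) (Fpiece n)" by (rule cls_lincombs[OF fs])
  thus "cls a (Suc n) \<in> genideal F ((\<lambda>f. cls f 1) ` set fs)"
    unfolding m using F.lincombs_subset_genideal[OF xsc, of "Fpiece n"] Fpiece_closed by blast
qed

lemma lincombs_singleton_zero: "set xs \<subseteq> carrier R \<Longrightarrow> lincombs xs {\<zero>} = {\<zero>}"
  by (induction xs) auto

text \<open>
  It suffices to test forms \<open>a \<in> [I\<^sup>m]\<^bsub>md\<^esub>\<close>. Regularity of the leading forms gives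
  \<open>a \<in> (f\<^sub>1, \<dots>, f\<^bsub>i-1\<^esub>) I\<^bsup>m-1\<^esup> + I\<^bsup>m+1\<^esup>\<close>. In degree \<open>m d\<close> the second summand vanishes, because
  \<open>I\<^bsup>m+1\<^esup>\<close> starts in degree \<open>(m + 1) d\<close>.
\<close>

lemma regular_mod_cls:
  assumes xs: "set xs \<subseteq> I \<inter> G d" and lf: "leading_forms_regular xs"
  shows "F.regular_mod {\<zero>\<^bsub>F\<^esub>} (map (\<lambda>f. cls f 1) xs)"
  unfolding F.regular_mod_iff_nth
proof (intro allI impI)
  fix i assume i0: "i < length (map (\<lambda>f. cls f 1) xs)"
  hence i: "i < length xs" by simp
  let ?ys = "take i xs"
  have ys: "set ?ys \<subseteq> I \<inter> G d" using xs set_take_subset[of i xs] by blast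
  have ysc: "set ?ys \<subseteq> carrier R" using ys G_carrier by blast
  have f: "xs ! i \<in> Ipiece 1" using xs i Ipiece_1 by auto
  have YG: "set (map (\<lambda>f. cls f 1) ?ys) \<subseteq> Fpiece 1" using ys Ipiece_1 by (auto simp: Fpiece_def)
  have YC: "set (map (\<lambda>f. cls f 1) ?ys) \<subseteq> carrier F" using YG Fpiece_closed by blast
  have Q: "F.adjoin_list {\<zero>\<^bsub>F\<^esub>} (take i (map (\<lambda>f. cls f 1) xs)) = genideal F ((\<lambda>f. cls f 1) ` set ?ys)"
    using F.adjoin_list_zero[OF YC] by (simp add: take_map)
  have hom: "SF.homogeneous (F.adjoin_list {\<zero>\<^bsub>F\<^esub>} (take i (map (\<lambda>f. cls f 1) xs)))"
    unfolding take_map using YG by (intro SF.homogeneous_adjoin_list SF.homogeneous_zero) auto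
  have "F.nonzerodivisor_mod (F.adjoin_list {\<zero>\<^bsub>F\<^esub>} (take i (map (\<lambda>f. cls f 1) xs))) (cls (xs ! i) 1)"
  proof (rule SF.homogeneous_nonzerodivisor_modI[OF hom])
    show "cls (xs ! i) 1 \<in> Fpiece 1" using f by (auto simp: Fpiece_def)
    fix m Y assume "Y \<in> Fpiece m" and mem: "cls (xs ! i) 1 \<otimes>\<^bsub>F\<^esub> Y \<in> F.adjoin_list {\<zero>\<^bsub>F\<^esub>} (take i (map (\<lambda>f. cls f 1) xs))"
    then obtain a where a: "a \<in> Ipiece m" "Y = cls a m" by (auto simp: Fpiece_def)
    have fa: "xs ! i \<otimes> a \<in> Ipiece (Suc m)" using Ipiece_mult[OF f a(1)] by simp
    have "cls (xs ! i \<otimes> a) (Suc m) = cls (xs ! i) 1 \<otimes>\<^bsub>F\<^esub> Y"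
      using cls_mult[OF Ipiece_Ipow[OF f] Ipiece_Ipow[OF a(1)]] a(2) by simp
    hence "xs ! i \<otimes> a \<in> lincombs ?ys (Ipiece m)" using mem cls_mem_genideal_iff[OF ys fa] unfolding Q by simp
    hence c: "xs ! i \<otimes> a \<in> lincombs ?ys (Ipow m)" using lincombs_mono[of "Ipiece m" "Ipow m" ?ys] Ipiece_Ipow by blast
    have "xs ! i \<otimes> a = xs ! i \<otimes> a \<oplus> \<zero>" using Ipiece_carrier[OF fa] by simp
    from lf[unfolded leading_forms_regular_def, rule_format, OF i Ipiece_Ipow[OF a(1)] c Ipow_ops(2) this]
    obtain c' b' where cb: "c' \<in> lincombs ?ys (Ipow_pred m)" "b' \<in> Ipow (Suc m)" "a = c' \<oplus> b'" by blast
    have cc: "c' \<in> carrier R" "b' \<in> carrier R"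
      using cb(1,2) lincombs_carrier[OF ysc Ipow_pred_subset] Ipow_ops(8) by auto
    have "a = component (c' \<oplus> b') (m * d)" using component_of_Ipiece[OF a(1)] cb(3) by simp
    also have "\<dots> = component c' (m * d)"
      using cc Ipow_Suc_component[OF cb(2)] by (simp add: component_add)
    finally have ac: "a = component c' (m * d)" .
    show "Y \<in> F.adjoin_list {\<zero>\<^bsub>F\<^esub>} (take i (map (\<lambda>f. cls f 1) xs))"
    proof (cases m)
      case 0
      hence "a = \<zero>" using ac cb(1) lincombs_singleton_zero[OF ysc] by (simp add: Ipow_pred_def)
      thus ?thesis unfolding a(2) using F.ideal_ops(2)[OF SF.homogeneous_ideal_of[OF hom]] cls_zero by simp
    next
      case (Suc m')
      have ysG: "set ?ys \<subseteq> G d" using ys by blast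
      have "c' \<in> lincombs ?ys (Ipow m')" using cb(1) Suc by (simp add: Ipow_pred_def)
      from component_lincombs[OF Ipow_ops(1) Ipow_component ysG this, of "m' * d"]
      have "a \<in> lincombs ?ys (Ipiece m')" using ac Suc by (simp add: Ipiece_def)
      thus ?thesis unfolding a(2) Q using cls_mem_genideal_iff[OF ys, of a m'] a(1) Suc by simp
    qed
  qed
  thus "F.nonzerodivisor_mod (F.adjoin_list {\<zero>\<^bsub>F\<^esub>} (take i (map (\<lambda>f. cls f 1) xs))) (map (\<lambda>f. cls f 1) xs ! i)"
    using i by simp
qed

lemma reduction_eventually:
  assumes "reduction R J I"
  shows "\<exists>N. \<forall>m\<ge>N. Ipow (Suc m) = ideal_prod R J (Ipow m)"
proof -
  obtain N where J: "ideal J R" and N: "Ipow (Suc N) = ideal_prod R J (Ipow N)"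
    using assms by (auto simp: reduction_def Ipow_def)
  have "Ipow (Suc m) = ideal_prod R J (Ipow m)" if "m \<ge> N" for m
    using that
  proof (induction m rule: dec_induct)
    case base show ?case by (rule N)
  next
    case (step m)
    have "Ipow (Suc (Suc m)) = ideal_prod R I (ideal_prod R J (Ipow m))" using Ipow_Suc[of "Suc m"] step.IH by simp
    also have "\<dots> = ideal_prod R J (ideal_prod R I (Ipow m))"
      using ideal_prod_assoc[OF I J Ipow_ideal] ideal_prod_assoc[OF J I Ipow_ideal] ideal_prod_commute[OF I J] by simp
    finally show ?case using Ipow_Suc[of m] by simp
  qed
  thus ?thesis by blast
qed

text \<open>
  The condition on the left is analytic tightness. In each degree \<open>n \<ge> 1\<close> of the special fiber it says that the class of \<open>f\<close> is a
  nonzerodivisor modulo the classes of \<open>xs\<close>; the translation is the fact \<open>mem\<close>, which rests on the Valabrega--Valla property.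
  In degree zero the pieces are scalars, and the class of \<open>f\<close> is outside the ideal because it is not even nilpotent modulo it.
\<close>

theorem tight_iff_cohen_macaulay:
  assumes inf: "infinite k" and xs: "set xs \<subseteq> I \<inter> G d" and f: "f \<in> I \<inter> G d"
    and lf: "leading_forms_regular xs" and red: "reduction R (Idl (insert f (set xs))) I"
    and dim: "krull_dim F = enat (Suc (length xs))"
  shows "(\<forall>n\<ge>1. \<forall>a\<in>Ipiece n. a \<otimes> f \<in> Idl (set xs) \<longrightarrow> a \<in> Idl (set xs)) \<longleftrightarrow> cohen_macaulay F"
proof -
  let ?Y = "map (\<lambda>f. cls f 1) xs" and ?y = "cls f 1"
  let ?Q = "genideal F ((\<lambda>f. cls f 1) ` set xs)"
  have fA: "f \<in> Ipiece 1" using f Ipiece_1 by simp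
  have xsc: "set xs \<subseteq> carrier R" using xs G_carrier by blast
  have fc: "f \<in> carrier R" using fA by (rule Ipiece_carrier)
  have Y: "set ?Y \<subseteq> Fpiece 1" using xs Ipiece_1 by (auto simp: Fpiece_def)
  have y: "?y \<in> Fpiece 1" using fA by (simp add: Fpiece_def)
  have YC: "set ?Y \<subseteq> carrier F" using Y Fpiece_closed by blast
  have Q: "F.adjoin_list {\<zero>\<^bsub>F\<^esub>} ?Y = ?Q" using F.adjoin_list_zero[OF YC] by simp
  have reg: "F.regular_mod {\<zero>\<^bsub>F\<^esub>} ?Y" by (rule regular_mod_cls[OF xs lf])
  obtain N where N: "\<And>m. m \<ge> N \<Longrightarrow> Ipow (Suc m) = ideal_prod R (Idl (insert f (set xs))) (Ipow m)"
    using reduction_eventually[OF red] by blast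
  have big: "Fpiece m \<subseteq> genideal F (insert ?y (set ?Y))" if mN: "m \<ge> Suc N" for m
  proof
    fix Z assume "Z \<in> Fpiece m"
    then obtain a where a: "a \<in> Ipiece m" "Z = cls a m" by (auto simp: Fpiece_def)
    obtain m' where m'S: "m = Suc m'" using mN by (cases m) auto
    have m': "m = Suc m'" "m' \<ge> N" using m'S mN by simp_all
    have fs: "set (f # xs) \<subseteq> I \<inter> G d" using xs f by simp
    have "a \<in> ideal_prod R (Idl (set (f # xs))) (Ipow m')" using N[OF m'(2)] Ipiece_Ipow[OF a(1)] m'(1) by simp
    hence "a \<in> lincombs (f # xs) (Ipiece m')" using a(1) m'(1) by (intro ideal_prod_forms[OF fs]) auto
    hence "Z \<in> genideal F ((\<lambda>f. cls f 1) ` set (f # xs))"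
      using cls_mem_genideal_iff[OF fs, of a m'] a m'(1) by simp
    thus "Z \<in> genideal F (insert ?y (set ?Y))" by simp
  qed
  have infF: "infinite (Fpiece 0)"
  proof
    assume "finite (Fpiece 0)"
    moreover have "inj_on (\<lambda>c. cls c 0) k"
      using cls_inj[of _ 0] k_carrier by (intro inj_onI) (auto simp: Ipiece_def Ipow_0 degree_zero)
    ultimately show False using inf unfolding Fpiece_0 by (simp add: finite_image_iff)
  qed
  have dim': "krull_dim F = enat (Suc (length ?Y))" using dim by simp
  have mem: "cls a (Suc n) \<in> ?Q \<longleftrightarrow> a \<in> Idl (set xs)" if a: "a \<in> Ipiece (Suc n)" for a n
  proof -
    have "a \<in> lincombs xs (Ipiece n) \<longleftrightarrow> a \<in> Idl (set xs)"
    proof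
      assume "a \<in> lincombs xs (Ipiece n)"
      thus "a \<in> Idl (set xs)" using lincombs_subset_genideal[OF xsc, of "Ipiece n"] Ipiece_carrier by blast
    next
      assume "a \<in> Idl (set xs)"
      hence "a \<in> lincombs xs (Ipow n)" using xs by (intro genideal_inter_Ipow[OF _ lf _ Ipiece_Ipow[OF a]]) auto
      moreover have "a \<in> G (d + n * d)" using Ipiece_G[OF a] by simp
      ultimately show "a \<in> lincombs xs (Ipiece n)"
        unfolding Ipiece_def using xs by (intro lincombs_homogeneous[OF Ipow_ops(1) Ipow_component]) auto
    qed
    thus ?thesis using cls_mem_genideal_iff[OF xs a] by simp
  qed
  have mult: "?y \<otimes>\<^bsub>F\<^esub> cls a n = cls (a \<otimes> f) (Suc n)" "a \<otimes> f \<in> Ipiece (Suc n)" if a: "a \<in> Ipiece n" for a n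
    using cls_mult[OF Ipiece_Ipow[OF fA] Ipiece_Ipow[OF a]] Ipiece_mult[OF fA a] Ipiece_carrier[OF a] fc by (simp_all add: m_comm)
  have hom: "SF.homogeneous ?Q"
    unfolding Q[symmetric] using Y by (intro SF.homogeneous_adjoin_list SF.homogeneous_zero) auto
  note Qo = F.ideal_ops[OF SF.homogeneous_ideal_of[OF hom]]
  have "(\<forall>n\<ge>1. \<forall>a\<in>Ipiece n. a \<otimes> f \<in> Idl (set xs) \<longrightarrow> a \<in> Idl (set xs)) \<longleftrightarrow> F.nonzerodivisor_mod ?Q ?y"
  proof
    assume t: "\<forall>n\<ge>1. \<forall>a\<in>Ipiece n. a \<otimes> f \<in> Idl (set xs) \<longrightarrow> a \<in> Idl (set xs)"
    show "F.nonzerodivisor_mod ?Q ?y"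
    proof (rule SF.homogeneous_nonzerodivisor_modI[OF hom y])
      fix m Z assume "Z \<in> Fpiece m" and yZ: "?y \<otimes>\<^bsub>F\<^esub> Z \<in> ?Q"
      then obtain a where a: "a \<in> Ipiece m" "Z = cls a m" by (auto simp: Fpiece_def)
      show "Z \<in> ?Q"
      proof (cases m)
        case (Suc n)
        have "a \<otimes> f \<in> Idl (set xs)" using mem[OF mult(2)[OF a(1)]] mult(1)[OF a(1)] yZ a(2) by simp
        hence "a \<in> Idl (set xs)" using t a(1) Suc by auto
        thus ?thesis using mem[of a n] a Suc by simp
      next
        case 0
        have Zk: "Z \<in> Fpiece 0" using a 0 by (simp add: Fpiece_def)
        have ynQ: "?y \<notin> ?Q"
        proof -
          have "?y [^]\<^bsub>F\<^esub> (1::nat) \<notin> ?Q" using SF.pow_notin_Qxs[OF Y y reg big dim'] unfolding Q .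
          thus ?thesis using F.nat_pow_eone[OF Fpiece_closed[OF y]] by simp
        qed
        have "Z = \<zero>\<^bsub>F\<^esub>"
        proof (rule ccontr)
          assume "Z \<noteq> \<zero>\<^bsub>F\<^esub>"
          hence "Z \<in> Fpiece 0 - {\<zero>\<^bsub>F\<^esub>}" using Zk by simp
          from F.subfield_m_inv[OF F_subfield this]
          have inv: "inv\<^bsub>F\<^esub> Z \<in> carrier F" "Z \<otimes>\<^bsub>F\<^esub> inv\<^bsub>F\<^esub> Z = \<one>\<^bsub>F\<^esub>" using Fpiece_closed by auto
          have "(?y \<otimes>\<^bsub>F\<^esub> Z) \<otimes>\<^bsub>F\<^esub> inv\<^bsub>F\<^esub> Z \<in> ?Q" by (rule Qo(7)[OF yZ inv(1)])
          hence "?y \<in> ?Q" using inv Fpiece_closed[OF y] Fpiece_closed[OF Zk] by (simp add: F.m_assoc)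
          thus False using ynQ by simp
        qed
        thus ?thesis using Qo(2) by simp
      qed
    qed
  next
    assume nz: "F.nonzerodivisor_mod ?Q ?y"
    show "\<forall>n\<ge>1. \<forall>a\<in>Ipiece n. a \<otimes> f \<in> Idl (set xs) \<longrightarrow> a \<in> Idl (set xs)"
    proof (intro allI impI ballI)
      fix n a assume n: "(1::nat) \<le> n" and a: "a \<in> Ipiece n" "a \<otimes> f \<in> Idl (set xs)"
      obtain m where m: "n = Suc m" using n by (cases n) auto
      have "?y \<otimes>\<^bsub>F\<^esub> cls a n \<in> ?Q" using mem[OF mult(2)[OF a(1)]] a(2) mult(1)[OF a(1)] by simp
      hence "cls a n \<in> ?Q" using nz cls_closed[OF Ipiece_Ipow[OF a(1)]] unfolding F.nonzerodivisor_mod_def by blast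
      thus "a \<in> Idl (set xs)" using mem[of a m] a(1) m by simp
    qed
  qed
  also have "\<dots> \<longleftrightarrow> cohen_macaulay F"
    using SF.cohen_macaulay_iff_nonzerodivisor[OF Y y reg big infF dim'] unfolding Q by simp
  finally show ?thesis .
qed

end

section \<open>Analytic tightness and the Cohen--Macaulay property\<close>

theorem theorem2p13:
  fixes R :: "('a, 'b) ring_scheme" (structure)
    and k :: "'a set" and G :: "nat \<Rightarrow> 'a set"
    and I :: "'a set" and d g :: nat and fs :: "'a list"
  assumes "standard_graded_ring R k G" and "infinite k"
    and "equigenerated_ideal R G d I"
    and "ideal_height R I = enat g"
    and "analytic_deviation R G I = 1"
    and "length fs = g + 1" and "set fs \<subseteq> I \<inter> G d"
    and "regular_sequence (associated_graded_ring R I) (map (degree_one_class R I) (take g fs))"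
    and "reduction R (genideal R (set fs)) I"
  shows "analytically_tight R G d I fs \<longleftrightarrow> cohen_macaulay (special_fiber R G I)"
proof -
  have cr: "cring R" by (rule standard_graded_ring.axioms(1)[OF assms(1)])
  have "ideal I R" using assms(3) unfolding equigenerated_ideal_def homogeneous_ideal_def by (elim conjE)
  hence "ring_with_ideal R I" by (intro ring_with_ideal.intro ring_with_ideal_axioms.intro cr)
  hence "equigenerated R k G I d"
    by (intro equigenerated.intro equigenerated_axioms.intro assms(1,3))
  then interpret equigenerated R k G I d .
  define xs where "xs = take g fs"
  define f where "f = last fs"
  have "fs \<noteq> []" using assms(6) by auto
  hence fs: "fs = xs @ [f]" using assms(6) append_butlast_last_id[of fs] by (simp add: xs_def f_def butlast_conv_take)
  have xs: "set xs \<subseteq> I \<inter> G d" and f: "f \<in> I \<inter> G d" using assms(7) fs by auto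
  have lf: "leading_forms_regular xs" using xs assms(8) by (intro leading_forms_regularI) (auto simp: xs_def)
  have red: "reduction R (Idl (insert f (set xs))) I" using assms(9) fs by simp
  have spread: "analytic_spread R G I = enat (Suc g)"
  proof -
    have "analytic_spread R G I - enat g = 1" using assms(4,5) by (simp add: analytic_deviation_def)
    thus ?thesis by (cases "analytic_spread R G I") (auto simp: one_enat_def)
  qed
  have len: "length xs = g" using assms(6) by (simp add: xs_def)
  have dim: "krull_dim F = enat (Suc (length xs))"
    using spread len by (simp add: analytic_spread_def special_fiber_eq)
  have bl: "butlast fs = xs" "last fs = f" using fs by simp_all
  have xsc: "set xs \<subseteq> carrier R" using xs G_carrier by blast
  note Io = ideal_ops[OF genideal_ideal[OF xsc]]
  have fc: "f \<in> carrier R" using f by auto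
  have "analytically_tight R G d I fs \<longleftrightarrow> (\<forall>n\<ge>1. \<forall>a\<in>Ipiece n. a \<otimes> f \<in> Idl (set xs) \<longrightarrow> a \<in> Idl (set xs))"
  proof -
    have "colon R (Idl (set xs)) f \<inter> Ipow n \<inter> G (n * d) = Idl (set xs) \<inter> Ipow n \<inter> G (n * d) \<longleftrightarrow>
        (\<forall>a\<in>Ipiece n. a \<otimes> f \<in> Idl (set xs) \<longrightarrow> a \<in> Idl (set xs))" for n
      using Io(7)[OF _ fc] Io(8) Ipiece_carrier[of _ n] unfolding colon_def Ipiece_def by blast
    thus ?thesis
      unfolding analytically_tight_def analytically_tight_in_power_def bl
      using assms(6,7) spread by (simp add: Ipow_def)
  qed
  also have "\<dots> \<longleftrightarrow> cohen_macaulay F" by (rule tight_iff_cohen_macaulay[OF assms(2) xs f lf red dim])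
  finally show ?thesis by (simp add: special_fiber_eq)
qed

end
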